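(* Let $\Omega\subseteq\mathbb{R}^d$ be a domain and let $(H_s)_{s\in[0,1]}$ be an admissible bundle of reproducing kernel Hilbert spaces of vector fields on $\Omega$ (with Lebesgue measure on $[0,1]$) ordered by inclusion, $H_s\subseteq H_t$ for $s\le t$. Let $v=(v_s(t))_{s,t\in[0,1]}$, $v_s(t)\in H_s$, be a time-dependent one-parameter family of vector fields, $v\in L^2([0,1],V)$. For each fixed $s$ let $t\mapsto\psi_s(t)$ be the flow in $t$ of the time-dependent vector field $\int_0^sv_r(t)\,\mathrm{d}r$. Then, for each fixed $t$, the one-parameter family $s\mapsto\psi_s(t)$ is the flow in $s$ of the vector field $$\mathrm{Ad}_{\psi_s(t)}\int_0^t\mathrm{Ad}_{\psi_s(r)^{-1}}v_s(r)\,\mathrm{d}r.$$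
   Context: An admissible reproducing kernel Hilbert space of vector fields on $\Omega$ is a Hilbert space $H$ of $C^1$ vector fields $\Omega\to\mathbb{R}^d$ such that $\|v\|_{1,\infty}\le M\|v\|_H$ for all $v\in H$ and some constant $M$. The family $(H_s)_{s\in[0,1]}$ is an admissible bundle if: (1) for each $s$ there is $M_s>0$ with $\|v\|_{1,\infty}\le M_s\|v\|_{H_s}$ for all $v\in H_s$; (2) $(s,x,y)\mapsto\mathsf{k}_s(x,y)$ is Borel measurable, $\mathsf{k}_s$ being the reproducing kernel of $H_s$; (3) $s\mapsto M_s$ is Borel measurable with $\int_0^1M_s^2\,\mathrm{d}s<\infty$. The space $V$ consists of the $u\in L^2([0,1]\times\Omega)$ such that $s\mapsto u(s,x)$ is measurable for all $x\in\Omega$, $s\mapsto\|u(s,\cdot)\|_{H_s}$ is measurable, and $\|u\|_V^2=\int_0^1\|u(s,\cdot)\|_{H_s}^2\,\mathrm{d}s<\infty$; we write $u_s=u(s,\cdot)$. All vector fields vanish on the boundary of $\Omega$, so that flows are well defined. The flow in a parameter $\tau$ (starting at $\tau=0$) of a $\tau$-dependent vector field $w(\tau)$ is the solution of $\partial_\tau\varphi(\tau)=w(\tau)\circ\varphi(\tau)$, $\varphi(0)=\mathrm{Id}$ (understood for a.e. $\tau$, i.e. in integrated form). For a diffeomorphism $\varphi$ and a vector field $w$, $\mathrm{Ad}_\varphi w=(D\varphi\cdot w)\circ\varphi^{-1}$. *)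

theory Defs
  imports "HOL-Analysis.Analysis"
begin

(* A vector field on Omega is a total function that is 0 off Omega, so that two fields are equal
   as functions iff they agree on Omega. *)

definition C1_on :: "(real^'n) set \<Rightarrow> (real^'n \<Rightarrow> real^'n) \<Rightarrow> bool" where
  "C1_on \<Omega> f \<longleftrightarrow>
     (\<exists>f'. (\<forall>x\<in>\<Omega>. (f has_derivative blinfun_apply (f' x)) (at x)) \<and> continuous_on \<Omega> f')"

definition C1_fields :: "(real^'n) set \<Rightarrow> (real^'n \<Rightarrow> real^'n) set" where
  "C1_fields \<Omega> = {v. C1_on \<Omega> v \<and> (\<forall>x. x \<notin> \<Omega> \<longrightarrow> v x = 0)
                     \<and> (\<forall>p\<in>frontier \<Omega>. (v \<longlongrightarrow> 0) (at p within \<Omega>))}"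

(* The norm with values in [0,\<infinity>], so that no boundedness has to be presupposed. *)
definition norm_1_inf :: "(real^'n) set \<Rightarrow> (real^'n \<Rightarrow> real^'n) \<Rightarrow> ennreal" where
  "norm_1_inf \<Omega> v = (SUP x\<in>\<Omega>. ennreal (norm (v x)))
                    + (SUP x\<in>\<Omega>. ennreal (onorm (frechet_derivative v (at x))))"

(* Hilbert spaces of vector fields vary with a parameter, so they are given by a carrier H and an
   inner product ip, of which only the values on H matter. *)

definition ip_norm :: "('a \<Rightarrow> 'a \<Rightarrow> real) \<Rightarrow> 'a \<Rightarrow> real" where
  "ip_norm ip u = sqrt (ip u u)"

definition hilbert_space_of_fields ::
  "(real^'n \<Rightarrow> real^'n) set \<Rightarrow> ((real^'n \<Rightarrow> real^'n) \<Rightarrow> (real^'n \<Rightarrow> real^'n) \<Rightarrow> real) \<Rightarrow> bool" where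
  "hilbert_space_of_fields H ip \<longleftrightarrow>
     (\<lambda>x. 0) \<in> H \<and>
     (\<forall>u\<in>H. \<forall>w\<in>H. \<forall>a b. (\<lambda>x. a *\<^sub>R u x + b *\<^sub>R w x) \<in> H) \<and>
     (\<forall>u\<in>H. \<forall>w\<in>H. ip u w = ip w u) \<and>
     (\<forall>u\<in>H. \<forall>w\<in>H. \<forall>z\<in>H. \<forall>a b. ip (\<lambda>x. a *\<^sub>R u x + b *\<^sub>R w x) z = a * ip u z + b * ip w z) \<and>
     (\<forall>u\<in>H. 0 \<le> ip u u \<and> (ip u u = 0 \<longrightarrow> u = (\<lambda>x. 0))) \<and>
     Metric_space.mcomplete H (\<lambda>u w. ip_norm ip (\<lambda>x. u x - w x))"

definition admissible_rkhs ::
  "(real^'n) set \<Rightarrow> (real^'n \<Rightarrow> real^'n) set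
     \<Rightarrow> ((real^'n \<Rightarrow> real^'n) \<Rightarrow> (real^'n \<Rightarrow> real^'n) \<Rightarrow> real) \<Rightarrow> real \<Rightarrow> bool" where
  "admissible_rkhs \<Omega> H ip M \<longleftrightarrow>
     hilbert_space_of_fields H ip \<and> H \<subseteq> C1_fields \<Omega> \<and>
     (\<forall>v\<in>H. norm_1_inf \<Omega> v \<le> ennreal (M * ip_norm ip v))"

(* Matrix-valued kernel: k(.,y) a lies in H and represents v \<mapsto> a \<bullet> v(y). These conditions determine
   k on \<Omega> \<times> \<Omega>. *)
definition reproducing_kernel ::
  "(real^'n) set \<Rightarrow> (real^'n \<Rightarrow> real^'n) set
     \<Rightarrow> ((real^'n \<Rightarrow> real^'n) \<Rightarrow> (real^'n \<Rightarrow> real^'n) \<Rightarrow> real)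
     \<Rightarrow> (real^'n \<Rightarrow> real^'n \<Rightarrow> real^'n^'n) \<Rightarrow> bool" where
  "reproducing_kernel \<Omega> H ip k \<longleftrightarrow>
     (\<forall>y\<in>\<Omega>. \<forall>a. let ka = (\<lambda>x. if x \<in> \<Omega> then k x y *v a else 0)
                  in ka \<in> H \<and> (\<forall>v\<in>H. ip ka v = a \<bullet> v y))"

definition admissible_bundle ::
  "(real^'n) set \<Rightarrow> (real \<Rightarrow> (real^'n \<Rightarrow> real^'n) set)
     \<Rightarrow> (real \<Rightarrow> (real^'n \<Rightarrow> real^'n) \<Rightarrow> (real^'n \<Rightarrow> real^'n) \<Rightarrow> real) \<Rightarrow> bool" where
  "admissible_bundle \<Omega> H ip \<longleftrightarrow>
     (\<exists>M. (\<forall>s\<in>{0..1}. 0 < M s \<and> admissible_rkhs \<Omega> (H s) (ip s) (M s)) \<and>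
          M \<in> borel_measurable (restrict_space borel {0..1}) \<and>
          set_integrable lborel {0..1} (\<lambda>s. (M s)\<^sup>2)) \<and>
     (\<exists>k. (\<forall>s\<in>{0..1}. reproducing_kernel \<Omega> (H s) (ip s) (k s)) \<and>
          (\<lambda>(s, x, y). k s x y) \<in> borel_measurable (restrict_space borel ({0..1} \<times> \<Omega> \<times> \<Omega>)))"

(* Elements of V and of L^2([0,1],V) are kept as functions and not as classes of functions modulo
   null sets. V_norm is therefore only a seminorm on V_space. *)

definition V_space ::
  "(real^'n) set \<Rightarrow> (real \<Rightarrow> (real^'n \<Rightarrow> real^'n) set)
     \<Rightarrow> (real \<Rightarrow> (real^'n \<Rightarrow> real^'n) \<Rightarrow> (real^'n \<Rightarrow> real^'n) \<Rightarrow> real)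
     \<Rightarrow> (real \<Rightarrow> real^'n \<Rightarrow> real^'n) set" where
  "V_space \<Omega> H ip =
     {u. (\<lambda>(s, x). u s x) \<in> borel_measurable (lebesgue_on ({0..1} \<times> \<Omega>)) \<and>
         integrable (lebesgue_on ({0..1} \<times> \<Omega>)) (\<lambda>(s, x). (norm (u s x))\<^sup>2) \<and>
         (\<forall>x\<in>\<Omega>. (\<lambda>s. u s x) \<in> borel_measurable (lebesgue_on {0..1})) \<and>
         (\<forall>s\<in>{0..1}. u s \<in> H s) \<and>
         (\<lambda>s. ip_norm (ip s) (u s)) \<in> borel_measurable (lebesgue_on {0..1}) \<and>
         integrable (lebesgue_on {0..1}) (\<lambda>s. (ip_norm (ip s) (u s))\<^sup>2)}"

definition V_norm ::
  "(real \<Rightarrow> (real^'n \<Rightarrow> real^'n) \<Rightarrow> (real^'n \<Rightarrow> real^'n) \<Rightarrow> real)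
     \<Rightarrow> (real \<Rightarrow> real^'n \<Rightarrow> real^'n) \<Rightarrow> real" where
  "V_norm ip u = sqrt (LINT s|lebesgue_on {0..1}. (ip_norm (ip s) (u s))\<^sup>2)"

(* v t s is the field v_s(t). The second and third conditions are strong (Bochner) measurability
   into V and square integrability. An element of L^2([0,1],V) determines the map s \<mapsto> v_s(t) only up
   to a null set that may depend on t. Since integrals over t at fixed s have to make sense, the
   last condition requires the family to be a representative that is measurable jointly in (t,s),
   in the same sense in which V_space requires measurability of s \<mapsto> u(s,x) for every x.
   Every element of L^2([0,1],V) has such a representative. *)
definition L2_V ::
  "(real^'n) set \<Rightarrow> (real \<Rightarrow> (real^'n \<Rightarrow> real^'n) set)
     \<Rightarrow> (real \<Rightarrow> (real^'n \<Rightarrow> real^'n) \<Rightarrow> (real^'n \<Rightarrow> real^'n) \<Rightarrow> real)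
     \<Rightarrow> (real \<Rightarrow> real \<Rightarrow> real^'n \<Rightarrow> real^'n) set" where
  "L2_V \<Omega> H ip =
     {v. (\<forall>t\<in>{0..1}. v t \<in> V_space \<Omega> H ip) \<and>
         (\<exists>f. (\<forall>n. simple_function (lebesgue_on {0..1}) (f n) \<and> f n ` {0..1} \<subseteq> V_space \<Omega> H ip) \<and>
              (AE t in lebesgue_on {0..1}.
                 (\<lambda>n. V_norm ip (\<lambda>s x. f n t s x - v t s x)) \<longlonglongrightarrow> 0)) \<and>
         integrable (lebesgue_on {0..1}) (\<lambda>t. (V_norm ip (v t))\<^sup>2) \<and>
         (\<forall>x\<in>\<Omega>. (\<lambda>(t, s). v t s x) \<in> borel_measurable (lebesgue_on ({0..1} \<times> {0..1})))}"

(* The differential equation is required for almost every parameter, hence in integrated form.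
   Absolute integrability excludes the default value of an undefined integral. *)
definition is_flow ::
  "(real^'n) set \<Rightarrow> (real \<Rightarrow> real^'n \<Rightarrow> real^'n) \<Rightarrow> (real \<Rightarrow> real^'n \<Rightarrow> real^'n) \<Rightarrow> bool" where
  "is_flow \<Omega> w \<phi> \<longleftrightarrow>
     (\<forall>x\<in>\<Omega>. \<phi> 0 x = x \<and>
        (\<lambda>\<sigma>. w \<sigma> (\<phi> \<sigma> x)) absolutely_integrable_on {0..1} \<and>
        (\<forall>\<tau>\<in>{0..1}. \<phi> \<tau> x \<in> \<Omega> \<and> \<phi> \<tau> x = x + (LINT \<sigma>:{0..\<tau>}|lebesgue. w \<sigma> (\<phi> \<sigma> x))))"

definition is_C1_diffeo :: "(real^'n) set \<Rightarrow> (real^'n \<Rightarrow> real^'n) \<Rightarrow> bool" where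
  "is_C1_diffeo \<Omega> \<phi> \<longleftrightarrow> bij_betw \<phi> \<Omega> \<Omega> \<and> C1_on \<Omega> \<phi> \<and> C1_on \<Omega> (inv_into \<Omega> \<phi>)"

definition Ad ::
  "(real^'n) set \<Rightarrow> (real^'n \<Rightarrow> real^'n) \<Rightarrow> (real^'n \<Rightarrow> real^'n) \<Rightarrow> real^'n \<Rightarrow> real^'n" where
  "Ad \<Omega> \<phi> w y = (let x = inv_into \<Omega> \<phi> y in frechet_derivative \<phi> (at x) (w x))"

end

theory Submission
  imports Defs
begin

text \<open>
  Write \<open>W\<^sub>s(t) = \<integral>\<^sub>0\<^sup>s v\<^sub>r(t) dr\<close>. Since the fields vanish on the boundary, they extend by 0 to fields
  on the whole space whose Lipschitz constant is at most their \<open>C\<^sup>1\<close> norm, and by Cauchy-Schwarz these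
  norms are bounded by a function \<open>m(t, s)\<close> that is integrable on the unit square. So every \<open>W\<^sub>s\<close> is a
  field with an integrable Lipschitz constant, and the derivative \<open>J\<close> of its flow in the initial point
  solves \<open>J' = A J\<close> with \<open>A = DW\<^sub>s \<circ> \<psi>\<^sub>s\<close>. If \<open>K = J\<^sup>-\<^sup>1\<close>, then \<open>K' = - K A\<close>, hence the difference \<open>\<delta>\<close> of
  \<open>\<psi>\<^sub>s\<close> and a perturbed solution with forcing \<open>b\<close> satisfies \<open>(K \<delta>)' = K b + o(\<delta>)\<close>. With a perturbed initial
  point this gives differentiability in \<open>x\<close>. With \<open>b = (W\<^sub>u - W\<^sub>s) \<circ> \<psi>\<^sub>u\<close> it gives
  \<open>\<psi>\<^sub>u - \<psi>\<^sub>s = \<integral>\<^sub>s\<^sup>u (J \<integral>\<^sub>0\<^sup>t K (v\<^sub>\<sigma>(r) \<circ> \<psi>\<^sub>\<sigma>(r)) dr) d\<sigma> + o(\<alpha>(u) - \<alpha>(s))\<close> as \<open>u\<close> decreases to \<open>s\<close>, where \<open>\<alpha>\<close> is the primitive of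
  \<open>\<integral> m(t, \<sigma>) dt\<close>. A continuous function whose increments are \<open>o(\<alpha>(u) - \<alpha>(s))\<close> is constant, so the integral
  formula is exact.
\<close>

section \<open>Indefinite integrals on the real line\<close>

text \<open>The data are only measurable in \<open>t\<close> and in \<open>s\<close>, so every
  differential equation is an identity between primitives. Increments in \<open>s\<close> are
  measured by \<open>\<alpha>\<close> rather than by \<open>u - s\<close> because its density
  \<open>\<mu>\<close> is merely integrable. The increment of the flow is compared with the integral
  of \<open>G\<close> over the strip between \<open>s\<close> and \<open>u\<close>, not with
  \<open>u - s\<close> times a value at \<open>s\<close>. Only \<open>J\<close>, \<open>K\<close>
  and the trajectory, which depend continuously on the parameter, are ever frozen, while
  \<open>v\<close> stays under the integral. Hence the local estimate holds at every
  \<open>s\<close> and no Lebesgue points are chosen. A second obstacle is measurability: a jointly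
  Lebesgue measurable \<open>v\<close> may have bad sections and bad values along curves. It is
  replaced by a Borel field that vanishes off a set of full measure, one set for all points
  \<open>x\<close>. Integrals over \<open>s\<close> then agree for almost every \<open>t\<close>,
  integrals over \<open>t\<close> for almost every \<open>s\<close>, and this is enough for the two
  flow equations. The constant \<open>C = 2 * exp (2 * integral of l)\<close> comes from weights
  with exponent twice the primitive of \<open>l\<close>, for which one integration gains the factor
  1/2.\<close>

text \<open>Bochner integrals of operator-valued functions need this class.\<close>

instance blinfun :: (euclidean_space, euclidean_space) second_countable_topology
proof
  obtain D :: "real set" where D: "countable D" "\<And>X. open X \<Longrightarrow> X \<noteq> {} \<Longrightarrow> \<exists>d\<in>D. d \<in> X"
    using countable_dense_exists by metis
  let ?I = "Basis \<times> Basis :: ('b \<times> 'a) set"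
  let ?F = "PiE ?I (\<lambda>_. D)"
  \<comment> \<open>Operators with matrix entries in a countable dense set of reals are dense,
    because the operator norm is at most the sum of the moduli of the entries.\<close>
  define C where "C = (\<lambda>g. blinfun_of_matrix (\<lambda>i j. g (i, j)) :: 'a \<Rightarrow>\<^sub>L 'b) ` ?F"
  have cC: "countable C"
    unfolding C_def using D(1) by (intro countable_image countable_PiE) auto
  have dense: "\<exists>c\<in>C. dist c f < e" if e: "0 < e" for f :: "'a \<Rightarrow>\<^sub>L 'b" and e
  proof -
    \<comment> \<open>One tolerance for each matrix entry; the factor 2 makes their sum strictly
      smaller than \<open>e\<close>.\<close>
    define d where "d = e / (2 * real (card ?I))"
    have card: "card ?I > 0" by (simp add: card_gt_0_iff)
    have d: "d > 0" using e card by (simp add: d_def)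
    have "\<exists>q\<in>D. dist q (f (snd p) \<bullet> fst p) < d" for p :: "'b \<times> 'a"
      using D(2)[of "ball (f (snd p) \<bullet> fst p) d"] d by (auto simp: dist_commute)
    then obtain g0 where g0: "\<And>p. g0 p \<in> D" "\<And>p. dist (g0 p) (f (snd p) \<bullet> fst p) < d"
      by metis
    define g where "g = restrict g0 ?I"
    have g: "g \<in> ?F" using g0 by (auto simp: g_def)
    have "norm (blinfun_of_matrix (\<lambda>i j. g (i, j)) - f)
        = norm (blinfun_of_matrix ((\<lambda>i j. g (i, j)) - (\<lambda>i j. f j \<bullet> i)))"
      using blinfun_of_matrix_works[of f] by (simp add: blinfun_of_matrix_minus[symmetric])
    also have "\<dots> \<le> (\<Sum>i\<in>Basis. \<Sum>j\<in>Basis. \<bar>((\<lambda>i j. g (i, j)) - (\<lambda>i j. f j \<bullet> i)) i j\<bar>)"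
      by (rule norm_blinfun_of_matrix)
    also have "\<dots> = (\<Sum>p\<in>?I. dist (g p) (f (snd p) \<bullet> fst p))"
      by (simp add: sum.cartesian_product dist_real_def split_def)
    also have "\<dots> \<le> (\<Sum>p\<in>?I. d)"
      by (intro sum_mono) (use g0(2) in \<open>auto simp: g_def less_imp_le\<close>)
    also have "\<dots> < e" using e card by (simp add: d_def)
    finally show ?thesis using g by (auto simp: C_def dist_norm)
  qed
  define B where "B = (\<lambda>(c, n). ball c (inverse (real (Suc n)))) ` (C \<times> UNIV)"
  have "topological_basis B"
  proof (rule topological_basisI)
    fix b assume "b \<in> B" then show "open b" by (auto simp: B_def)
  next
    fix U :: "('a \<Rightarrow>\<^sub>L 'b) set" and f assume U: "open U" "f \<in> U"
    then obtain e where e: "e > 0" "ball f e \<subseteq> U" using open_contains_ball by blast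
    obtain n where n: "inverse (real (Suc n)) < e / 2" using reals_Archimedean[of "e/2"] e by auto
    obtain c where c: "c \<in> C" "dist c f < inverse (real (Suc n))"
      using dense[of "inverse (real (Suc n))" f] by auto
    have "ball c (inverse (real (Suc n))) \<subseteq> ball f e"
    proof
      fix h assume "h \<in> ball c (inverse (real (Suc n)))"
      then have "dist c h < inverse (real (Suc n))" by simp
      then show "h \<in> ball f e"
        using c(2) n dist_triangle2[of f h c] dist_triangle[of f h c] by (simp add: dist_commute)
    qed
    moreover have "ball c (inverse (real (Suc n))) \<in> B" using c(1) by (auto simp: B_def)
    ultimately show "\<exists>b\<in>B. f \<in> b \<and> b \<subseteq> U" using c(2) e by (meson mem_ball order_trans)
  qed
  moreover have "countable B" unfolding B_def using cC by auto
  ultimately show "\<exists>B :: ('a \<Rightarrow>\<^sub>L 'b) set set. countable B \<and> open = generate_topology B"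
    using topological_basis_imp_subbasis by blast
qed

text \<open>
  Integrating from \<open>-\<infinity>\<close> makes all identities below valid on the whole line, without clamping the time to
  an interval.
\<close>

definition primitive :: "'a::{banach,second_countable_topology} \<Rightarrow> (real \<Rightarrow> 'a) \<Rightarrow> real \<Rightarrow> 'a" where
  "primitive c g t = c + (LBINT \<tau>:{..t}. g \<tau>)"

lemma set_integrable_lborel_subset:
  fixes g :: "real \<Rightarrow> 'a::{banach,second_countable_topology}"
  assumes "integrable lborel g" "S \<in> sets borel"
  shows "set_integrable lborel S g"
  using set_integrable_subset[of lborel UNIV g S] assms by (auto simp: set_integrable_def)

lemma primitive_diff:
  fixes g :: "real \<Rightarrow> 'a::{banach,second_countable_topology}"
  assumes g: "integrable lborel g" and "a \<le> b"
  shows "primitive c g b - primitive c g a = (LBINT \<tau>:{a<..b}. g \<tau>)"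
proof -
  have "{..b} = {..a} \<union> {a<..b}" using assms by auto
  then have "(LBINT \<tau>:{..b}. g \<tau>) = (LBINT \<tau>:{..a}. g \<tau>) + (LBINT \<tau>:{a<..b}. g \<tau>)"
    by (metis (no_types, lifting) Int_emptyI atMost_iff g greaterThanAtMost_borel greaterThanAtMost_iff
        atMost_borel not_le set_integrable_lborel_subset set_integral_Un)
  then show ?thesis by (simp add: primitive_def)
qed

text \<open>If \<open>g\<close> is not integrable, its integral is 0 by convention, and
  \<open>h\<close> is nonnegative on \<open>S\<close>. So the bound can be used without checking the
  measurability of \<open>g\<close>.\<close>

lemma set_lebesgue_integral_norm_bound:
  fixes g :: "'b \<Rightarrow> 'a::{banach,second_countable_topology}"
  assumes "set_integrable M S h" "\<And>x. x \<in> S \<Longrightarrow> norm (g x) \<le> h x"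
  shows "norm (LINT x:S|M. g x) \<le> (LINT x:S|M. h x)"
proof (cases "set_integrable M S g")
  case True
  have "norm (LINT x:S|M. g x) \<le> (LINT x:S|M. norm (g x))"
    using set_integral_norm_bound[OF True] .
  also have "\<dots> \<le> (LINT x:S|M. h x)"
    by (intro set_integral_mono set_integrable_norm True assms)
  finally show ?thesis .
next
  case False
  then have "(LINT x:S|M. g x) = 0"
    by (simp add: set_lebesgue_integral_def set_integrable_def not_integrable_integral_eq)
  moreover have "0 \<le> (LINT x:S|M. h x)"
    unfolding set_lebesgue_integral_def
    by (intro Bochner_Integration.integral_nonneg)
      (use order_trans[OF norm_ge_zero assms(2)] in \<open>simp add: indicator_def\<close>)
  ultimately show ?thesis by simp
qed


lemma primitive_norm_diff_le:
  fixes g :: "real \<Rightarrow> 'a::{banach,second_countable_topology}"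
  assumes "integrable lborel g" "integrable lborel h" "\<And>x. norm (g x) \<le> h x" "a \<le> b"
  shows "norm (primitive c g b - primitive c g a) \<le> primitive d h b - primitive d h a"
  unfolding primitive_diff[OF assms(1,4)] primitive_diff[OF assms(2,4)]
  by (intro set_lebesgue_integral_norm_bound set_integrable_lborel_subset) (use assms in auto)

lemma primitive_norm_le:
  fixes g :: "real \<Rightarrow> 'a::{banach,second_countable_topology}"
  assumes "integrable lborel h" "\<And>x. norm (g x) \<le> h x"
  shows "norm (primitive c g t - c) \<le> integral\<^sup>L lborel h"
proof -
  have "norm (primitive c g t - c) \<le> (LBINT \<tau>:{..t}. h \<tau>)"
    unfolding primitive_def add_diff_cancel_left'
    by (intro set_lebesgue_integral_norm_bound set_integrable_lborel_subset) (use assms in auto)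
  also have "\<dots> \<le> integral\<^sup>L lborel h"
    unfolding set_lebesgue_integral_def
    by (intro integral_mono)
      (use set_integrable_lborel_subset[OF assms(1), of "{..t}"] assms order_trans[OF norm_ge_zero assms(2)]
       in \<open>auto simp: set_integrable_def indicator_def\<close>)
  finally show ?thesis .
qed

lemma tendsto_primitive:
  fixes g :: "real \<Rightarrow> 'a::{banach,second_countable_topology}"
  assumes g: "integrable lborel g" and X: "X \<longlonglongrightarrow> t"
  shows "(\<lambda>n. primitive c g (X n)) \<longlonglongrightarrow> primitive c g t"
  unfolding primitive_def set_lebesgue_integral_def
proof (intro tendsto_add tendsto_const integral_dominated_convergence)
  show "integrable lborel (\<lambda>x. norm (g x))" using g by simp
  \<comment> \<open>The indicators can fail to converge only at the endpoint \<open>t\<close>, a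
    null set.\<close>
  show "AE x in lborel. (\<lambda>n. indicator {..X n} x *\<^sub>R g x) \<longlonglongrightarrow> indicator {..t} x *\<^sub>R g x"
    using AE_lborel_singleton[of t]
  proof eventually_elim
    case (elim x)
    have "eventually (\<lambda>n. indicator {..X n} x = (indicator {..t} x :: real)) sequentially"
    proof (cases "x < t")
      case True
      show ?thesis
        by (rule eventually_mono[OF order_tendstoD(1)[OF X True]]) (use True in \<open>auto simp: indicator_def\<close>)
    next
      case False
      then have "t < x" using elim by auto
      show ?thesis
        by (rule eventually_mono[OF order_tendstoD(2)[OF X \<open>t < x\<close>]]) (use \<open>t < x\<close> in \<open>auto simp: indicator_def\<close>)
    qed
    then show ?case
      by (intro tendsto_scaleR tendsto_const) (simp add: tendsto_eventually)
  qed
qed (use g in \<open>auto simp: indicator_def\<close>)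

lemma continuous_primitive:
  fixes g :: "real \<Rightarrow> 'a::{banach,second_countable_topology}"
  assumes "integrable lborel g"
  shows "continuous_on UNIV (primitive c g)"
  using tendsto_primitive[OF assms]
  by (auto simp: continuous_on_eq_continuous_at continuous_at_sequentially o_def)

text \<open>Identities between primitives are first shown up to a constant with
  \<open>growth_zero\<close>; the constant is then read off at minus infinity.\<close>

lemma primitive_at_bot:
  fixes g :: "real \<Rightarrow> 'a::{banach,second_countable_topology}"
  assumes g: "integrable lborel g"
  shows "(\<lambda>n. primitive c g (- real n)) \<longlonglongrightarrow> c"
proof -
  have "(\<lambda>n. LINT x|lborel. indicator {..- real n} x *\<^sub>R g x) \<longlonglongrightarrow> (LINT x|(lborel::real measure). (0::'a))"
  proof (rule integral_dominated_convergence[where w="\<lambda>x. norm (g x)" and f="\<lambda>x. 0" and s="\<lambda>n x. indicator {..- real n} x *\<^sub>R g x"])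
    show "integrable lborel (\<lambda>x. norm (g x))" using g by simp
    show "AE x in lborel. norm (indicator {..- real n} x *\<^sub>R g x) \<le> norm (g x)" for n
      by (auto simp: indicator_def)
    show "AE x in lborel. (\<lambda>n. indicator {..- real n} x *\<^sub>R g x) \<longlonglongrightarrow> 0"
    proof (intro AE_I2 tendsto_eventually)
      fix x :: real
      obtain N where "- x < real N" using reals_Archimedean2 by blast
      then show "\<forall>\<^sub>F n in sequentially. indicator {..- real n} x *\<^sub>R g x = 0"
        by (auto intro!: eventually_sequentiallyI[of N])
    qed
  qed (use g in auto)
  then have "(\<lambda>n. primitive c g (- real n)) \<longlonglongrightarrow> c + 0"
    unfolding primitive_def set_lebesgue_integral_def by (intro tendsto_add tendsto_const) simp
  then show ?thesis by simp
qed

text \<open>Continuous induction: the points satisfying the estimate with respect to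
  \<open>a\<close> form a closed set, and at its maximum the local estimate would reach a slightly
  larger point unless the maximum is \<open>b\<close>.\<close>

lemma growth_le:
  fixes F :: "real \<Rightarrow> 'a::real_normed_vector" and A :: "real \<Rightarrow> real"
  assumes F: "continuous_on {a..b} F" and A: "continuous_on {a..b} A" and ab: "a \<le> b"
    and loc: "\<And>s. a \<le> s \<Longrightarrow> s < b \<Longrightarrow>
                \<forall>\<^sub>F u in at_right s. norm (F u - F s) \<le> e * (A u - A s)"
  shows "norm (F b - F a) \<le> e * (A b - A a)"
proof -
  define S where "S = {s \<in> {a..b}. norm (F s - F a) \<le> e * (A s - A a)}"
  have cl: "closed S" unfolding S_def
    by (intro continuous_on_closed_Collect_le continuous_intros F A closed_real_atLeastAtMost)
  have aS: "a \<in> S" using ab by (auto simp: S_def)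
  have bdd: "bdd_above S" by (auto simp: S_def)
  define m where "m = Sup S"
  have mS: "m \<in> S" unfolding m_def using closed_contains_Sup[OF _ bdd cl] aS by auto
  have "m = b"
  proof (rule ccontr)
    assume "m \<noteq> b"
    then have "a \<le> m" "m < b" using mS by (auto simp: S_def)
    have "\<forall>\<^sub>F u in at_right m. norm (F u - F m) \<le> e * (A u - A m) \<and> m < u \<and> u < b"
      using loc[OF \<open>a \<le> m\<close> \<open>m < b\<close>] eventually_at_right_less[of m] eventually_at_right_real[OF \<open>m < b\<close>]
      by eventually_elim auto
    then obtain u where u: "norm (F u - F m) \<le> e * (A u - A m)" "m < u" "u < b"
      using eventually_happens trivial_limit_at_right_real by blast
    have "norm (F u - F a) \<le> norm (F u - F m) + norm (F m - F a)"
      by (metis diff_add_cancel add_diff_eq norm_triangle_ineq)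
    also have "\<dots> \<le> e * (A u - A m) + e * (A m - A a)" using u mS by (auto simp: S_def)
    also have "\<dots> = e * (A u - A a)" by (simp add: algebra_simps)
    finally have "u \<in> S" using u \<open>a \<le> m\<close> by (auto simp: S_def)
    then have "u \<le> m" unfolding m_def using bdd by (rule cSup_upper)
    then show False using u by simp
  qed
  then show ?thesis using mS by (auto simp: S_def)
qed

text \<open>This replaces the Lebesgue differentiation theorem: with \<open>A\<close> the primitive of a bound it shows that
  two absolutely continuous functions with the same derivative differ by a constant.\<close>

lemma growth_zero:
  fixes F :: "real \<Rightarrow> 'a::real_normed_vector" and A :: "real \<Rightarrow> real"
  assumes F: "continuous_on UNIV F" and A: "continuous_on UNIV A"
    and loc: "\<And>s e. e > 0 \<Longrightarrow> \<forall>\<^sub>F u in at_right s. norm (F u - F s) \<le> e * (A u - A s)"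
  shows "F b = F a"
proof -
  have "F b = F a" if ab: "a \<le> b" for a b
  proof -
    have le: "norm (F b - F a) \<le> e * (A b - A a)" if "e > 0" for e
      by (rule growth_le) (use ab loc[OF that] continuous_on_subset[OF F] continuous_on_subset[OF A] in auto)
    have "((\<lambda>e. e * (A b - A a)) \<longlongrightarrow> 0 * (A b - A a)) (at_right 0)"
      by (intro tendsto_intros)
    moreover have "\<forall>\<^sub>F e in at_right 0. norm (F b - F a) \<le> e * (A b - A a)"
      using eventually_at_right_less[of 0] by eventually_elim (rule le)
    ultimately have "norm (F b - F a) \<le> 0"
      using tendsto_lowerbound[where F="at_right (0::real)"] by fastforce
    then show ?thesis by simp
  qed
  then show ?thesis by (metis linear)
qed

lemma bounded_continuous_mult_integrable:
  fixes f :: "real \<Rightarrow> 'a::{banach,second_countable_topology}"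
    and g :: "real \<Rightarrow> 'b::{banach,second_countable_topology}"
    and prod :: "'a \<Rightarrow> 'b \<Rightarrow> 'c::{banach,second_countable_topology}"
  assumes "bounded_bilinear prod" and f: "f \<in> borel_measurable borel" "\<And>x. norm (f x) \<le> C"
    and g: "integrable lborel g"
  shows "integrable lborel (\<lambda>x. prod (f x) (g x))"
proof -
  interpret bounded_bilinear prod by fact
  obtain K where K: "\<And>a b. norm (prod a b) \<le> norm a * norm b * K" "K > 0" using pos_bounded by blast
  have [measurable]: "g \<in> borel_measurable borel" using g by auto
  have m: "(\<lambda>x. prod (f x) (g x)) \<in> borel_measurable borel"
    by (rule borel_measurable_continuous_Pair[OF f(1)])
      (auto intro!: continuous_on continuous_intros)
  show ?thesis
  proof (rule Bochner_Integration.integrable_bound)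
    show "integrable lborel (\<lambda>x. C * K * norm (g x))" using g by simp
    show "AE x in lborel. norm (prod (f x) (g x)) \<le> norm (C * K * norm (g x))"
    proof (intro AE_I2)
      fix x
      have "norm (prod (f x) (g x)) \<le> norm (f x) * norm (g x) * K" by (rule K)
      also have "\<dots> \<le> C * norm (g x) * K"
        using f(2) K(2) by (intro mult_right_mono) auto
      finally show "norm (prod (f x) (g x)) \<le> norm (C * K * norm (g x))" 
        by (simp add: mult_ac)
    qed
  qed (use m in simp)
qed

lemma norm_primitive_le:
  fixes g :: "real \<Rightarrow> 'a::{banach,second_countable_topology}"
  assumes "integrable lborel g"
  shows "norm (primitive c g t) \<le> norm c + (LBINT x. norm (g x))"
  using primitive_norm_le[of "\<lambda>x. norm (g x)" g c t] assms norm_triangle_sub[of "primitive c g t" c]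
  by auto

lemma borel_measurable_primitive:
  fixes g :: "real \<Rightarrow> 'a::{banach,second_countable_topology}"
  assumes "integrable lborel g"
  shows "primitive c g \<in> borel_measurable borel"
  using continuous_primitive[OF assms] by (rule borel_measurable_continuous_onI)

text \<open>Integration by parts. On a short interval the increment of the product is an integral
  with one factor frozen at an endpoint; unfreezing costs the oscillation of the continuous
  primitives times \<open>norm (f \<tau>) + norm (g \<tau>)\<close>, so \<open>growth_zero\<close>
  applies with the primitive of this sum.\<close>

lemma primitive_product:
  fixes f :: "real \<Rightarrow> 'a::{banach,second_countable_topology}"
    and g :: "real \<Rightarrow> 'b::{banach,second_countable_topology}"
    and prod :: "'a \<Rightarrow> 'b \<Rightarrow> 'c::{banach,second_countable_topology}"
  assumes bil: "bounded_bilinear prod" and f: "integrable lborel f" and g: "integrable lborel g"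
  shows "prod (primitive c f t) (primitive d g t) =
    primitive (prod c d) (\<lambda>\<tau>. prod (f \<tau>) (primitive d g \<tau>) + prod (primitive c f \<tau>) (g \<tau>)) t"
    (is "_ = primitive _ ?h t")
proof -
  interpret bounded_bilinear prod by fact
  let ?f = "primitive c f" and ?g = "primitive d g"
  have i1: "integrable lborel (\<lambda>\<tau>. prod (f \<tau>) (?g \<tau>))"
    using bounded_continuous_mult_integrable[OF flip borel_measurable_primitive norm_primitive_le] f g by blast
  have i2: "integrable lborel (\<lambda>\<tau>. prod (?f \<tau>) (g \<tau>))"
    using bounded_continuous_mult_integrable[OF bil borel_measurable_primitive norm_primitive_le] f g by blast
  have ih: "integrable lborel ?h" using i1 i2 by simp
  have cf: "continuous_on UNIV ?f" and cg: "continuous_on UNIV ?g" and ch: "continuous_on UNIV (primitive (prod c d) ?h)"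
    using continuous_primitive f g ih by blast+
  obtain K where K: "\<And>a b. norm (prod a b) \<le> norm a * norm b * K" "K > 0" using pos_bounded by blast
  define F where "F t = prod (?f t) (?g t) - primitive (prod c d) ?h t" for t
  let ?n = "\<lambda>\<tau>. norm (f \<tau>) + norm (g \<tau>)"
  have inn: "integrable lborel ?n" using f g by simp
  have const: "F b = F a" for a b
  proof (rule growth_zero)
    show "continuous_on UNIV F" unfolding F_def
      by (intro continuous_intros continuous_on cf cg ch)
    show "continuous_on UNIV (primitive 0 ?n)" by (rule continuous_primitive[OF inn])
    fix s e :: real assume e: "e > 0"
    \<comment> \<open>\<open>K\<close> bounds the bilinear map. The comparison of
      \<open>?g u\<close> with \<open>?g \<tau>\<close> passes through \<open>?g s\<close> and uses
      the tolerance twice, which leaves \<open>e / K\<close>.\<close>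
    have e': "e / (2 * K) > 0" using e K by simp
    have "(?f \<longlongrightarrow> ?f s) (at_right s)" "(?g \<longlongrightarrow> ?g s) (at_right s)"
      using cf cg by (auto simp: continuous_on_eq_continuous_at continuous_at intro: tendsto_within_subset)
    then have "\<forall>\<^sub>F u in at_right s. dist (?f u) (?f s) < e / (2*K)" "\<forall>\<^sub>F u in at_right s. dist (?g u) (?g s) < e / (2*K)"
      using e' by (auto dest: tendstoD)
    then have "\<forall>\<^sub>F u in at_right s. dist (?f u) (?f s) < e / (2*K) \<and> dist (?g u) (?g s) < e / (2*K)"
      by (rule eventually_conj)
    then obtain b where b: "s < b" "\<And>u. s < u \<Longrightarrow> u < b \<Longrightarrow> dist (?f u) (?f s) < e / (2*K) \<and> dist (?g u) (?g s) < e / (2*K)"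
      unfolding eventually_at_right_field by blast
    show "\<forall>\<^sub>F u in at_right s. norm (F u - F s) \<le> e * (primitive 0 ?n u - primitive 0 ?n s)"
      using eventually_at_right_real[OF b(1)]
    proof eventually_elim
      case (elim u)
      then have su: "s \<le> u" by simp
      have r: "set_integrable lborel {s<..u} h" if "integrable lborel h" for h :: "real \<Rightarrow> 'z::{banach,second_countable_topology}"
        using that by (rule set_integrable_lborel_subset) simp
      have 1: "prod (?f u - ?f s) (?g u) = (LBINT \<tau>:{s<..u}. prod (f \<tau>) (?g u))"
        unfolding primitive_diff[OF f su] set_lebesgue_integral_def
        using integral_bounded_linear[OF bounded_linear_left[of "?g u"] r[OF f, unfolded set_integrable_def]]
        by (simp add: scaleR_left)
      have 2: "prod (?f s) (?g u - ?g s) = (LBINT \<tau>:{s<..u}. prod (?f s) (g \<tau>))"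
        unfolding primitive_diff[OF g su] set_lebesgue_integral_def
        using integral_bounded_linear[OF bounded_linear_right[of "?f s"] r[OF g, unfolded set_integrable_def]]
        by (simp add: scaleR_right)
      have j1: "integrable lborel (\<lambda>\<tau>. prod (f \<tau>) (?g u))"
        by (rule integrable_bounded_linear[OF bounded_linear_left]) (use f in auto)
      have j2: "integrable lborel (\<lambda>\<tau>. prod (?f s) (g \<tau>))"
        by (rule integrable_bounded_linear[OF bounded_linear_right]) (use g in auto)
      have "F u - F s = prod (?f u - ?f s) (?g u) + prod (?f s) (?g u - ?g s)
            - (primitive (prod c d) ?h u - primitive (prod c d) ?h s)"
        by (simp add: F_def diff_left diff_right)
      also have "\<dots> = (LBINT \<tau>:{s<..u}. (prod (f \<tau>) (?g u) + prod (?f s) (g \<tau>)) - ?h \<tau>)"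
        unfolding 1 2 primitive_diff[OF ih su]
        by (subst set_integral_diff, rule r, use j1 j2 in simp, rule r[OF ih])
          (subst set_integral_add(2), use j1 j2 in \<open>auto intro: r\<close>)
      also have "norm \<dots> \<le> (LBINT \<tau>:{s<..u}. e * ?n \<tau>)"
      proof (rule set_lebesgue_integral_norm_bound)
        show "set_integrable lborel {s<..u} (\<lambda>\<tau>. e * ?n \<tau>)" using inn by (intro r) simp
        fix \<tau> assume t: "\<tau> \<in> {s<..u}"
        have "dist (?g u) (?g s) < e / (2*K)" "dist (?g \<tau>) (?g s) < e / (2*K)" "dist (?f \<tau>) (?f s) < e / (2*K)"
          using b(2) elim t by auto
        moreover have "dist (?g u) (?g \<tau>) \<le> dist (?g u) (?g s) + dist (?g \<tau>) (?g s)"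
          by (rule dist_triangle2)
        moreover have "e / K = e / (2*K) + e / (2*K)" using K(2) by (simp add: field_simps)
        moreover have "e / (2*K) \<le> e / K" using K(2) e by (simp add: field_simps)
        ultimately have d: "norm (?g u - ?g \<tau>) \<le> e / K" "norm (?f s - ?f \<tau>) \<le> e / K"
          unfolding dist_norm[symmetric] dist_commute[of "?f s"] by linarith+
        have "prod (f \<tau>) (?g u) + prod (?f s) (g \<tau>) - ?h \<tau> = prod (f \<tau>) (?g u - ?g \<tau>) + prod (?f s - ?f \<tau>) (g \<tau>)"
          by (simp add: diff_left diff_right)
        also have "norm \<dots> \<le> norm (f \<tau>) * norm (?g u - ?g \<tau>) * K + norm (?f s - ?f \<tau>) * norm (g \<tau>) * K"
          by (intro order_trans[OF norm_triangle_ineq] add_mono K)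
        also have "\<dots> \<le> norm (f \<tau>) * (e / K) * K + (e / K) * norm (g \<tau>) * K"
          using d K(2) by (intro add_mono mult_right_mono mult_left_mono) auto
        also have "\<dots> = e * ?n \<tau>" using K(2) by (simp add: field_simps)
        finally show "norm (prod (f \<tau>) (?g u) + prod (?f s) (g \<tau>) - ?h \<tau>) \<le> e * ?n \<tau>" .
      qed
      also have "\<dots> = e * (primitive 0 ?n u - primitive 0 ?n s)"
        unfolding primitive_diff[OF inn su] by (rule set_integral_mult_right)
      finally show ?case .
    qed
  qed
  \<comment> \<open>The constant value of \<open>F\<close> is its limit at minus infinity, where
    both terms equal \<open>prod c d\<close>.\<close>
  have "(\<lambda>n. F (- real n)) \<longlonglongrightarrow> prod c d - prod c d"
    unfolding F_def by (intro tendsto_diff tendsto primitive_at_bot f g ih)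
  moreover have "(\<lambda>n. F (- real n)) = (\<lambda>n. F t)" by (rule ext) (rule const)
  ultimately have "F t = 0" by (simp add: LIMSEQ_const_iff)
  then show ?thesis by (simp add: F_def)
qed

section \<open>Gronwall inequalities and linear equations with integrable coefficients\<close>

text \<open>By convexity the increment of \<open>exp\<close> lies between
  \<open>exp u * (v - u)\<close> and \<open>exp v * (v - u)\<close>, and these differ by the
  right-hand side.\<close>

lemma exp_increment: "\<bar>exp v - exp u - exp u * (v - u)\<bar> \<le> \<bar>exp v - exp u\<bar> * \<bar>v - u\<bar>" for u v :: real
proof -
  have "exp u * (v - u) \<le> exp v - exp u" for u v :: real
    using exp_ge_add_one_self[of "v - u"] by (simp add: exp_diff field_simps)
  from this[of u v] this[of v u] show ?thesis
    unfolding abs_mult[symmetric] by (auto simp: algebra_simps abs_le_iff)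
qed

text \<open>The chain rule, by the local comparison that proves \<open>primitive_product\<close>;
  the nonlinear error is \<open>exp_increment\<close>.\<close>

lemma primitive_exp:
  fixes g :: "real \<Rightarrow> real"
  assumes g: "integrable lborel g"
  shows "integrable lborel (\<lambda>\<tau>. exp (primitive a g \<tau>) * g \<tau>)"
    and "exp (primitive a g t) = primitive (exp a) (\<lambda>\<tau>. exp (primitive a g \<tau>) * g \<tau>) t"
proof -
  let ?E = "\<lambda>\<tau>. exp (primitive a g \<tau>)"
  have cE: "continuous_on UNIV ?E" by (intro continuous_intros continuous_primitive g)
  show ih: "integrable lborel (\<lambda>\<tau>. ?E \<tau> * g \<tau>)"
  proof (rule bounded_continuous_mult_integrable[OF bounded_bilinear_mult _ _ g])
    show "?E \<in> borel_measurable borel" by (rule borel_measurable_continuous_onI[OF cE])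
    show "norm (?E x) \<le> exp (norm a + (LBINT x. norm (g x)))" for x
      using norm_primitive_le[OF g, of a x] by simp
  qed
  let ?h = "primitive (exp a) (\<lambda>\<tau>. ?E \<tau> * g \<tau>)" and ?n = "\<lambda>x. \<bar>g x\<bar>"
  have inn: "integrable lborel ?n" using g by simp
  have const: "?E q - ?h q = ?E p - ?h p" for p q
  proof (rule growth_zero[where F="\<lambda>t. ?E t - ?h t" and A="primitive 0 ?n"])
    show "continuous_on UNIV (\<lambda>t. ?E t - ?h t)" by (intro continuous_on_diff cE continuous_primitive ih)
    show "continuous_on UNIV (primitive 0 ?n)" by (rule continuous_primitive[OF inn])
    fix s e :: real assume e: "e > 0"
    have "(?E \<longlongrightarrow> ?E s) (at_right s)"
      using cE by (auto simp: continuous_on_eq_continuous_at continuous_at intro: tendsto_within_subset)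
    then have "\<forall>\<^sub>F u in at_right s. dist (?E u) (?E s) < e / 3" using e by (intro tendstoD) auto
    then obtain b where b: "s < b" "\<And>u. s < u \<Longrightarrow> u < b \<Longrightarrow> dist (?E u) (?E s) < e / 3"
      unfolding eventually_at_right_field by blast
    show "\<forall>\<^sub>F u in at_right s. norm (?E u - ?h u - (?E s - ?h s)) \<le> e * (primitive 0 ?n u - primitive 0 ?n s)"
      using eventually_at_right_real[OF b(1)]
    proof eventually_elim
      case (elim u)
      then have su: "s \<le> u" by simp
      let ?d = "primitive a g u - primitive a g s" and ?N = "primitive 0 ?n u - primitive 0 ?n s"
      have N: "?N = (LBINT \<tau>:{s<..u}. ?n \<tau>)" by (rule primitive_diff[OF inn su])
      have d: "\<bar>?d\<bar> \<le> ?N"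
        using primitive_norm_diff_le[OF g inn _ su, of a 0] by simp
      have 1: "\<bar>?E u - ?E s - ?E s * ?d\<bar> \<le> e / 3 * ?N"
      proof -
        have "\<bar>?E u - ?E s - ?E s * ?d\<bar> \<le> \<bar>?E u - ?E s\<bar> * \<bar>?d\<bar>" by (rule exp_increment)
        also have "\<dots> \<le> e / 3 * ?N"
          using b(2)[of u] elim e d by (intro mult_mono) (auto simp: dist_real_def)
        finally show ?thesis .
      qed
      have "?E s * ?d - (?h u - ?h s) = (LBINT \<tau>:{s<..u}. ?E s * g \<tau> - ?E \<tau> * g \<tau>)"
        unfolding primitive_diff[OF g su] primitive_diff[OF ih su] set_integral_mult_right[symmetric]
        by (rule set_integral_diff(2)[symmetric]; rule set_integrable_lborel_subset) (use g ih in auto)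
      also have "norm \<dots> \<le> (LBINT \<tau>:{s<..u}. e / 3 * ?n \<tau>)"
      proof (rule set_lebesgue_integral_norm_bound)
        show "set_integrable lborel {s<..u} (\<lambda>\<tau>. e / 3 * ?n \<tau>)" using inn by (intro set_integrable_lborel_subset) auto
        fix \<tau> assume "\<tau> \<in> {s<..u}"
        then have "\<bar>?E s - ?E \<tau>\<bar> \<le> e / 3" using b(2)[of \<tau>] elim by (auto simp: dist_real_def abs_minus_commute)
        then show "norm (?E s * g \<tau> - ?E \<tau> * g \<tau>) \<le> e / 3 * ?n \<tau>"
          unfolding left_diff_distrib[symmetric] real_norm_def abs_mult by (rule mult_right_mono) simp
      qed
      also have "\<dots> = e / 3 * ?N" unfolding N by (rule set_integral_mult_right)
      finally have 2: "\<bar>?E s * ?d - (?h u - ?h s)\<bar> \<le> e / 3 * ?N" by simp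
      have "0 \<le> e * ?N" using d e by (intro mult_nonneg_nonneg) auto
      then show ?case using 1 2 unfolding real_norm_def by linarith
    qed
  qed
  have "(\<lambda>n. ?E (- real n) - ?h (- real n)) \<longlonglongrightarrow> exp a - exp a"
    by (intro tendsto_diff tendsto_exp primitive_at_bot ih g)
  moreover have "(\<lambda>n. ?E (- real n) - ?h (- real n)) = (\<lambda>n. ?E t - ?h t)" by (rule ext) (rule const)
  ultimately show "?E t = ?h t" by (simp add: LIMSEQ_const_iff)
qed

text \<open>Evaluates the weights of the Gronwall and Picard arguments: \<open>k = 2\<close> for
  estimates from minus infinity on, \<open>k = -2\<close> for estimates backward in time.\<close>

lemma exp_weight:
  fixes l :: "real \<Rightarrow> real"
  assumes l: "integrable lborel l" and "k \<noteq> 0"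
  shows "integrable lborel (\<lambda>\<tau>. l \<tau> * exp (k * primitive 0 l \<tau>))"
    and "(LBINT \<tau>:{..t}. l \<tau> * exp (k * primitive 0 l \<tau>)) = (exp (k * primitive 0 l t) - 1) / k"
proof -
  have kl: "integrable lborel (\<lambda>\<tau>. k * l \<tau>)" using l by simp
  have p: "primitive 0 (\<lambda>\<tau>. k * l \<tau>) t = k * primitive 0 l t" for t by (simp add: primitive_def)
  have eq: "exp (k * primitive 0 l \<tau>) * (k * l \<tau>) = k * (l \<tau> * exp (k * primitive 0 l \<tau>))" for \<tau> by simp
  note e = primitive_exp[OF kl, of 0, unfolded p eq]
  show "integrable lborel (\<lambda>\<tau>. l \<tau> * exp (k * primitive 0 l \<tau>))"
    using integrable_mult_right[OF e(1), of "1/k"] \<open>k \<noteq> 0\<close> by simp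
  show "(LBINT \<tau>:{..t}. l \<tau> * exp (k * primitive 0 l \<tau>)) = (exp (k * primitive 0 l t) - 1) / k"
    using e(2)[of t] \<open>k \<noteq> 0\<close> by (simp add: primitive_def[of 1] field_simps)
qed

lemma primitive_nonneg_bounds:
  fixes l :: "real \<Rightarrow> real"
  assumes "integrable lborel l" "\<And>t. 0 \<le> l t"
  shows "0 \<le> primitive 0 l t" "primitive 0 l t \<le> integral\<^sup>L lborel l"
proof -
  show "0 \<le> primitive 0 l t"
    using assms by (auto simp: primitive_def set_lebesgue_integral_def intro!: Bochner_Integration.integral_nonneg)
  show "primitive 0 l t \<le> integral\<^sup>L lborel l"
    using primitive_norm_le[of l l 0 t] assms by auto
qed

lemma gronwall_forward:
  fixes u l :: "real \<Rightarrow> real"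
  assumes l: "integrable lborel l" "\<And>t. 0 \<le> l t" and a: "0 \<le> a"
    and u: "\<And>t. 0 \<le> u t" "\<And>t. u t \<le> B"
    and le: "\<And>t. u t \<le> a + (LBINT \<tau>:{..t}. l \<tau> * u \<tau>)"
  shows "u t \<le> 2 * exp (2 * integral\<^sup>L lborel l) * a"
proof -
  let ?L = "primitive 0 l"
  note L = primitive_nonneg_bounds[OF l]
  define S where "S = (SUP t. exp (-2 * ?L t) * u t)"
  have up: "exp (-2 * ?L t) * u t \<le> B" for t
  proof -
    have "exp (-2 * ?L t) * u t \<le> 1 * u t" using L[of t] u by (intro mult_right_mono) auto
    then show ?thesis using u(2)[of t] by simp
  qed
  have bdd: "bdd_above (range (\<lambda>t. exp (-2 * ?L t) * u t))" using up by (auto intro!: bdd_aboveI)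
  have Sup: "exp (-2 * ?L t) * u t \<le> S" for t unfolding S_def by (rule cSUP_upper[OF _ bdd]) simp
  have uS: "u t \<le> S * exp (2 * ?L t)" for t
  proof -
    have "u t = exp (2 * ?L t) * (exp (-2 * ?L t) * u t)" by (simp add: exp_minus)
    also have "\<dots> \<le> exp (2 * ?L t) * S" using Sup by (intro mult_left_mono) auto
    finally show ?thesis by (simp add: mult.commute)
  qed
  have S0: "0 \<le> S" using Sup[of 0] u(1)[of 0] by (meson exp_ge_zero mult_nonneg_nonneg order_trans)
  have w: "integrable lborel (\<lambda>\<tau>. S * (l \<tau> * exp (2 * ?L \<tau>)))"
    using exp_weight(1)[OF l(1), of 2] by simp
  have "exp (-2 * ?L t) * u t \<le> a + S / 2" for t
  proof -
    have "norm (LBINT \<tau>:{..t}. l \<tau> * u \<tau>) \<le> (LBINT \<tau>:{..t}. S * (l \<tau> * exp (2 * ?L \<tau>)))"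
    proof (rule set_lebesgue_integral_norm_bound[OF set_integrable_lborel_subset[OF w]])
      show "norm (l \<tau> * u \<tau>) \<le> S * (l \<tau> * exp (2 * ?L \<tau>))" for \<tau>
        using mult_left_mono[OF uS l(2), of \<tau> \<tau>] l(2)[of \<tau>] u(1)[of \<tau>] by (simp add: mult_ac)
    qed auto
    also have "\<dots> = S * ((exp (2 * ?L t) - 1) / 2)"
      using exp_weight(2)[OF l(1), of 2 t] by simp
    also have "\<dots> \<le> S / 2 * exp (2 * ?L t)" using S0 by (simp add: algebra_simps)
    finally have "u t \<le> a + S / 2 * exp (2 * ?L t)" using le[of t] by simp
    then have "exp (-2 * ?L t) * u t \<le> exp (-2 * ?L t) * (a + S / 2 * exp (2 * ?L t))"
      by (rule mult_left_mono) simp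
    also have "\<dots> = exp (-2 * ?L t) * a + S / 2" by (simp add: algebra_simps exp_minus)
    also have "\<dots> \<le> 1 * a + S / 2" using L[of t] a by (intro add_mono mult_right_mono) auto
    finally show ?thesis by simp
  qed
  then have "S \<le> a + S / 2" unfolding S_def by (intro cSUP_least) (auto simp: S_def[symmetric])
  then have "S \<le> 2 * a" by simp
  then have "S * exp (2 * ?L t) \<le> (2 * a) * exp (2 * integral\<^sup>L lborel l)"
    using S0 a L[of t] by (intro mult_mono) auto
  then show ?thesis using uS[of t] by (simp add: mult_ac)
qed

text \<open>The mirror image of \<open>gronwall_forward\<close> with the weight
  \<open>exp (2 * ?L t)\<close>. It multiplies \<open>a\<close> as well, and its upper bound is the
  exponential factor in the conclusion.\<close>

lemma gronwall_backward:
  fixes u l :: "real \<Rightarrow> real"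
  assumes l: "integrable lborel l" "\<And>t. 0 \<le> l t" and a: "0 \<le> a"
    and u: "\<And>t. 0 \<le> u t" "\<And>t. u t \<le> B"
    and le: "\<And>t. t \<le> b \<Longrightarrow> u t \<le> a + (LBINT \<tau>:{t<..b}. l \<tau> * u \<tau>)"
    and "t \<le> b"
  shows "u t \<le> 2 * exp (2 * integral\<^sup>L lborel l) * a"
proof -
  let ?L = "primitive 0 l" and ?I = "integral\<^sup>L lborel l"
  note L = primitive_nonneg_bounds[OF l]
  define S where "S = (SUP t\<in>{..b}. exp (2 * ?L t) * u t)"
  have up: "exp (2 * ?L t) * u t \<le> exp (2 * ?I) * B" for t
    using L[of t] u[of t] by (intro mult_mono) auto
  have bdd: "bdd_above ((\<lambda>t. exp (2 * ?L t) * u t) ` {..b})" using up by (auto intro!: bdd_aboveI)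
  have Sup: "exp (2 * ?L t) * u t \<le> S" if "t \<le> b" for t
    unfolding S_def by (rule cSUP_upper[OF _ bdd]) (use that in simp)
  have uS: "u t \<le> S * exp (-2 * ?L t)" if "t \<le> b" for t
  proof -
    have "u t = exp (-2 * ?L t) * (exp (2 * ?L t) * u t)" by (simp add: exp_minus)
    also have "\<dots> \<le> exp (-2 * ?L t) * S" using Sup[OF that] by (intro mult_left_mono) auto
    finally show ?thesis by (simp add: mult.commute)
  qed
  have S0: "0 \<le> S" using Sup[of b] u(1)[of b] by (meson exp_ge_zero mult_nonneg_nonneg order_trans order_refl)
  note wi = exp_weight(1)[OF l(1), of "-2", simplified]
  have w: "integrable lborel (\<lambda>\<tau>. S * (l \<tau> * exp (-2 * ?L \<tau>)))" using wi by simp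
  have "exp (2 * ?L t) * u t \<le> exp (2 * ?I) * a + S / 2" if "t \<le> b" for t
  proof -
    have "norm (LBINT \<tau>:{t<..b}. l \<tau> * u \<tau>) \<le> (LBINT \<tau>:{t<..b}. S * (l \<tau> * exp (-2 * ?L \<tau>)))"
    proof (rule set_lebesgue_integral_norm_bound[OF set_integrable_lborel_subset[OF w]])
      show "norm (l \<tau> * u \<tau>) \<le> S * (l \<tau> * exp (-2 * ?L \<tau>))" if "\<tau> \<in> {t<..b}" for \<tau>
        using mult_left_mono[OF uS l(2), of \<tau> \<tau>] l(2)[of \<tau>] u(1)[of \<tau>] that by (simp add: mult_ac)
    qed auto
    also have "\<dots> = S * (LBINT \<tau>:{t<..b}. l \<tau> * exp (-2 * ?L \<tau>))" by simp
    also have "\<dots> = S * ((exp (-2 * ?L t) - exp (-2 * ?L b)) / 2)"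
    proof -
      have "(LBINT \<tau>:{t<..b}. l \<tau> * exp (-2 * ?L \<tau>)) = (exp (-2 * ?L b) - 1) / (-2) - (exp (-2 * ?L t) - 1) / (-2)"
        (is "?i = _") using primitive_diff[OF wi that, of 0] exp_weight(2)[OF l(1), of "-2" b] exp_weight(2)[OF l(1), of "-2" t]
        unfolding primitive_def[of 0 "\<lambda>\<tau>. l \<tau> * exp (- (2 * ?L \<tau>))"] by simp
      then have "?i = (exp (-2 * ?L t) - exp (-2 * ?L b)) / 2" by (simp add: field_simps)
      then show ?thesis by simp
    qed
    also have "\<dots> \<le> S / 2 * exp (-2 * ?L t)" using S0 by (simp add: algebra_simps)
    finally have "u t \<le> a + S / 2 * exp (-2 * ?L t)" using le[OF that] by simp
    then have "exp (2 * ?L t) * u t \<le> exp (2 * ?L t) * (a + S / 2 * exp (-2 * ?L t))"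
      by (rule mult_left_mono) simp
    also have "\<dots> = exp (2 * ?L t) * a + S / 2" by (simp add: algebra_simps exp_minus)
    also have "\<dots> \<le> exp (2 * ?I) * a + S / 2" using L[of t] a by (intro add_mono mult_right_mono) auto
    finally show ?thesis by simp
  qed
  then have "S \<le> exp (2 * ?I) * a + S / 2"
    unfolding S_def by (intro cSUP_least) (auto simp: S_def[symmetric])
  then have "S \<le> 2 * exp (2 * ?I) * a" by simp
  moreover have "S * exp (-2 * ?L t) \<le> S * 1" using S0 L[of t] by (intro mult_left_mono) auto
  ultimately show ?thesis using uS[OF \<open>t \<le> b\<close>] by simp
qed

text \<open>The integrated form of \<open>u' = B u\<close> with value \<open>c\<close> at minus
  infinity. Integrability is included because a divergent integral would silently count as
  0.\<close>

definition linear_solution ::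
  "(real \<Rightarrow> 'e \<Rightarrow> 'e) \<Rightarrow> 'e \<Rightarrow> (real \<Rightarrow> 'e::{banach,second_countable_topology}) \<Rightarrow> bool" where
  "linear_solution B c u \<longleftrightarrow> integrable lborel (\<lambda>t. B t (u t)) \<and> (\<forall>t. u t = primitive c (\<lambda>t. B t (u t)) t)"

lemma linear_solutionD:
  assumes "linear_solution B c u"
  shows "integrable lborel (\<lambda>t. B t (u t))" "u t = primitive c (\<lambda>t. B t (u t)) t"
  by (rule assms[unfolded linear_solution_def, THEN conjunct1],
      rule assms[unfolded linear_solution_def, THEN conjunct2, THEN spec])

text \<open>The Picard operator contracts in the norm \<open>sup |e\<^sup>-\<^sup>2\<^sup>L u|\<close>, where \<open>L\<close> is the primitive of \<open>l\<close>.\<close>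

lemma linear_ode_exists:
  fixes B :: "real \<Rightarrow> 'e \<Rightarrow> 'e::{banach,second_countable_topology}"
  assumes l: "integrable lborel l" "\<And>t. 0 \<le> l t"
    and lin: "\<And>t y z. B t (y - z) = B t y - B t z"
    and bound: "\<And>t y. norm (B t y) \<le> l t * norm y"
    and meas: "\<And>u. continuous_on UNIV u \<Longrightarrow> (\<lambda>t. B t (u t)) \<in> borel_measurable borel"
  shows "\<exists>u. linear_solution B c u"
proof -
  let ?L = "primitive 0 l"
  note L = primitive_nonneg_bounds[OF l]
  have cL: "continuous_on UNIV ?L" by (rule continuous_primitive[OF l(1)])
  have int: "integrable lborel (\<lambda>t. B t (u t))"
    if "continuous_on UNIV u" "\<And>t. norm (u t) \<le> C" for u C
  proof (rule Bochner_Integration.integrable_bound)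
    show "integrable lborel (\<lambda>t. C * l t)" using l by simp
    show "AE t in lborel. norm (B t (u t)) \<le> norm (C * l t)"
      using order_trans[OF bound mult_left_mono[OF that(2) l(2)]]
      by (auto simp: mult.commute intro: order_trans[OF _ abs_ge_self])
  qed (use meas that in auto)
  \<comment> \<open>The fixed point is sought for the rescaled function \<open>w\<close>, which
    lives in the space of bounded continuous functions; \<open>V\<close> undoes the weight and
    \<open>T\<close> restores it.\<close>
  define V where "V w t = exp (2 * ?L t) *\<^sub>R apply_bcontfun w t" for w :: "real \<Rightarrow>\<^sub>C 'e" and t
  have cV: "continuous_on UNIV (V w)" for w
    unfolding V_def by (intro continuous_intros cL) auto
  have bV: "norm (V w t) \<le> exp (2 * integral\<^sup>L lborel l) * norm w" for w t
    unfolding V_def using L[of t] norm_bounded[of w t] by (auto intro!: mult_mono)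
  have iV: "integrable lborel (\<lambda>t. B t (V w t))" for w by (rule int[OF cV bV])
  define T where "T w t = exp (-2 * ?L t) *\<^sub>R primitive c (\<lambda>\<tau>. B \<tau> (V w \<tau>)) t" for w t
  have T: "T w \<in> bcontfun" for w
  proof (rule bcontfun_normI)
    show "continuous_on UNIV (T w)"
      unfolding T_def by (intro continuous_intros cL continuous_primitive iV)
    show "norm (T w t) \<le> 1 * (norm c + (LBINT t. norm (B t (V w t))))" for t
      unfolding T_def norm_scaleR using L[of t] norm_primitive_le[OF iV, of c w t]
      by (intro mult_mono) auto
  qed
  have "dist (Bcontfun (T w)) (Bcontfun (T z)) \<le> 1 / 2 * dist w z" for w z
  proof (rule dist_bound)
    fix t
    have w: "integrable lborel (\<lambda>\<tau>. dist w z * (l \<tau> * exp (2 * ?L \<tau>)))"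
      using exp_weight(1)[OF l(1), of 2] by simp
    have "T w t - T z t = exp (-2 * ?L t) *\<^sub>R (LBINT \<tau>:{..t}. B \<tau> (V w \<tau>) - B \<tau> (V z \<tau>))"
      unfolding T_def primitive_def scaleR_diff_right[symmetric]
      by (simp add: set_integral_diff(2)[OF set_integrable_lborel_subset[OF iV] set_integrable_lborel_subset[OF iV]])
    then have "norm (T w t - T z t) = exp (-2 * ?L t) * norm (LBINT \<tau>:{..t}. B \<tau> (V w \<tau>) - B \<tau> (V z \<tau>))"
      by simp
    also have "\<dots> \<le> exp (-2 * ?L t) * (LBINT \<tau>:{..t}. dist w z * (l \<tau> * exp (2 * ?L \<tau>)))"
    proof (intro mult_left_mono set_lebesgue_integral_norm_bound[OF set_integrable_lborel_subset[OF w]])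
      fix \<tau>
      have "norm (B \<tau> (V w \<tau>) - B \<tau> (V z \<tau>)) \<le> l \<tau> * norm (V w \<tau> - V z \<tau>)"
        unfolding lin[symmetric] by (rule bound)
      also have "\<dots> \<le> l \<tau> * (exp (2 * ?L \<tau>) * dist w z)"
        unfolding V_def scaleR_diff_right[symmetric] norm_scaleR
        using dist_bounded[of w \<tau> z] l by (intro mult_left_mono) (auto simp: dist_norm)
      finally show "norm (B \<tau> (V w \<tau>) - B \<tau> (V z \<tau>)) \<le> dist w z * (l \<tau> * exp (2 * ?L \<tau>))"
        by (simp add: mult_ac)
    qed auto
    \<comment> \<open>The weighted integral is \<open>(exp (2 * ?L t) - 1) / 2\<close>; dividing by
      the weight leaves less than 1/2, the contraction constant.\<close>
    also have "\<dots> = dist w z * ((1 - exp (- 2 * ?L t)) / 2)"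
    proof -
      have "(LBINT \<tau>:{..t}. dist w z * (l \<tau> * exp (2 * ?L \<tau>))) = dist w z * ((exp (2 * ?L t) - 1) / 2)"
        using exp_weight(2)[OF l(1), of 2 t] by simp
      then show ?thesis by (simp add: field_simps exp_minus)
    qed
    also have "\<dots> \<le> 1 / 2 * dist w z" by (simp add: algebra_simps)
    finally show "dist (apply_bcontfun (Bcontfun (T w)) t) (apply_bcontfun (Bcontfun (T z)) t) \<le> 1 / 2 * dist w z"
      by (simp add: Bcontfun_inverse[OF T] dist_norm)
  qed
  then have "\<exists>!w. Bcontfun (T w) = w" by (intro banach_fix_type[where c="1/2"]) auto
  then obtain w where w: "Bcontfun (T w) = w" by blast
  have "V w t = primitive c (\<lambda>\<tau>. B \<tau> (V w \<tau>)) t" for t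
  proof -
    have "apply_bcontfun w t = T w t" using Bcontfun_inverse[OF T, of w] w by simp
    then show ?thesis by (simp add: V_def[of w t] T_def exp_minus)
  qed
  then show ?thesis unfolding linear_solution_def using iV by blast
qed

lemma integrable_dominated:
  fixes f :: "real \<Rightarrow> 'a::{banach,second_countable_topology}"
  assumes "integrable lborel h" "f \<in> borel_measurable borel" "\<And>x. norm (f x) \<le> h x"
  shows "integrable lborel f"
  by (rule Bochner_Integration.integrable_bound[OF assms(1)])
    (use assms(2,3) order_trans[OF assms(3) abs_ge_self] in \<open>auto\<close>)

lemma set_integral_le_integral:
  fixes h :: "real \<Rightarrow> real"
  assumes "integrable lborel h" "\<And>x. 0 \<le> h x" "S \<in> sets borel"
  shows "(LBINT \<tau>:S. h \<tau>) \<le> integral\<^sup>L lborel h"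
  unfolding set_lebesgue_integral_def
  by (intro integral_mono)
    (use set_integrable_lborel_subset[OF assms(1,3)] assms in \<open>auto simp: set_integrable_def indicator_def\<close>)

lemma integrable_mult_norm_primitive:
  fixes h :: "real \<Rightarrow> 'a::{banach,second_countable_topology}" and l :: "real \<Rightarrow> real"
  assumes l: "integrable lborel l" and h: "integrable lborel h"
  shows "integrable lborel (\<lambda>t. l t * norm (primitive c h t))"
  by (subst mult.commute, rule bounded_continuous_mult_integrable[OF bounded_bilinear_mult _ _ l])
    (use borel_measurable_primitive[OF h, of c] norm_primitive_le[OF h, of c] in auto)

text \<open>Gronwall for a perturbed equation: the forcing \<open>b\<close> acts like an additional
  initial value of size its total integral. Integrability of \<open>h\<close> supplies the a priori
  bound that \<open>gronwall_forward\<close> asks for.\<close>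

lemma ode_bound:
  fixes h :: "real \<Rightarrow> 'a::{banach,second_countable_topology}"
  assumes l: "integrable lborel l" "\<And>t. 0 \<le> l t"
    and b: "integrable lborel b" "\<And>t. 0 \<le> b t"
    and h: "integrable lborel h" "\<And>\<tau>. norm (h \<tau>) \<le> l \<tau> * norm (primitive c h \<tau>) + b \<tau>"
  shows "norm (primitive c h t) \<le> 2 * exp (2 * integral\<^sup>L lborel l) * (norm c + integral\<^sup>L lborel b)"
proof (rule gronwall_forward[where u="\<lambda>t. norm (primitive c h t)", OF l])
  let ?u = "primitive c h"
  show "norm (?u t) \<le> norm c + (LBINT x. norm (h x))" for t by (rule norm_primitive_le[OF h(1)])
  have lu: "integrable lborel (\<lambda>t. l t * norm (?u t))" by (rule integrable_mult_norm_primitive[OF l(1) h(1)])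
  show "norm (?u t) \<le> norm c + integral\<^sup>L lborel b + (LBINT \<tau>:{..t}. l \<tau> * norm (?u \<tau>))" for t
  proof -
    have "norm (?u t) \<le> norm c + norm (LBINT \<tau>:{..t}. h \<tau>)"
      unfolding primitive_def by (rule norm_triangle_ineq)
    also have "norm (LBINT \<tau>:{..t}. h \<tau>) \<le> (LBINT \<tau>:{..t}. l \<tau> * norm (?u \<tau>) + b \<tau>)"
      using h(2) lu b by (intro set_lebesgue_integral_norm_bound set_integrable_lborel_subset) auto
    also have "\<dots> = (LBINT \<tau>:{..t}. l \<tau> * norm (?u \<tau>)) + (LBINT \<tau>:{..t}. b \<tau>)"
      using lu b by (intro set_integral_add(2) set_integrable_lborel_subset) auto
    also have "(LBINT \<tau>:{..t}. b \<tau>) \<le> integral\<^sup>L lborel b" 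
      using b by (intro set_integral_le_integral) auto
    finally show ?thesis by simp
  qed
qed (use b in \<open>auto intro!: add_nonneg_nonneg Bochner_Integration.integral_nonneg\<close>)

lemma ode_bound_homogeneous:
  fixes h :: "real \<Rightarrow> 'a::{banach,second_countable_topology}"
  assumes l: "integrable lborel l" "\<And>t. 0 \<le> l t"
    and h: "integrable lborel h" "\<And>\<tau>. norm (h \<tau>) \<le> l \<tau> * norm (primitive c h \<tau>)"
  shows "norm (primitive c h t) \<le> 2 * exp (2 * integral\<^sup>L lborel l) * norm c"
  using ode_bound[OF l, of "\<lambda>_. 0" h c t] h by simp

text \<open>Backward Gronwall bounds all earlier values by the value at \<open>t\<close>, and the
  earlier time is sent to minus infinity. Applied to differences of trajectories it makes flows
  injective with Lipschitz inverse.\<close>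

lemma ode_bound_backward:
  fixes h :: "real \<Rightarrow> 'a::{banach,second_countable_topology}"
  assumes l: "integrable lborel l" "\<And>t. 0 \<le> l t"
    and h: "integrable lborel h" "\<And>\<tau>. norm (h \<tau>) \<le> l \<tau> * norm (primitive c h \<tau>)"
  shows "norm c \<le> 2 * exp (2 * integral\<^sup>L lborel l) * norm (primitive c h t)"
proof -
  let ?u = "primitive c h"
  have lu: "integrable lborel (\<lambda>t. l t * norm (?u t))" by (rule integrable_mult_norm_primitive[OF l(1) h(1)])
  have "norm (?u s) \<le> 2 * exp (2 * integral\<^sup>L lborel l) * norm (?u t)" if "s \<le> t" for s
  proof (rule gronwall_backward[where u="\<lambda>t. norm (?u t)", OF l _ _ _ _ that])
    show "norm (?u t) \<le> norm c + (LBINT x. norm (h x))" for t by (rule norm_primitive_le[OF h(1)])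
    show "norm (?u s) \<le> norm (?u t) + (LBINT \<tau>:{s<..t}. l \<tau> * norm (?u \<tau>))" if "s \<le> t" for s
    proof -
      have "norm (?u s) \<le> norm (?u t) + norm (?u t - ?u s)"
        by (metis add.commute norm_minus_commute norm_triangle_sub)
      also have "norm (?u t - ?u s) \<le> (LBINT \<tau>:{s<..t}. l \<tau> * norm (?u \<tau>))"
        unfolding primitive_diff[OF h(1) that]
        using h(2) lu by (intro set_lebesgue_integral_norm_bound set_integrable_lborel_subset) auto
      finally show ?thesis by simp
    qed
  qed auto
  then have "\<forall>\<^sub>F n in sequentially. norm (?u (- real n)) \<le> 2 * exp (2 * integral\<^sup>L lborel l) * norm (?u t)"
    by (intro eventually_sequentiallyI[of "nat \<lceil>-t\<rceil>"]) (auto simp: nat_le_iff ceiling_le_iff)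
  then show ?thesis
    by (rule tendsto_upperbound[OF tendsto_norm[OF primitive_at_bot[OF h(1), of c]]]) simp
qed

context
  fixes l :: "real \<Rightarrow> real"
  assumes l: "integrable lborel l" "\<And>t. 0 \<le> l t"
begin

lemma linear_solution_bound:
  assumes bound: "\<And>t y. norm (B t y) \<le> l t * norm y" and u: "linear_solution B c u"
  shows "norm (u t) \<le> 2 * exp (2 * integral\<^sup>L lborel l) * norm c"
  by (rule ode_bound_homogeneous[OF l linear_solutionD(1)[OF u], of c t, folded linear_solutionD(2)[OF u]]) (rule bound)

text \<open>The difference solves the equation of \<open>B'\<close> with value 0 at minus infinity
  and forcing \<open>B' t (u t) - B t (u t)\<close>. One factor of the squared constant bounds
  \<open>u\<close>, the other is that of \<open>ode_bound\<close>.\<close>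

lemma linear_solution_dependence:
  assumes d: "integrable lborel d" "\<And>t. 0 \<le> d t"
    and lin': "\<And>t y z. B' t (y - z) = B' t y - B' t z"
    and bound: "\<And>t y. norm (B t y) \<le> l t * norm y" and bound': "\<And>t y. norm (B' t y) \<le> l t * norm y"
    and diff: "\<And>t y. norm (B' t y - B t y) \<le> d t * norm y"
    and u: "linear_solution B c u" and u': "linear_solution B' c u'"
  shows "norm (u' t - u t) \<le> (2 * exp (2 * integral\<^sup>L lborel l))\<^sup>2 * norm c * integral\<^sup>L lborel d"
proof -
  let ?C = "2 * exp (2 * integral\<^sup>L lborel l)"
  let ?h = "\<lambda>t. B' t (u' t) - B t (u t)"
  note iu = linear_solutionD(1)[OF u] and iu' = linear_solutionD(1)[OF u']
  have p: "primitive 0 ?h t = u' t - u t" for t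
    unfolding linear_solutionD(2)[OF u, of t] linear_solutionD(2)[OF u', of t] primitive_def
    by (subst set_integral_diff(2)[OF set_integrable_lborel_subset[OF iu'] set_integrable_lborel_subset[OF iu]]) auto
  \<comment> \<open>The self-difference is a zero of the right type; it takes the place of
    \<open>c\<close> in \<open>ode_bound\<close>.\<close>
  have "norm (primitive 0 ?h t) \<le> ?C * (norm (primitive 0 ?h t - primitive 0 ?h t) + (LBINT t. ?C * norm c * d t))"
    unfolding diff_self
  proof (rule ode_bound[OF l])
    show "norm (?h \<tau>) \<le> l \<tau> * norm (primitive 0 ?h \<tau>) + ?C * norm c * d \<tau>" for \<tau>
    proof -
      have "?h \<tau> = B' \<tau> (u' \<tau> - u \<tau>) + (B' \<tau> (u \<tau>) - B \<tau> (u \<tau>))" by (simp add: lin')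
      also have "norm \<dots> \<le> l \<tau> * norm (u' \<tau> - u \<tau>) + d \<tau> * norm (u \<tau>)"
        by (intro order_trans[OF norm_triangle_ineq] add_mono bound' diff)
      also have "d \<tau> * norm (u \<tau>) \<le> d \<tau> * (?C * norm c)"
        by (intro mult_left_mono linear_solution_bound[OF bound u] d)
      finally show ?thesis unfolding p by (simp add: mult_ac)
    qed
  qed (use d iu iu' in auto)
  then show ?thesis unfolding p by (simp add: power2_eq_square mult_ac)
qed

end

section \<open>Fundamental solutions of linear systems in finite dimension and their
  inverses\<close>

lemma borel_measurable_bilinear:
  fixes prod :: "'a::{real_normed_vector,second_countable_topology} \<Rightarrow>
    'b::{real_normed_vector,second_countable_topology} \<Rightarrow> 'c::real_normed_vector"
  assumes "bounded_bilinear prod" "f \<in> borel_measurable M" "g \<in> borel_measurable M"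
  shows "(\<lambda>x. prod (f x) (g x)) \<in> borel_measurable M"
  by (rule borel_measurable_continuous_Pair[OF assms(2,3)])
    (auto intro!: bounded_bilinear.continuous_on[OF assms(1)] continuous_intros)

lemma norm_compose_le:
  fixes X y :: "'a::euclidean_space \<Rightarrow>\<^sub>L 'a"
  assumes "norm X \<le> c"
  shows "norm (X o\<^sub>L y) \<le> c * norm y" "norm (- (y o\<^sub>L X)) \<le> c * norm y"
  using order_trans[OF norm_blinfun_compose mult_right_mono[OF assms norm_ge_zero]]
    order_trans[OF norm_blinfun_compose mult_left_mono[OF assms norm_ge_zero]]
  by (auto simp: mult.commute)

lemma norm_id_blinfun_le: "norm (id_blinfun :: 'a::euclidean_space \<Rightarrow>\<^sub>L 'a) \<le> 1"
  by (rule norm_blinfun_bound) auto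

abbreviation fundamental_solution ::
  "(real \<Rightarrow> 'a::euclidean_space \<Rightarrow>\<^sub>L 'a) \<Rightarrow> (real \<Rightarrow> 'a \<Rightarrow>\<^sub>L 'a) \<Rightarrow> bool" where
  "fundamental_solution A \<equiv> linear_solution (\<lambda>t y. A t o\<^sub>L y) id_blinfun"

abbreviation inverse_fundamental_solution ::
  "(real \<Rightarrow> 'a::euclidean_space \<Rightarrow>\<^sub>L 'a) \<Rightarrow> (real \<Rightarrow> 'a \<Rightarrow>\<^sub>L 'a) \<Rightarrow> bool" where
  "inverse_fundamental_solution A \<equiv> linear_solution (\<lambda>t y. - (y o\<^sub>L A t)) id_blinfun"

context
  fixes l :: "real \<Rightarrow> real" and A :: "real \<Rightarrow> 'a::euclidean_space \<Rightarrow>\<^sub>L 'a"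
  assumes l: "integrable lborel l" "\<And>t. 0 \<le> l t"
    and A: "A \<in> borel_measurable borel" "\<And>t. norm (A t) \<le> l t"
begin

lemma fundamental_solution_exists: "\<exists>J. fundamental_solution A J"
proof (rule linear_ode_exists[OF l])
  show "(\<lambda>t. A t o\<^sub>L u t) \<in> borel_measurable borel" if "continuous_on UNIV u" for u :: "real \<Rightarrow> 'a \<Rightarrow>\<^sub>L 'a"
    by (rule borel_measurable_bilinear[OF bounded_bilinear_blinfun_compose A(1) borel_measurable_continuous_onI[OF that]])
qed (rule norm_compose_le[OF A(2)] bounded_bilinear.diff_right[OF bounded_bilinear_blinfun_compose])+

lemma inverse_fundamental_solution_exists: "\<exists>K. inverse_fundamental_solution A K"
proof (rule linear_ode_exists[OF l])
  show "(\<lambda>t. - (u t o\<^sub>L A t)) \<in> borel_measurable borel" if "continuous_on UNIV u" for u :: "real \<Rightarrow> 'a \<Rightarrow>\<^sub>L 'a"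
    by (rule borel_measurable_uminus[OF borel_measurable_bilinear[OF bounded_bilinear_blinfun_compose
        borel_measurable_continuous_onI[OF that] A(1)]])
qed (simp add: bounded_bilinear.diff_left[OF bounded_bilinear_blinfun_compose], rule norm_compose_le[OF A(2)])

lemma fundamental_solution_bounds:
  shows "fundamental_solution A J \<Longrightarrow> norm (J t) \<le> 2 * exp (2 * integral\<^sup>L lborel l)"
    and "inverse_fundamental_solution A J \<Longrightarrow> norm (J t) \<le> 2 * exp (2 * integral\<^sup>L lborel l)"
proof -
  have c: "2 * exp (2 * integral\<^sup>L lborel l) * norm (id_blinfun :: 'a \<Rightarrow>\<^sub>L 'a) \<le> 2 * exp (2 * integral\<^sup>L lborel l)"
    using mult_left_mono[OF norm_id_blinfun_le, of "2 * exp (2 * integral\<^sup>L lborel l)"] by simp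
  show "norm (J t) \<le> 2 * exp (2 * integral\<^sup>L lborel l)" if "fundamental_solution A J"
    by (rule order_trans[OF linear_solution_bound[OF l norm_compose_le(1)[OF A(2)] that] c])
  show "norm (J t) \<le> 2 * exp (2 * integral\<^sup>L lborel l)" if "inverse_fundamental_solution A J"
    by (rule order_trans[OF linear_solution_bound[OF l norm_compose_le(2)[OF A(2)] that] c])
qed

text \<open>Only the integral of the distance of the coefficients enters, so dominated convergence
  will give continuity of \<open>J\<close> and \<open>K\<close> in the initial point and in the
  parameter.\<close>

lemma fundamental_solution_dependence:
  assumes A': "A' \<in> borel_measurable borel" "\<And>t. norm (A' t) \<le> l t"
  shows "fundamental_solution A J \<Longrightarrow> fundamental_solution A' J' \<Longrightarrow>
      norm (J' t - J t) \<le> (2 * exp (2 * integral\<^sup>L lborel l))\<^sup>2 * (LBINT t. norm (A' t - A t))"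
    and "inverse_fundamental_solution A J \<Longrightarrow> inverse_fundamental_solution A' J' \<Longrightarrow>
      norm (J' t - J t) \<le> (2 * exp (2 * integral\<^sup>L lborel l))\<^sup>2 * (LBINT t. norm (A' t - A t))"
proof -
  let ?C = "2 * exp (2 * integral\<^sup>L lborel l)" and ?d = "\<lambda>t. norm (A' t - A t)"
  have d: "integrable lborel ?d"
  proof (rule integrable_dominated)
    show "integrable lborel (\<lambda>t. 2 * l t)" using l by simp
    show "norm (?d t) \<le> 2 * l t" for t
      using norm_triangle_ineq4[of "A' t" "A t"] A(2)[of t] A'(2)[of t] by simp
  qed (use A A' in measurable)
  have c: "?C\<^sup>2 * norm (id_blinfun :: 'a \<Rightarrow>\<^sub>L 'a) * integral\<^sup>L lborel ?d \<le> ?C\<^sup>2 * integral\<^sup>L lborel ?d"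
  proof (rule mult_right_mono)
    show "?C\<^sup>2 * norm (id_blinfun :: 'a \<Rightarrow>\<^sub>L 'a) \<le> ?C\<^sup>2"
      using mult_left_mono[OF norm_id_blinfun_le zero_le_power2] by (simp only: mult_1_right)
    show "0 \<le> integral\<^sup>L lborel ?d" by (rule Bochner_Integration.integral_nonneg) (rule norm_ge_zero)
  qed
  note bil = bounded_bilinear_blinfun_compose
  show "norm (J' t - J t) \<le> ?C\<^sup>2 * integral\<^sup>L lborel ?d"
    if "fundamental_solution A J" "fundamental_solution A' J'"
  proof (rule order_trans[OF linear_solution_dependence[OF l d norm_ge_zero _ norm_compose_le(1)[OF A(2)]
          norm_compose_le(1)[OF A'(2)] _ that] c])
    show "norm ((A' t o\<^sub>L y) - (A t o\<^sub>L y)) \<le> ?d t * norm y" for t and y :: "'a \<Rightarrow>\<^sub>L 'a"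
      unfolding bounded_bilinear.diff_left[OF bil, symmetric] by (rule norm_blinfun_compose)
  qed (rule bounded_bilinear.diff_right[OF bil])
  show "norm (J' t - J t) \<le> ?C\<^sup>2 * integral\<^sup>L lborel ?d"
    if "inverse_fundamental_solution A J" "inverse_fundamental_solution A' J'"
  proof (rule order_trans[OF linear_solution_dependence[OF l d norm_ge_zero _ norm_compose_le(2)[OF A(2)]
          norm_compose_le(2)[OF A'(2)] _ that] c])
    show "norm (- (y o\<^sub>L A' t) - - (y o\<^sub>L A t)) \<le> ?d t * norm y" for t and y :: "'a \<Rightarrow>\<^sub>L 'a"
      using norm_compose_le(2)[OF order_refl, of y "A' t - A t"] by (simp add: bounded_bilinear.diff_right[OF bil])
  qed (simp add: bounded_bilinear.diff_left[OF bil])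
qed

end

text \<open>The product rule gives \<open>- K A J + K A J = 0\<close> as derivative of
  \<open>K J\<close>, which therefore keeps its value at minus infinity.\<close>

lemma inverse_fundamental_solution_left:
  assumes "fundamental_solution A J" "inverse_fundamental_solution A K"
  shows "K t o\<^sub>L J t = id_blinfun"
proof -
  have J: "integrable lborel (\<lambda>t. A t o\<^sub>L J t)" "\<And>t. J t = primitive id_blinfun (\<lambda>t. A t o\<^sub>L J t) t"
    by (rule linear_solutionD[OF assms(1)])+
  have K: "integrable lborel (\<lambda>t. - (K t o\<^sub>L A t))" "\<And>t. K t = primitive id_blinfun (\<lambda>t. - (K t o\<^sub>L A t)) t"
    by (rule linear_solutionD[OF assms(2)])+
  have "K t o\<^sub>L J t = primitive (id_blinfun o\<^sub>L id_blinfun)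
     (\<lambda>t. ((- (K t o\<^sub>L A t)) o\<^sub>L J t) + (K t o\<^sub>L (A t o\<^sub>L J t))) t"
    using primitive_product[OF bounded_bilinear_blinfun_compose K(1) J(1), of id_blinfun t id_blinfun]
    unfolding J(2)[symmetric] K(2)[symmetric] .
  also have "(\<lambda>t. ((- (K t o\<^sub>L A t)) o\<^sub>L J t) + (K t o\<^sub>L (A t o\<^sub>L J t))) = (\<lambda>t. 0)"
    by (auto intro!: blinfun_eqI simp: blinfun.bilinear_simps)
  finally show ?thesis by (auto simp: primitive_def set_lebesgue_integral_def intro!: blinfun_eqI)
qed

text \<open>\<open>X = J K\<close> satisfies \<open>X' = A X - X A\<close>, which does not visibly
  vanish. Finite dimension is used instead: a left inverse of an endomorphism is also a right
  inverse.\<close>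

lemma inverse_fundamental_solution_right:
  assumes "fundamental_solution A J" "inverse_fundamental_solution A K"
  shows "J t o\<^sub>L K t = id_blinfun"
proof -
  have "blinfun_apply (K t) \<circ> blinfun_apply (J t) = id"
    using inverse_fundamental_solution_left[OF assms, of t]
    by (simp add: id_def flip: blinfun_compose.rep_eq)
  then have "blinfun_apply (J t) \<circ> blinfun_apply (K t) = id"
    by (subst linear_inverse_left) (intro bounded_linear.linear blinfun.bounded_linear_right)+
  then show ?thesis by (auto intro!: blinfun_eqI dest: fun_cong)
qed

section \<open>Flows of Lipschitz fields\<close>

text \<open>The quotient in the last assumption is 0 where \<open>\<delta> n \<tau> = 0\<close>, consistently with the bound on \<open>q\<close>.\<close>

lemma linearization:
  fixes \<delta> b q :: "nat \<Rightarrow> real \<Rightarrow> 'a::euclidean_space" and A K :: "real \<Rightarrow> 'a \<Rightarrow>\<^sub>L 'a"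
  assumes l: "integrable lborel l" "\<And>t. 0 \<le> l t"
    and A: "A \<in> borel_measurable borel" "\<And>t. norm (A t) \<le> l t"
    and K: "inverse_fundamental_solution A K"
    and b: "\<And>n. integrable lborel (b n)" and q: "\<And>n. integrable lborel (q n)"
    and \<delta>: "\<And>n t. \<delta> n t = primitive (c n) (\<lambda>\<tau>. b n \<tau> + q n \<tau>) t"
    and qbound: "\<And>n \<tau>. norm (q n \<tau>) \<le> l \<tau> * norm (\<delta> n \<tau>)"
    and small: "\<And>n. norm (c n) + (LBINT \<tau>. norm (b n \<tau>)) \<le> a n"
    and lim: "\<And>\<tau>. (\<lambda>n. norm (q n \<tau> - A \<tau> (\<delta> n \<tau>)) / norm (\<delta> n \<tau>)) \<longlonglongrightarrow> 0"
  shows "\<exists>e. e \<longlonglongrightarrow> 0 \<and>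
    (\<forall>n t. norm (K t (\<delta> n t) - primitive (c n) (\<lambda>\<tau>. K \<tau> (b n \<tau>)) t) \<le> e n * a n)"
proof -
  let ?C = "2 * exp (2 * integral\<^sup>L lborel l)"
  \<comment> \<open>The relative error of linearization. It tends to 0 pointwise and is dominated by
    \<open>2 * l\<close>, so its integral tends to 0 although nothing is uniform in time.\<close>
  define \<theta> where "\<theta> n \<tau> = norm (q n \<tau> - A \<tau> (\<delta> n \<tau>)) / norm (\<delta> n \<tau>)" for n \<tau>
  have int: "integrable lborel (\<lambda>\<tau>. b n \<tau> + q n \<tau>)" for n using b q by auto
  have m\<delta>: "\<delta> n \<in> borel_measurable borel" for n
    using borel_measurable_primitive[OF int, of "c n" n] by (simp add: \<delta>[abs_def])
  note K1 = linear_solutionD[OF K]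
  have mK: "K \<in> borel_measurable borel"
    using borel_measurable_primitive[OF K1(1), of id_blinfun] K1(2) by (metis ext)
  have bK: "norm (K t) \<le> ?C" for t by (rule fundamental_solution_bounds(2)[OF l A K])
  have b\<delta>: "norm (\<delta> n t) \<le> ?C * a n" for n t
  proof -
    have "norm (\<delta> n t) \<le> ?C * (norm (c n) + (LBINT \<tau>. norm (b n \<tau>)))"
      unfolding \<delta>[of n t]
    proof (rule ode_bound[OF l _ _ int])
      show "norm (b n \<tau> + q n \<tau>) \<le> l \<tau> * norm (primitive (c n) (\<lambda>\<tau>. b n \<tau> + q n \<tau>) \<tau>) + norm (b n \<tau>)" for \<tau>
        using norm_triangle_ineq[of "b n \<tau>" "q n \<tau>"] qbound[of n \<tau>] unfolding \<delta>[symmetric] by linarith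
    qed (use b in auto)
    also have "\<dots> \<le> ?C * a n" by (intro mult_left_mono small) simp
    finally show ?thesis .
  qed
  have mA: "(\<lambda>\<tau>. A \<tau> (\<delta> n \<tau>)) \<in> borel_measurable borel" for n
    by (rule borel_measurable_bilinear[OF bounded_bilinear_blinfun_apply A(1) m\<delta>])
  have bA: "norm (A \<tau> (\<delta> n \<tau>)) \<le> l \<tau> * norm (\<delta> n \<tau>)" for n \<tau>
    by (rule order_trans[OF norm_blinfun]) (intro mult_right_mono A(2) norm_ge_zero)
  have [measurable]: "b n \<in> borel_measurable borel" "q n \<in> borel_measurable borel" for n using b q by auto
  note [measurable] = mA m\<delta> mK
  have \<theta>_le: "\<theta> n \<tau> \<le> 2 * l \<tau>" for n \<tau>
  proof (cases "\<delta> n \<tau> = 0")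
    case False
    have "norm (q n \<tau> - A \<tau> (\<delta> n \<tau>)) \<le> 2 * l \<tau> * norm (\<delta> n \<tau>)"
      using norm_triangle_ineq4[of "q n \<tau>" "A \<tau> (\<delta> n \<tau>)"] qbound[of n \<tau>] bA[of \<tau> n] by simp
    then show ?thesis using False by (simp add: \<theta>_def field_simps)
  qed (simp add: \<theta>_def l)
  have \<theta>_nonneg: "0 \<le> \<theta> n \<tau>" for n \<tau> by (simp add: \<theta>_def)
  have m\<theta>: "\<theta> n \<in> borel_measurable borel" for n unfolding \<theta>_def by measurable
  have i\<theta>: "integrable lborel (\<theta> n)" for n
    by (rule integrable_dominated[of "\<lambda>\<tau>. 2 * l \<tau>"]) (use l \<theta>_le \<theta>_nonneg m\<theta> in auto)
  have rem: "norm (q n \<tau> - A \<tau> (\<delta> n \<tau>)) \<le> \<theta> n \<tau> * (?C * a n)" for n \<tau>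
  proof (cases "\<delta> n \<tau> = 0")
    case True then show ?thesis using qbound[of n \<tau>] by (simp add: \<theta>_def)
  next
    case False
    then have "norm (q n \<tau> - A \<tau> (\<delta> n \<tau>)) = \<theta> n \<tau> * norm (\<delta> n \<tau>)" by (simp add: \<theta>_def)
    also have "\<dots> \<le> \<theta> n \<tau> * (?C * a n)" by (intro mult_left_mono b\<delta> \<theta>_nonneg)
    finally show ?thesis .
  qed
  \<comment> \<open>One factor \<open>?C\<close> bounds \<open>K\<close>, the other bounds
    \<open>\<delta> n\<close> by \<open>?C * a n\<close>.\<close>
  define e where "e n = ?C * ?C * integral\<^sup>L lborel (\<theta> n)" for n
  have "(\<lambda>n. integral\<^sup>L lborel (\<theta> n)) \<longlonglongrightarrow> integral\<^sup>L (lborel :: real measure) (\<lambda>_. 0)"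
  proof (rule integral_dominated_convergence[where w="\<lambda>\<tau>. 2 * l \<tau>"])
    show "AE \<tau> in lborel. (\<lambda>n. \<theta> n \<tau>) \<longlonglongrightarrow> 0" unfolding \<theta>_def using lim by simp
    show "AE \<tau> in lborel. norm (\<theta> n \<tau>) \<le> 2 * l \<tau>" for n using \<theta>_le \<theta>_nonneg by simp
  qed (use l m\<theta> in auto)
  then have "e \<longlonglongrightarrow> ?C * ?C * 0" unfolding e_def by (intro tendsto_mult tendsto_const) simp
  then have e0: "e \<longlonglongrightarrow> 0" by simp
  have main: "norm (K t (\<delta> n t) - primitive (c n) (\<lambda>\<tau>. K \<tau> (b n \<tau>)) t) \<le> e n * a n" for n t
  proof -
    have iKb: "integrable lborel (\<lambda>\<tau>. K \<tau> (b n \<tau>))"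
      by (rule bounded_continuous_mult_integrable[OF bounded_bilinear_blinfun_apply mK bK b])
    have iKr: "integrable lborel (\<lambda>\<tau>. K \<tau> (q n \<tau> - A \<tau> (\<delta> n \<tau>)))"
    proof (rule bounded_continuous_mult_integrable[OF bounded_bilinear_blinfun_apply mK bK])
      show "integrable lborel (\<lambda>\<tau>. q n \<tau> - A \<tau> (\<delta> n \<tau>))"
        by (rule integrable_dominated[of "\<lambda>\<tau>. \<theta> n \<tau> * (?C * a n)"]) (use i\<theta> rem in auto)
    qed
    have "K t (\<delta> n t) = primitive (id_blinfun (c n))
      (\<lambda>\<tau>. blinfun_apply (- (K \<tau> o\<^sub>L A \<tau>)) (\<delta> n \<tau>) + K \<tau> (b n \<tau> + q n \<tau>)) t"
      using primitive_product[OF bounded_bilinear_blinfun_apply K1(1) int, of id_blinfun t "c n" n]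
      unfolding K1(2)[symmetric] \<delta>[symmetric] .
    \<comment> \<open>The purpose of the integrating factor \<open>K\<close>: the linear term
      \<open>A \<tau> (\<delta> n \<tau>)\<close> cancels and only forcing and remainder are
      left.\<close>
    also have "(\<lambda>\<tau>. blinfun_apply (- (K \<tau> o\<^sub>L A \<tau>)) (\<delta> n \<tau>) + K \<tau> (b n \<tau> + q n \<tau>))
       = (\<lambda>\<tau>. K \<tau> (b n \<tau>) + K \<tau> (q n \<tau> - A \<tau> (\<delta> n \<tau>)))"
      by (simp add: blinfun.bilinear_simps algebra_simps)
    finally have "K t (\<delta> n t) - primitive (c n) (\<lambda>\<tau>. K \<tau> (b n \<tau>)) t
       = (LBINT \<tau>:{..t}. K \<tau> (q n \<tau> - A \<tau> (\<delta> n \<tau>)))"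
      using set_integral_add(2)[OF set_integrable_lborel_subset[OF iKb] set_integrable_lborel_subset[OF iKr], of "{..t}"]
      by (simp add: primitive_def)
    also have "norm \<dots> \<le> (LBINT \<tau>:{..t}. ?C * (\<theta> n \<tau> * (?C * a n)))"
    proof (rule set_lebesgue_integral_norm_bound[OF set_integrable_lborel_subset])
      show "norm (K \<tau> (q n \<tau> - A \<tau> (\<delta> n \<tau>))) \<le> ?C * (\<theta> n \<tau> * (?C * a n))" for \<tau>
        by (rule order_trans[OF norm_blinfun]) (intro mult_mono bK rem; simp)
    qed (use i\<theta> in auto)
    also have "\<dots> \<le> (LBINT \<tau>. ?C * (\<theta> n \<tau> * (?C * a n)))"
    proof (rule set_integral_le_integral)
      have "0 \<le> ?C * a n" by (rule order_trans[OF norm_ge_zero b\<delta>])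
      then have "0 \<le> a n" by (simp add: zero_le_mult_iff)
      then show "0 \<le> ?C * (\<theta> n \<tau> * (?C * a n))" for \<tau> using \<theta>_nonneg[of n \<tau>] by (intro mult_nonneg_nonneg) auto
    qed (use i\<theta> in auto)
    also have "\<dots> = e n * a n" by (simp add: e_def)
    finally show ?thesis .
  qed
  show ?thesis using e0 main by blast
qed

text \<open>Scaling \<open>h\<close> by a small \<open>s\<close> brings it into the range where the
  linear approximation is accurate, and homogeneity removes \<open>s\<close>. So a single function
  can bound both Lipschitz constants and derivatives.\<close>

lemma has_derivative_lipschitz_bound:
  fixes f :: "'a::euclidean_space \<Rightarrow> 'a"
  assumes der: "(f has_derivative blinfun_apply D) (at x)"
    and lip: "\<And>y. norm (f y - f x) \<le> L * norm (y - x)" and L: "0 \<le> L"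
  shows "norm D \<le> L"
proof (rule norm_blinfun_bound[OF L])
  fix h :: 'a
  show "norm (D h) \<le> L * norm h"
  proof (cases "h = 0")
    case False
    show ?thesis
    proof (rule field_le_epsilon)
      fix e :: real assume "0 < e"
      then have e: "0 < e / norm h" using False by simp
      then obtain d where d: "0 < d" "\<And>y. norm (y - x) < d \<Longrightarrow> norm (f y - f x - D (y - x)) \<le> e / norm h * norm (y - x)"
        using der unfolding has_derivative_at_alt by blast
      define s where "s = d / (2 * norm h)"
      have s: "0 < s" "norm (s *\<^sub>R h) < d" using d(1) False by (auto simp: s_def)
      have "s * norm (D h) = norm (D (s *\<^sub>R h))" using s by (simp add: blinfun.scaleR_right)
      also have "\<dots> \<le> norm (f (x + s *\<^sub>R h) - f x) + norm (f (x + s *\<^sub>R h) - f x - D (s *\<^sub>R h))"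
        using norm_triangle_ineq4[of "f (x + s *\<^sub>R h) - f x" "f (x + s *\<^sub>R h) - f x - D (s *\<^sub>R h)"] by simp
      also have "\<dots> \<le> L * norm (s *\<^sub>R h) + e / norm h * norm (s *\<^sub>R h)"
        using lip[of "x + s *\<^sub>R h"] d(2)[of "x + s *\<^sub>R h"] s(2) by (intro add_mono) auto
      also have "\<dots> = s * (L * norm h + e)" using s(1) False by (simp add: algebra_simps)
      finally show "norm (D h) \<le> L * norm h + e" using s(1) by simp
    qed
  qed (simp add: blinfun.zero_right)
qed

text \<open>The field is defined on the whole space and is stationary off \<open>\<Omega>\<close>,
  which allows comparison with points outside. Measurability is required only along continuous
  curves, where the integral equations evaluate the field.\<close>

locale lipschitz_field =
  fixes \<Omega> :: "'a::euclidean_space set" and w :: "real \<Rightarrow> 'a \<Rightarrow> 'a"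
    and w' :: "real \<Rightarrow> 'a \<Rightarrow> 'a \<Rightarrow>\<^sub>L 'a" and l :: "real \<Rightarrow> real"
  assumes open_dom: "open \<Omega>"
    and l_int: "integrable lborel l" and l_nonneg: "\<And>t. 0 \<le> l t"
    and w_meas: "\<And>y. continuous_on UNIV y \<Longrightarrow> (\<lambda>t. w t (y t)) \<in> borel_measurable borel"
    and w'_meas: "\<And>y. continuous_on UNIV y \<Longrightarrow> range y \<subseteq> \<Omega> \<Longrightarrow> (\<lambda>t. w' t (y t)) \<in> borel_measurable borel"
    and w_bound: "\<And>t x. norm (w t x) \<le> l t"
    and w_lip: "\<And>t x y. norm (w t x - w t y) \<le> l t * norm (x - y)"
    and w_off: "\<And>t x. x \<notin> \<Omega> \<Longrightarrow> w t x = 0"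
    and w_der: "\<And>t x. x \<in> \<Omega> \<Longrightarrow> (w t has_derivative blinfun_apply (w' t x)) (at x)"
    and w'_cont: "\<And>t. continuous_on \<Omega> (w' t)"
begin

abbreviation C where "C \<equiv> 2 * exp (2 * integral\<^sup>L lborel l)"

definition solution :: "'a \<Rightarrow> (real \<Rightarrow> 'a) \<Rightarrow> bool" where
  "solution x y \<longleftrightarrow> continuous_on UNIV y \<and> (\<forall>t. y t = primitive x (\<lambda>\<tau>. w \<tau> (y \<tau>)) t)"

lemma w_comp_integrable:
  assumes "continuous_on UNIV y"
  shows "integrable lborel (\<lambda>t. w t (y t))"
  by (rule integrable_dominated[OF l_int w_meas[OF assms] w_bound])

lemma w'_bound: "x \<in> \<Omega> \<Longrightarrow> norm (w' t x) \<le> l t"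
  by (rule has_derivative_lipschitz_bound[OF w_der w_lip l_nonneg])

lemma solutionD:
  assumes "solution x y"
  shows "continuous_on UNIV y" "y t = primitive x (\<lambda>\<tau>. w \<tau> (y \<tau>)) t"
  by (rule assms[unfolded solution_def, THEN conjunct1],
      rule assms[unfolded solution_def, THEN conjunct2, THEN spec])

lemma solution_diff:
  assumes y: "solution x y" and z: "solution x' z"
  shows "integrable lborel (\<lambda>\<tau>. w \<tau> (z \<tau>) - w \<tau> (y \<tau>))"
    and "z t - y t = primitive (x' - x) (\<lambda>\<tau>. w \<tau> (z \<tau>) - w \<tau> (y \<tau>)) t"
proof -
  note iy = w_comp_integrable[OF solutionD(1)[OF y]] and iz = w_comp_integrable[OF solutionD(1)[OF z]]
  show "integrable lborel (\<lambda>\<tau>. w \<tau> (z \<tau>) - w \<tau> (y \<tau>))" using iy iz by simp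
  show "z t - y t = primitive (x' - x) (\<lambda>\<tau>. w \<tau> (z \<tau>) - w \<tau> (y \<tau>)) t"
    unfolding solutionD(2)[OF y, of t] solutionD(2)[OF z, of t] primitive_def
    by (subst set_integral_diff(2)[OF set_integrable_lborel_subset[OF iz] set_integrable_lborel_subset[OF iy]]) auto
qed

lemma solution_dist:
  assumes y: "solution x y" and z: "solution x' z"
  shows "norm (z t - y t) \<le> C * norm (x' - x)" "norm (x' - x) \<le> C * norm (z t - y t)"
proof -
  note d = solution_diff[OF y z]
  have le: "norm (w \<tau> (z \<tau>) - w \<tau> (y \<tau>)) \<le> l \<tau> * norm (primitive (x' - x) (\<lambda>\<tau>. w \<tau> (z \<tau>) - w \<tau> (y \<tau>)) \<tau>)" for \<tau>
    unfolding d(2)[symmetric] by (rule w_lip)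
  show "norm (z t - y t) \<le> C * norm (x' - x)"
    unfolding d(2)[of t] by (rule ode_bound_homogeneous[OF l_int l_nonneg d(1) le])
  show "norm (x' - x) \<le> C * norm (z t - y t)"
    unfolding d(2)[of t] by (rule ode_bound_backward[OF l_int l_nonneg d(1) le])
qed

lemma constant_solution:
  assumes "x \<notin> \<Omega>" shows "solution x (\<lambda>_. x)"
  using assms by (simp add: solution_def primitive_def w_off set_lebesgue_integral_def)

end

section \<open>The flow maps are diffeomorphisms, with derivatives given by fundamental
  solutions\<close>

locale flow_of_field = lipschitz_field +
  fixes \<phi> :: "real \<Rightarrow> 'a \<Rightarrow> 'a"
  assumes conn: "connected \<Omega>" and nonempty: "\<Omega> \<noteq> {}"
    and flow_in: "\<And>x t. x \<in> \<Omega> \<Longrightarrow> \<phi> t x \<in> \<Omega>"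
    and flow_sol: "\<And>x. x \<in> \<Omega> \<Longrightarrow> solution x (\<lambda>t. \<phi> t x)"
begin

lemma flow_inj: "inj_on (\<phi> t) \<Omega>"
proof (rule inj_onI)
  fix x x' assume x: "x \<in> \<Omega>" "x' \<in> \<Omega>" "\<phi> t x = \<phi> t x'"
  show "x = x'" using solution_dist(2)[OF flow_sol[OF x(2)] flow_sol[OF x(1)], of t] x(3) by simp
qed

lemma flow_lipschitz:
  assumes "x \<in> \<Omega>" "x' \<in> \<Omega>"
  shows "norm (\<phi> t x' - \<phi> t x) \<le> C * norm (x' - x)"
  by (rule solution_dist(1)[OF flow_sol[OF assms(1)] flow_sol[OF assms(2)]])

lemma flow_continuous: "continuous_on \<Omega> (\<phi> t)"
proof (rule continuous_onI)
  fix x e :: real and x0 assume "0 < e" "x0 \<in> \<Omega>"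
  then show "\<exists>d>0. \<forall>x'\<in>\<Omega>. dist x' x0 < d \<longrightarrow> dist (\<phi> t x') (\<phi> t x0) \<le> e"
    by (intro exI[of _ "e / C"]) (auto simp: dist_norm field_simps intro!: order_trans[OF flow_lipschitz])
qed

text \<open>
  The image is open by invariance of domain. It is closed in \<open>\<Omega>\<close> because the flow and its inverse are
  Lipschitz and the complement of \<open>\<Omega>\<close> consists of stationary points, so no boundary point is sent inside.
\<close>

lemma flow_image: "\<phi> t ` \<Omega> = \<Omega>"
proof -
  have op: "open (\<phi> t ` \<Omega>)" by (rule invariance_of_domain[OF flow_continuous open_dom flow_inj])
  have cl: "closedin (top_of_set \<Omega>) (\<phi> t ` \<Omega>)"
  proof (subst closedin_limpt, intro conjI allI impI)
    show "\<phi> t ` \<Omega> \<subseteq> \<Omega>" using flow_in by auto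
    fix z assume "z islimpt \<phi> t ` \<Omega> \<and> z \<in> \<Omega>"
    then have z: "z \<in> \<Omega>" and "z islimpt \<phi> t ` \<Omega>" by auto
    then obtain p where p: "\<And>n. p n \<in> \<phi> t ` \<Omega>" "p \<longlonglongrightarrow> z"
      unfolding islimpt_sequential by blast
    have "\<forall>n. \<exists>x. x \<in> \<Omega> \<and> p n = \<phi> t x" using p(1) by blast
    then obtain X where X: "\<And>n. X n \<in> \<Omega>" "\<And>n. p n = \<phi> t (X n)" by metis
    have "Cauchy X"
    proof (rule metric_CauchyI)
      fix e :: real assume "0 < e"
      then have "0 < e / C" by simp
      then obtain M where M: "\<And>m n. m \<ge> M \<Longrightarrow> n \<ge> M \<Longrightarrow> dist (p m) (p n) < e / C"
        using metric_CauchyD[OF LIMSEQ_imp_Cauchy[OF p(2)]] by blast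
      show "\<exists>M. \<forall>m\<ge>M. \<forall>n\<ge>M. dist (X m) (X n) < e"
      proof (intro exI allI impI)
        fix m n assume "M \<le> m" "M \<le> n"
        have "dist (X m) (X n) \<le> C * dist (p m) (p n)"
          using solution_dist(2)[OF flow_sol[OF X(1)[of n]] flow_sol[OF X(1)[of m]], of t] by (simp add: dist_norm X(2))
        also have "\<dots> < e" using M[OF \<open>M \<le> m\<close> \<open>M \<le> n\<close>] by (simp add: field_simps)
        finally show "dist (X m) (X n) < e" .
      qed
    qed
    then obtain x where x: "X \<longlonglongrightarrow> x" using Cauchy_convergent convergent_def by blast
    have "x \<in> \<Omega>"
    \<comment> \<open>A limit \<open>x\<close> outside \<open>\<Omega>\<close> would be stationary,
      and the Lipschitz estimate against the constant solution would force \<open>p\<close> to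
      converge to \<open>x\<close> instead of to \<open>z\<close> in
      \<open>\<Omega>\<close>.\<close>
    proof (rule ccontr)
      assume nx: "x \<notin> \<Omega>"
      have "norm (p n - x) \<le> C * norm (X n - x)" for n
        using solution_dist(1)[OF constant_solution[OF nx] flow_sol[OF X(1)[of n]], of t] by (simp add: X(2))
      moreover have "(\<lambda>n. C * norm (X n - x)) \<longlonglongrightarrow> 0" using x by (auto intro!: tendsto_eq_intros)
      ultimately have "(\<lambda>n. norm (p n - x)) \<longlonglongrightarrow> 0"
        by (intro tendsto_sandwich[of "\<lambda>_. 0" "\<lambda>n. norm (p n - x)" _ "\<lambda>n. C * norm (X n - x)"]) (auto intro: always_eventually)
      then have "p \<longlonglongrightarrow> x" by (simp add: tendsto_norm_zero_iff LIM_zero_iff)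
      then show False using LIMSEQ_unique[OF p(2)] nx z by auto
    qed
    then have "(\<lambda>n. \<phi> t (X n)) \<longlonglongrightarrow> \<phi> t x"
      by (intro continuous_on_tendsto_compose[OF flow_continuous x]) (auto simp: X(1))
    then have "z = \<phi> t x" using LIMSEQ_unique[OF p(2)] by (simp flip: X(2))
    then show "z \<in> \<phi> t ` \<Omega>" using \<open>x \<in> \<Omega>\<close> by blast
  qed
  have "openin (top_of_set \<Omega>) (\<phi> t ` \<Omega>)"
    using op flow_in by (intro open_subset) auto
  then show ?thesis using conn cl nonempty unfolding connected_clopen by blast
qed

lemma flow_bij: "bij_betw (\<phi> t) \<Omega> \<Omega>"
  using flow_inj flow_image by (auto simp: bij_betw_def)

definition A where "A x t = w' t (\<phi> t x)"

lemma A_meas: "x \<in> \<Omega> \<Longrightarrow> A x \<in> borel_measurable borel"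
  unfolding A_def[abs_def] using flow_in by (intro w'_meas solutionD(1)[OF flow_sol]) auto

lemma A_bound: "x \<in> \<Omega> \<Longrightarrow> norm (A x t) \<le> l t"
  unfolding A_def by (intro w'_bound flow_in)

text \<open>\<open>J x t\<close> will be identified as the derivative of \<open>\<phi> t\<close> at
  \<open>x\<close> in \<open>flow_derivative\<close>, and \<open>K x t\<close> as the derivative of
  the inverse at \<open>\<phi> t x\<close> in \<open>inverse_flow_derivative\<close>.\<close>

definition J where "J x = (SOME J. fundamental_solution (A x) J)"
definition K where "K x = (SOME K. inverse_fundamental_solution (A x) K)"

lemma J: "x \<in> \<Omega> \<Longrightarrow> fundamental_solution (A x) (J x)"
  unfolding J_def by (rule someI_ex[OF fundamental_solution_exists[OF l_int l_nonneg A_meas A_bound]])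

lemma K: "x \<in> \<Omega> \<Longrightarrow> inverse_fundamental_solution (A x) (K x)"
  unfolding K_def by (rule someI_ex[OF inverse_fundamental_solution_exists[OF l_int l_nonneg A_meas A_bound]])

lemma J_bound: "x \<in> \<Omega> \<Longrightarrow> norm (J x t) \<le> C"
  by (rule fundamental_solution_bounds(1)[OF l_int l_nonneg A_meas A_bound J])

lemma K_bound: "x \<in> \<Omega> \<Longrightarrow> norm (K x t) \<le> C"
  by (rule fundamental_solution_bounds(2)[OF l_int l_nonneg A_meas A_bound K])

lemma JK: "x \<in> \<Omega> \<Longrightarrow> J x t o\<^sub>L K x t = id_blinfun"
  by (rule inverse_fundamental_solution_right[OF J K])

lemma difference_quotient_tendsto:
  assumes x: "x \<in> \<Omega>" and z: "Z \<longlonglongrightarrow> 0"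
  shows "(\<lambda>n. norm (w t (x + Z n) - w t x - w' t x (Z n)) / norm (Z n)) \<longlonglongrightarrow> 0"
proof -
  let ?r = "\<lambda>h. norm (w t (x + h) - w t x - w' t x h) / norm h"
  have "?r \<midarrow>0\<rightarrow> 0" using w_der[OF x, of t] by (simp add: has_derivative_at)
  \<comment> \<open>Since division by 0 gives 0, \<open>?r\<close> is continuous at 0 and the
    sequence \<open>Z\<close> is allowed to vanish.\<close>
  moreover have "?r 0 = 0" by simp
  ultimately have "isCont ?r 0" by (simp add: isCont_def)
  then show ?thesis using isCont_tendsto_compose[OF _ z, of ?r] by simp
qed

text \<open>\<open>linearization\<close> without forcing and with initial deviation
  \<open>X n\<close> says that \<open>K\<close> maps the deviation of the trajectories to
  \<open>X n\<close> up to \<open>o(norm (X n))\<close>; applying \<open>J\<close>, the inverse of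
  \<open>K\<close>, gives the derivative.\<close>

lemma flow_derivative:
  assumes x: "x \<in> \<Omega>"
  shows "(\<phi> t has_derivative blinfun_apply (J x t)) (at x)"
  unfolding has_derivative_at
proof (intro conjI blinfun.bounded_linear_right)
  let ?r = "\<lambda>h. norm (\<phi> t (x + h) - \<phi> t x - J x t h) / norm h"
  show "?r \<midarrow>0\<rightarrow> 0"
    unfolding tendsto_at_iff_sequentially
  proof (intro allI impI)
    fix X0 :: "nat \<Rightarrow> 'a" assume "\<forall>i. X0 i \<in> UNIV - {0}" and X0: "X0 \<longlonglongrightarrow> 0"
    \<comment> \<open>Keeps every perturbed initial point in \<open>\<Omega>\<close>, where the flow
      is controlled; only finitely many terms are changed.\<close>
    define X where "X n = (if x + X0 n \<in> \<Omega> then X0 n else 0)" for n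
    have ev: "\<forall>\<^sub>F n in sequentially. X n = X0 n"
    proof -
      have "(\<lambda>n. x + X0 n) \<longlonglongrightarrow> x" using X0 by (auto intro: tendsto_eq_intros)
      then have "\<forall>\<^sub>F n in sequentially. x + X0 n \<in> \<Omega>" using open_dom x by (auto dest: topological_tendstoD)
      then show ?thesis by eventually_elim (simp add: X_def)
    qed
    have X: "X \<longlonglongrightarrow> 0" using X0 tendsto_cong[OF ev] by simp
    have xX: "x + X n \<in> \<Omega>" for n using x by (auto simp: X_def)
    define \<delta> where "\<delta> n \<tau> = \<phi> \<tau> (x + X n) - \<phi> \<tau> x" for n \<tau>
    define q where "q n \<tau> = w \<tau> (\<phi> \<tau> (x + X n)) - w \<tau> (\<phi> \<tau> x)" for n \<tau>
    note d = solution_diff[OF flow_sol[OF x] flow_sol[OF xX]]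
    have \<delta>0: "(\<lambda>n. \<delta> n \<tau>) \<longlonglongrightarrow> 0" for \<tau>
    proof (rule Lim_null_comparison)
      show "\<forall>\<^sub>F n in sequentially. norm (\<delta> n \<tau>) \<le> C * norm (X n)"
        unfolding \<delta>_def using flow_lipschitz[OF x xX] by (simp add: always_eventually)
      show "(\<lambda>n. C * norm (X n)) \<longlonglongrightarrow> 0" using X by (auto intro!: tendsto_eq_intros)
    qed
    have "\<exists>e. e \<longlonglongrightarrow> 0 \<and> (\<forall>n t. norm (K x t (\<delta> n t) - primitive (X n) (\<lambda>\<tau>. K x \<tau> 0) t) \<le> e n * norm (X n))"
    proof (rule linearization[OF l_int l_nonneg A_meas[OF x] A_bound[OF x] K[OF x], where q=q])
      show "integrable lborel (q n)" for n unfolding q_def by (rule d(1))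
      show "\<delta> n t = primitive (X n) (\<lambda>\<tau>. 0 + q n \<tau>) t" for n t
        using d(2)[of t n] by (simp add: \<delta>_def q_def)
      show "norm (q n \<tau>) \<le> l \<tau> * norm (\<delta> n \<tau>)" for n \<tau> unfolding q_def \<delta>_def by (rule w_lip)
      show "(\<lambda>n. norm (q n \<tau> - A x \<tau> (\<delta> n \<tau>)) / norm (\<delta> n \<tau>)) \<longlonglongrightarrow> 0" for \<tau>
        using difference_quotient_tendsto[OF flow_in[OF x, of \<tau>] \<delta>0[of \<tau>], of \<tau>] by (simp add: q_def \<delta>_def A_def)
    qed auto
    then obtain e where e: "e \<longlonglongrightarrow> 0" "\<And>n t. norm (K x t (\<delta> n t) - X n) \<le> e n * norm (X n)"
      by (auto simp: primitive_def set_lebesgue_integral_def blinfun.zero_right)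
    have le: "?r (X n) \<le> C * \<bar>e n\<bar>" for n
    proof (cases "X n = 0")
      case False
      have "\<phi> t (x + X n) - \<phi> t x - J x t (X n) = J x t (K x t (\<delta> n t) - X n)"
        using JK[OF x, of t] by (simp add: blinfun.bilinear_simps \<delta>_def flip: blinfun_apply_blinfun_compose)
      also have "norm \<dots> \<le> C * (e n * norm (X n))"
        by (rule order_trans[OF norm_blinfun]) (intro mult_mono J_bound[OF x] e; simp)
      also have "\<dots> \<le> C * \<bar>e n\<bar> * norm (X n)" by (simp add: mult_right_mono)
      finally show ?thesis using False by (simp add: field_simps)
    qed simp
    have "(\<lambda>n. ?r (X n)) \<longlonglongrightarrow> 0"
    proof (rule tendsto_sandwich[of "\<lambda>_. 0" _ _ "\<lambda>n. C * \<bar>e n\<bar>"])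
      show "(\<lambda>n. C * \<bar>e n\<bar>) \<longlonglongrightarrow> 0" using e(1) by (auto intro!: tendsto_eq_intros)
    qed (use le in \<open>auto intro!: always_eventually\<close>)
    moreover have "\<forall>\<^sub>F n in sequentially. ?r (X n) = (?r \<circ> X0) n" using ev by eventually_elim simp
    ultimately show "(?r \<circ> X0) \<longlonglongrightarrow> 0" by (rule Lim_transform_eventually)
  qed
qed

lemma A_tendsto:
  assumes x: "x \<in> \<Omega>" and X: "\<And>n. X n \<in> \<Omega>" "X \<longlonglongrightarrow> x"
  shows "(\<lambda>n. LBINT t. norm (A (X n) t - A x t)) \<longlonglongrightarrow> 0"
proof -
  have "(\<lambda>n. LBINT t. norm (A (X n) t - A x t)) \<longlonglongrightarrow> integral\<^sup>L (lborel :: real measure) (\<lambda>_. 0)"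
  proof (rule integral_dominated_convergence[where w="\<lambda>\<tau>. 2 * l \<tau>"])
    show "AE t in lborel. (\<lambda>n. norm (A (X n) t - A x t)) \<longlonglongrightarrow> 0"
    proof (rule AE_I2)
      fix t
      have "(\<lambda>n. \<phi> t (X n)) \<longlonglongrightarrow> \<phi> t x"
        using continuous_on_tendsto_compose[OF flow_continuous X(2) x] X(1) by (simp add: always_eventually)
      then have "(\<lambda>n. A (X n) t) \<longlonglongrightarrow> A x t" unfolding A_def
        by (rule continuous_on_tendsto_compose[OF w'_cont _ flow_in[OF x]]) (simp add: flow_in[OF X(1)])
      then show "(\<lambda>n. norm (A (X n) t - A x t)) \<longlonglongrightarrow> 0" by (intro tendsto_norm_zero LIM_zero)
    qed
    show "AE t in lborel. norm (norm (A (X n) t - A x t)) \<le> 2 * l t" for n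
    proof (rule AE_I2)
      fix t
      show "norm (norm (A (X n) t - A x t)) \<le> 2 * l t"
        using norm_triangle_ineq4[of "A (X n) t" "A x t"] A_bound[OF x, of t] A_bound[OF X(1), of n t] by simp
    qed
  qed (use l_int A_meas[OF x] A_meas[OF X(1)] in auto)
  then show ?thesis by simp
qed

lemma J_continuous: "continuous_on \<Omega> (\<lambda>x. J x t)"
  unfolding continuous_on_sequentially
proof (intro allI ballI impI)
  fix X x assume x: "x \<in> \<Omega>" and "(\<forall>n. X n \<in> \<Omega>) \<and> X \<longlonglongrightarrow> x"
  then have X: "\<And>n. X n \<in> \<Omega>" "X \<longlonglongrightarrow> x" by auto
  have "(\<lambda>n. J (X n) t - J x t) \<longlonglongrightarrow> 0"
  proof (rule Lim_null_comparison)
    show "\<forall>\<^sub>F n in sequentially. norm (J (X n) t - J x t) \<le> C\<^sup>2 * (LBINT t. norm (A (X n) t - A x t))"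
      using fundamental_solution_dependence(1)[OF l_int l_nonneg A_meas[OF x] A_bound[OF x] A_meas[OF X(1)] A_bound[OF X(1)] J[OF x] J[OF X(1)]]
      by (intro always_eventually allI)
    show "(\<lambda>n. C\<^sup>2 * (LBINT t. norm (A (X n) t - A x t))) \<longlonglongrightarrow> 0"
      by (rule tendsto_mult_right_zero[OF A_tendsto[OF x X]])
  qed
  then show "((\<lambda>x. J x t) \<circ> X) \<longlonglongrightarrow> J x t" by (simp add: LIM_zero_iff o_def)
qed

lemma K_continuous: "continuous_on \<Omega> (\<lambda>x. K x t)"
  unfolding continuous_on_sequentially
proof (intro allI ballI impI)
  fix X x assume x: "x \<in> \<Omega>" and "(\<forall>n. X n \<in> \<Omega>) \<and> X \<longlonglongrightarrow> x"
  then have X: "\<And>n. X n \<in> \<Omega>" "X \<longlonglongrightarrow> x" by auto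
  have "(\<lambda>n. K (X n) t - K x t) \<longlonglongrightarrow> 0"
  proof (rule Lim_null_comparison)
    show "\<forall>\<^sub>F n in sequentially. norm (K (X n) t - K x t) \<le> C\<^sup>2 * (LBINT t. norm (A (X n) t - A x t))"
      using fundamental_solution_dependence(2)[OF l_int l_nonneg A_meas[OF x] A_bound[OF x] A_meas[OF X(1)] A_bound[OF X(1)] K[OF x] K[OF X(1)]]
      by (intro always_eventually allI)
    show "(\<lambda>n. C\<^sup>2 * (LBINT t. norm (A (X n) t - A x t))) \<longlonglongrightarrow> 0"
      by (rule tendsto_mult_right_zero[OF A_tendsto[OF x X]])
  qed
  then show "((\<lambda>x. K x t) \<circ> X) \<longlonglongrightarrow> K x t" by (simp add: LIM_zero_iff o_def)
qed

lemma inverse_flow_derivative: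
  assumes x: "x \<in> \<Omega>"
  shows "(inv_into \<Omega> (\<phi> t) has_derivative blinfun_apply (K x t)) (at (\<phi> t x))"
proof (rule has_derivative_inverse_on[OF open_dom flow_derivative _ _ x, where g'="\<lambda>x. blinfun_apply (K x t)"])
  show "inv_into \<Omega> (\<phi> t) (\<phi> t x) = x" if "x \<in> \<Omega>" for x
    using inv_into_f_f[OF flow_inj that] .
  show "blinfun_apply (J x t) \<circ> blinfun_apply (K x t) = id"
    using JK[OF x, of t] by (simp add: id_def flip: blinfun_compose.rep_eq)
qed

end

section \<open>Differentiation under the integral\<close>

lemma continuous_on_lipschitz:
  fixes f :: "'a::real_normed_vector \<Rightarrow> 'b::real_normed_vector"
  assumes "\<And>x y. norm (f x - f y) \<le> L * norm (x - y)"
  shows "continuous_on UNIV f"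
proof (rule continuous_onI)
  fix x :: 'a and e :: real assume "0 < e"
  show "\<exists>d>0. \<forall>y\<in>UNIV. dist y x < d \<longrightarrow> dist (f y) (f x) \<le> e"
  proof (intro exI conjI ballI impI)
    show "0 < e / (\<bar>L\<bar> + 1)" using \<open>0 < e\<close> by simp
    fix y assume "dist y x < e / (\<bar>L\<bar> + 1)"
    then have "(\<bar>L\<bar> + 1) * dist y x < e" by (simp add: field_simps)
    moreover have "dist (f y) (f x) \<le> L * dist y x" using assms by (simp add: dist_norm)
    moreover have "L * dist y x \<le> (\<bar>L\<bar> + 1) * dist y x" by (rule mult_right_mono) auto
    ultimately show "dist (f y) (f x) \<le> e" by linarith
  qed
qed

text \<open>\<open>y\<close> is approximated by functions with countably many values:
  \<open>d (i n p)\<close> is the first point of a dense sequence at distance less than 1/(n+1) from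
  \<open>y p\<close>. For these, measurability at fixed points suffices, and continuity of
  \<open>F p\<close> passes to the limit.\<close>

lemma measurable_caratheodory:
  fixes F :: "'p \<Rightarrow> 'a::{metric_space,second_countable_topology} \<Rightarrow> 'b::metric_space"
  assumes F: "\<And>x. (\<lambda>p. F p x) \<in> borel_measurable M" and cont: "\<And>p. continuous_on UNIV (F p)"
    and y: "y \<in> borel_measurable M"
  shows "(\<lambda>p. F p (y p)) \<in> borel_measurable M"
proof -
  obtain D :: "'a set" where D: "countable D" "\<And>X. open X \<Longrightarrow> X \<noteq> {} \<Longrightarrow> \<exists>d\<in>D. d \<in> X"
    using countable_dense_exists by metis
  have "D \<noteq> {}" using D(2)[of UNIV] by auto
  define d where "d = from_nat_into D"
  have d: "\<exists>i. dist (d i) x < e" if "0 < e" for x e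
  proof -
    have "ball x e \<noteq> {}" using that by simp
    then obtain c where c: "c \<in> D" "c \<in> ball x e" using D(2)[OF open_ball, of x e] by blast
    then show ?thesis using from_nat_into_surj[OF D(1) c(1)] by (auto simp: d_def dist_commute)
  qed
  define i where "i n p = (LEAST i. dist (d i) (y p) < inverse (real (Suc n)))" for n p
  have im: "i n \<in> measurable M (count_space UNIV)" for n
    unfolding i_def using y by measurable
  have di: "dist (d (i n p)) (y p) < inverse (real (Suc n))" for n p
    unfolding i_def by (rule LeastI_ex) (rule d, simp)
  show ?thesis
  proof (rule borel_measurable_LIMSEQ_metric)
    show "(\<lambda>p. F p (d (i n p))) \<in> borel_measurable M" for n
      by (rule measurable_compose_countable[OF F im])
    fix p assume "p \<in> space M"
    have "(\<lambda>n. dist (d (i n p)) (y p)) \<longlonglongrightarrow> 0"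
      by (rule tendsto_sandwich[OF _ _ tendsto_const LIMSEQ_inverse_real_of_nat])
        (intro always_eventually allI zero_le_dist less_imp_le[OF di])+
    then have "(\<lambda>n. d (i n p)) \<longlonglongrightarrow> y p" by (rule tendsto_dist_iff[THEN iffD2])
    then show "(\<lambda>n. F p (d (i n p))) \<longlonglongrightarrow> F p (y p)"
      by (rule continuous_on_tendsto_compose[OF cont]) auto
  qed
qed

text \<open>Exhibits derivatives as limits of countably many difference quotients, for
  measurability.\<close>

lemma has_derivative_sequence:
  fixes f :: "'a::real_normed_vector \<Rightarrow> 'b::real_normed_vector"
  assumes f: "(f has_derivative D) (at x)"
  shows "(\<lambda>n. real (Suc n) *\<^sub>R (f (x + h /\<^sub>R real (Suc n)) - f x)) \<longlonglongrightarrow> D h"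
proof (cases "h = 0")
  case True
  then show ?thesis using linear_0[OF has_derivative_linear[OF f]] by simp
next
  case False
  let ?Z = "\<lambda>n. h /\<^sub>R real (Suc n)"
  have lin: "linear D" by (rule has_derivative_linear[OF f])
  have Z: "?Z \<longlonglongrightarrow> 0"
    using tendsto_scaleR[OF LIMSEQ_inverse_real_of_nat tendsto_const[of h]] by simp
  have "(\<lambda>h. norm (f (x + h) - f x - D h) / norm h) \<midarrow>0\<rightarrow> 0"
    using f by (simp add: has_derivative_at)
  then have "((\<lambda>h. norm (f (x + h) - f x - D h) / norm h) \<circ> ?Z) \<longlonglongrightarrow> 0"
    using Z False unfolding tendsto_at_iff_sequentially by (metis (no_types, lifting) DiffI UNIV_I inverse_nonzero_iff_nonzero of_nat_eq_0_iff old.nat.distinct(2) scaleR_eq_0_iff singletonD)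
  then have "(\<lambda>n. norm h * (norm (f (x + ?Z n) - f x - D (?Z n)) / norm (?Z n))) \<longlonglongrightarrow> norm h * 0"
    unfolding o_def by (intro tendsto_mult tendsto_const)
  moreover have "norm h * (norm (f (x + ?Z n) - f x - D (?Z n)) / norm (?Z n))
      = norm (real (Suc n) *\<^sub>R (f (x + ?Z n) - f x) - D h)" for n
  proof -
    have "real (Suc n) *\<^sub>R (f (x + ?Z n) - f x) - D h = real (Suc n) *\<^sub>R (f (x + ?Z n) - f x - D (?Z n))"
      unfolding linear_scale[OF lin] scaleR_diff_right[of "real (Suc n)" "f (x + ?Z n) - f x"] by simp
    moreover have "norm (?Z n) = norm h / real (Suc n)" by (simp add: divide_inverse_commute)
    ultimately show ?thesis using False by (simp only: norm_scaleR) (simp add: field_simps del: of_nat_Suc)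
  qed
  ultimately have "(\<lambda>n. norm (real (Suc n) *\<^sub>R (f (x + ?Z n) - f x) - D h)) \<longlonglongrightarrow> 0" by simp
  then show ?thesis by (simp only: tendsto_norm_zero_iff LIM_zero_iff)
qed

lemma borel_measurable_blinfun:
  fixes F :: "'p \<Rightarrow> 'a::euclidean_space \<Rightarrow>\<^sub>L 'b::euclidean_space"
  assumes "\<And>h. (\<lambda>p. F p h) \<in> borel_measurable M"
  shows "F \<in> borel_measurable M"
proof -
  define E where "E i j = Blinfun (\<lambda>x::'a. (x \<bullet> j) *\<^sub>R (i::'b))" for i j
  have E: "E i j x = (x \<bullet> j) *\<^sub>R i" for i j x
    unfolding E_def by (subst bounded_linear_Blinfun_apply) (intro bounded_linear_intros, simp)
  have "F = (\<lambda>p. \<Sum>i\<in>Basis. \<Sum>j\<in>Basis. (F p j \<bullet> i) *\<^sub>R E i j)"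
  proof (intro ext blinfun_eqI)
    fix p x
    have "F p x = F p (\<Sum>j\<in>Basis. (x \<bullet> j) *\<^sub>R j)" by (simp add: euclidean_representation)
    also have "\<dots> = (\<Sum>j\<in>Basis. (x \<bullet> j) *\<^sub>R F p j)" by (simp add: blinfun.bilinear_simps blinfun.sum_right)
    also have "\<dots> = (\<Sum>j\<in>Basis. (x \<bullet> j) *\<^sub>R (\<Sum>i\<in>Basis. (F p j \<bullet> i) *\<^sub>R i))"
      by (simp add: euclidean_representation)
    also have "\<dots> = (\<Sum>i\<in>Basis. \<Sum>j\<in>Basis. (F p j \<bullet> i) *\<^sub>R E i j x)"
      by (subst sum.swap) (simp add: scaleR_sum_right E mult.commute)
    finally show "F p x = (\<Sum>i\<in>Basis. \<Sum>j\<in>Basis. (F p j \<bullet> i) *\<^sub>R E i j) x"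
      by (simp add: blinfun.sum_left blinfun.scaleR_left)
  qed
  then show ?thesis
    by (subst \<open>F = _\<close>) (intro borel_measurable_sum borel_measurable_scaleR borel_measurable_inner
        borel_measurable_const assms)
qed

text \<open>Nothing is assumed on how \<open>V'\<close> depends on \<open>p\<close>: its
  measurability is inherited from difference quotients of \<open>V\<close>. Their base points may
  leave \<open>\<Omega>\<close>, where \<open>V\<close> is still defined and continuous.\<close>

lemma measurable_derivative_comp:
  fixes V :: "'p \<Rightarrow> 'a::euclidean_space \<Rightarrow> 'a" and V' :: "'p \<Rightarrow> 'a \<Rightarrow> 'a \<Rightarrow>\<^sub>L 'a"
  assumes V: "\<And>x. (\<lambda>p. V p x) \<in> borel_measurable M" and cont: "\<And>p. continuous_on UNIV (V p)"
    and der: "\<And>p x. x \<in> \<Omega> \<Longrightarrow> (V p has_derivative blinfun_apply (V' p x)) (at x)"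
    and y: "y \<in> borel_measurable M" "\<And>p. y p \<in> \<Omega>"
  shows "(\<lambda>p. V' p (y p)) \<in> borel_measurable M"
proof (rule borel_measurable_blinfun)
  fix h
  show "(\<lambda>p. V' p (y p) h) \<in> borel_measurable M"
  proof (rule borel_measurable_LIMSEQ_metric)
    have c: "(\<lambda>p. V p (y p + c)) \<in> borel_measurable M" for c
      by (rule measurable_caratheodory[OF V cont]) (use y in measurable)
    show "(\<lambda>p. real (Suc n) *\<^sub>R (V p (y p + h /\<^sub>R real (Suc n)) - V p (y p))) \<in> borel_measurable M" for n
      using c[of "h /\<^sub>R real (Suc n)"] measurable_caratheodory[OF V cont y(1)] by measurable
    show "(\<lambda>n. real (Suc n) *\<^sub>R (V p (y p + h /\<^sub>R real (Suc n)) - V p (y p))) \<longlonglongrightarrow> V' p (y p) h" for p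
      by (rule has_derivative_sequence[OF der[OF y(2)]])
  qed
qed

lemma primitive_tendsto_dominated:
  fixes f :: "nat \<Rightarrow> real \<Rightarrow> 'b::{banach,second_countable_topology}"
  assumes "\<And>n. f n \<in> borel_measurable borel" "g \<in> borel_measurable borel" "integrable lborel h"
    and "\<And>n r. norm (f n r) \<le> h r" and "\<And>r. (\<lambda>n. f n r) \<longlonglongrightarrow> g r"
  shows "(\<lambda>n. primitive c (f n) s) \<longlonglongrightarrow> primitive c g s"
  unfolding primitive_def set_lebesgue_integral_def
proof (intro tendsto_add tendsto_const integral_dominated_convergence[where w=h])
  show "AE r in lborel. norm (indicator {..s} r *\<^sub>R f n r) \<le> h r" for n
    using assms(4) order_trans[OF norm_ge_zero assms(4)] by (auto simp: indicator_def)
  show "AE r in lborel. (\<lambda>n. indicator {..s} r *\<^sub>R f n r) \<longlonglongrightarrow> indicator {..s} r *\<^sub>R g r"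
    by (intro AE_I2 tendsto_scaleR tendsto_const assms)
qed (use assms in auto)

lemma set_integral_blinfun_apply:
  fixes f' :: "'b \<Rightarrow> 'a::euclidean_space \<Rightarrow>\<^sub>L 'a"
  assumes "set_integrable M S f'"
  shows "blinfun_apply (LINT r:S|M. f' r) x = (LINT r:S|M. f' r x)"
  using integral_bounded_linear[OF blinfun.bounded_linear_left[of x] assms[unfolded set_integrable_def]]
  unfolding set_lebesgue_integral_def blinfun.scaleR_left by (rule sym)

text \<open>Differentiation under the integral: the remainder quotients \<open>?g n\<close> tend to
  0 pointwise and are dominated by \<open>2 * m\<close>, and the primitive of \<open>?g n\<close>
  bounds the remainder quotient of the integral.\<close>

lemma has_derivative_primitive:
  fixes f :: "real \<Rightarrow> 'a::euclidean_space \<Rightarrow> 'a" and f' :: "real \<Rightarrow> 'a \<Rightarrow>\<^sub>L 'a"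
  assumes der: "\<And>r. (f r has_derivative blinfun_apply (f' r)) (at x)"
    and lip: "\<And>r y. norm (f r y - f r x) \<le> m r * norm (y - x)"
    and m: "integrable lborel m" "\<And>r. 0 \<le> m r"
    and int: "\<And>y. integrable lborel (\<lambda>r. f r y)" and f': "f' \<in> borel_measurable borel"
  shows "((\<lambda>y. primitive 0 (\<lambda>r. f r y) s) has_derivative blinfun_apply (primitive 0 f' s)) (at x)"
  unfolding has_derivative_at
proof (intro conjI blinfun.bounded_linear_right)
  have bf': "norm (f' r) \<le> m r" for r by (rule has_derivative_lipschitz_bound[OF der lip m(2)])
  have if': "integrable lborel f'" by (rule integrable_dominated[OF m(1) f' bf'])
  have if'h: "integrable lborel (\<lambda>r. f' r h)" for h
    by (rule integrable_bounded_linear[OF blinfun.bounded_linear_left if'])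
  let ?F = "\<lambda>y. primitive 0 (\<lambda>r. f r y) s"
  let ?r = "\<lambda>h. norm (?F (x + h) - ?F x - primitive 0 f' s h) / norm h"
  show "?r \<midarrow>0\<rightarrow> 0"
    unfolding tendsto_at_iff_sequentially
  proof (intro allI impI)
    fix X :: "nat \<Rightarrow> 'a" assume "\<forall>i. X i \<in> UNIV - {0}" and X: "X \<longlonglongrightarrow> 0"
    then have X0: "X n \<noteq> 0" for n by auto
    let ?g = "\<lambda>n r. norm (f r (x + X n) - f r x - f' r (X n)) / norm (X n)"
    have mg: "?g n \<in> borel_measurable borel" for n
      using int[of x] int[of "x + X n"] if'h[of "X n"] by auto
    have bg: "norm (?g n r) \<le> 2 * m r" for n r
    proof -
      have "norm (f r (x + X n) - f r x - f' r (X n)) \<le> m r * norm (X n) + norm (f' r) * norm (X n)"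
        using lip[of r "x + X n"] norm_blinfun[of "f' r" "X n"]
          norm_triangle_ineq4[of "f r (x + X n) - f r x" "f' r (X n)"] by simp
      also have "\<dots> \<le> 2 * m r * norm (X n)"
        using mult_right_mono[OF bf'[of r] norm_ge_zero[of "X n"]] by simp
      finally show ?thesis using X0[of n] by (simp add: field_simps)
    qed
    have ig: "integrable lborel (?g n)" for n
      by (rule integrable_dominated[OF _ mg bg]) (use m in simp)
    have lim: "(\<lambda>n. primitive 0 (?g n) s) \<longlonglongrightarrow> primitive 0 (\<lambda>_. 0) s"
    proof (rule primitive_tendsto_dominated[OF mg _ _ bg])
      fix r
      have "(\<lambda>h. norm (f r (x + h) - f r x - f' r h) / norm h) \<midarrow>0\<rightarrow> 0"
        using der[of r] by (simp add: has_derivative_at)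
      then show "(\<lambda>n. ?g n r) \<longlonglongrightarrow> 0"
        using X X0 unfolding tendsto_at_iff_sequentially o_def by auto
    qed (use m in auto)
    have le: "?r (X n) \<le> primitive 0 (?g n) s" for n
    proof -
      have b: "primitive 0 f' s (X n) = (LBINT r:{..s}. f' r (X n))"
        unfolding primitive_def add_0
        by (rule set_integral_blinfun_apply[OF set_integrable_lborel_subset[OF if']]) simp
      have "?F (x + X n) - ?F x - primitive 0 f' s (X n) = (LBINT r:{..s}. f r (x + X n) - f r x - f' r (X n))"
        unfolding b unfolding primitive_def
        by (subst set_integral_diff(2), (rule set_integral_diff(1) set_integrable_lborel_subset int if'h atMost_borel)+,
            subst set_integral_diff(2), (rule set_integrable_lborel_subset int if'h atMost_borel)+) simp
      also have "norm \<dots> \<le> (LBINT r:{..s}. norm (X n) * ?g n r)"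
        by (intro set_lebesgue_integral_norm_bound set_integrable_lborel_subset integrable_mult_right ig)
          (use X0[of n] in auto)
      also have "\<dots> = norm (X n) * primitive 0 (?g n) s" by (simp add: primitive_def)
      finally show ?thesis using X0[of n] by (simp add: field_simps)
    qed
    show "(?r \<circ> X) \<longlonglongrightarrow> 0" unfolding o_def
    proof (rule tendsto_sandwich[OF _ _ tendsto_const])
      show "(\<lambda>n. primitive 0 (?g n) s) \<longlonglongrightarrow> 0" using lim by (simp add: primitive_def set_lebesgue_integral_def)
    qed (use le in \<open>auto intro!: always_eventually\<close>)
  qed
qed

section \<open>Families of fields\<close>

text \<open>In \<open>V t s\<close> the time comes first and the parameter second. The sections of
  \<open>m\<close> are integrable at every \<open>t\<close> and every \<open>s\<close>, so that no
  exceptional sets appear here; \<open>borel_modification\<close> arranges this.\<close>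

locale lipschitz_field_family =
  fixes \<Omega> :: "'a::euclidean_space set"
    and V :: "real \<Rightarrow> real \<Rightarrow> 'a \<Rightarrow> 'a" and V' :: "real \<Rightarrow> real \<Rightarrow> 'a \<Rightarrow> 'a \<Rightarrow>\<^sub>L 'a"
    and m :: "real \<Rightarrow> real \<Rightarrow> real"
  assumes open_dom: "open \<Omega>"
    and V_meas: "\<And>x. (\<lambda>p. V (fst p) (snd p) x) \<in> borel_measurable borel"
    and m_meas: "(\<lambda>p. m (fst p) (snd p)) \<in> borel_measurable borel"
    and m_nonneg: "\<And>t s. 0 \<le> m t s"
    and m_int: "integrable (lborel \<Otimes>\<^sub>M lborel) (\<lambda>(t, s). m t s)"
    and m_int1: "\<And>t. integrable lborel (m t)"
    and m_int2: "\<And>s. integrable lborel (\<lambda>t. m t s)"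
    and V_bound: "\<And>t s x. norm (V t s x) \<le> m t s"
    and V_lip: "\<And>t s x y. norm (V t s x - V t s y) \<le> m t s * norm (x - y)"
    and V_off: "\<And>t s x. x \<notin> \<Omega> \<Longrightarrow> V t s x = 0"
    and V_der: "\<And>t s x. x \<in> \<Omega> \<Longrightarrow> (V t s has_derivative blinfun_apply (V' t s x)) (at x)"
    and V'_cont: "\<And>t s. continuous_on \<Omega> (V' t s)"
begin

definition W where "W s t x = primitive 0 (\<lambda>r. V t r x) s"
definition W' where "W' s t x = primitive 0 (\<lambda>r. V' t r x) s"
text \<open>\<open>l\<close> bounds all fields \<open>W s\<close> at once, so the constant
  \<open>C\<close> does not depend on the parameter. \<open>\<mu>\<close> is the density of the
  function \<open>\<alpha>\<close> that measures increments in the parameter.\<close>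

definition l where "l t = (LBINT r. m t r)"
definition \<mu> where "\<mu> r = (LBINT t. m t r)"

lemma V_cont: "continuous_on UNIV (V t s)"
  by (rule continuous_on_lipschitz[OF V_lip])

lemma V'_bound: "x \<in> \<Omega> \<Longrightarrow> norm (V' t s x) \<le> m t s"
  by (rule has_derivative_lipschitz_bound[OF V_der V_lip m_nonneg])

lemma V_comp:
  assumes "f \<in> borel_measurable M" "g \<in> borel_measurable M" "y \<in> borel_measurable M"
  shows "(\<lambda>p. V (f p) (g p) (y p)) \<in> borel_measurable M"
proof (rule measurable_caratheodory[OF _ V_cont assms(3)])
  have "(\<lambda>p. (f p, g p)) \<in> M \<rightarrow>\<^sub>M borel"
    unfolding borel_prod[symmetric] using assms by measurable
  from measurable_compose[OF this V_meas]
  show "(\<lambda>p. V (f p) (g p) x) \<in> borel_measurable M" for x by simp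
qed

lemma V'_comp:
  assumes "f \<in> borel_measurable M" "g \<in> borel_measurable M" "y \<in> borel_measurable M" "\<And>p. y p \<in> \<Omega>"
  shows "(\<lambda>p. V' (f p) (g p) (y p)) \<in> borel_measurable M"
  by (rule measurable_derivative_comp[where V="\<lambda>p. V (f p) (g p)", OF _ V_cont V_der assms(3,4)])
    (rule V_comp[OF assms(1,2) borel_measurable_const])

lemma V_int1: "integrable lborel (\<lambda>r. V t r x)"
  by (rule integrable_dominated[OF m_int1 _ V_bound]) (rule V_comp, auto)

lemma V'_int1: "x \<in> \<Omega> \<Longrightarrow> integrable lborel (\<lambda>r. V' t r x)"
  by (rule integrable_dominated[OF m_int1 _ V'_bound]) (rule V'_comp, auto)

lemma l_int: "integrable lborel l"
  using lborel_pair.integrable_fst'[OF m_int] by (simp add: l_def[abs_def])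

lemma l_nonneg: "0 \<le> l t"
  unfolding l_def using m_nonneg by (intro Bochner_Integration.integral_nonneg)

lemma \<mu>_int: "integrable lborel \<mu>"
  using lborel_pair.integrable_snd[OF m_int] by (simp add: \<mu>_def[abs_def])

lemma \<mu>_nonneg: "0 \<le> \<mu> t"
  unfolding \<mu>_def using m_nonneg by (intro Bochner_Integration.integral_nonneg)

lemma primitive_measurable:
  fixes f :: "real \<Rightarrow> real \<Rightarrow> 'b::{banach,second_countable_topology}"
  assumes "(\<lambda>p. f (fst p) (snd p)) \<in> borel_measurable borel"
  shows "(\<lambda>t. primitive 0 (f t) s) \<in> borel_measurable borel"
proof -
  have [measurable]: "(\<lambda>p. f (fst p) (snd p)) \<in> borel_measurable (borel \<Otimes>\<^sub>M lborel)"
    using assms by (simp add: borel_prod[symmetric] cong: measurable_cong_sets)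
  have "(\<lambda>(t, r). indicator {..s} r *\<^sub>R f t r) \<in> borel_measurable (borel \<Otimes>\<^sub>M lborel)"
    unfolding split_def by measurable
  from lborel.borel_measurable_lebesgue_integral[OF this]
  show ?thesis by (simp add: primitive_def set_lebesgue_integral_def)
qed

lemma W_bound: "norm (W s t x) \<le> l t"
  using primitive_norm_le[OF m_int1 V_bound, where c=0] by (simp add: W_def l_def)

lemma W_diff: "W s t x - W s t y = primitive 0 (\<lambda>r. V t r x - V t r y) s"
  unfolding W_def primitive_def
  by (subst set_integral_diff(2)) (auto intro: set_integrable_lborel_subset V_int1)

lemma W_lip: "norm (W s t x - W s t y) \<le> l t * norm (x - y)"
proof -
  have "norm (primitive 0 (\<lambda>r. V t r x - V t r y) s - 0) \<le> (LBINT r. m t r * norm (x - y))"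
    by (rule primitive_norm_le[OF _ V_lip]) (use m_int1 in auto)
  then show ?thesis by (simp add: W_diff l_def)
qed

lemma W_der:
  assumes "x \<in> \<Omega>"
  shows "(W s t has_derivative blinfun_apply (W' s t x)) (at x)"
  unfolding W_def[abs_def] W'_def
  by (rule has_derivative_primitive[OF V_der[OF assms] V_lip m_int1 m_nonneg V_int1])
    (rule V'_comp, use assms in auto)

lemma W'_cont: "continuous_on \<Omega> (W' s t)"
  unfolding continuous_on_sequentially W'_def[abs_def] o_def
proof (intro allI ballI impI)
  fix X x assume x: "x \<in> \<Omega>" and "(\<forall>n. X n \<in> \<Omega>) \<and> X \<longlonglongrightarrow> x"
  then have X: "\<And>n. X n \<in> \<Omega>" "X \<longlonglongrightarrow> x" by auto
  show "(\<lambda>n. primitive 0 (\<lambda>r. V' t r (X n)) s) \<longlonglongrightarrow> primitive 0 (\<lambda>r. V' t r x) s"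
  proof (rule primitive_tendsto_dominated[OF _ _ m_int1])
    show "norm (V' t r (X n)) \<le> m t r" for n r by (rule V'_bound[OF X(1)])
    show "(\<lambda>n. V' t r (X n)) \<longlonglongrightarrow> V' t r x" for r
      by (rule continuous_on_tendsto_compose[OF V'_cont X(2) x]) (simp add: X(1))
  qed (rule V'_comp; use x X(1) in auto)+
qed

lemma W_comp_meas:
  assumes "y \<in> borel_measurable borel"
  shows "(\<lambda>t. W s t (y t)) \<in> borel_measurable borel"
  unfolding W_def
  by (rule primitive_measurable, rule V_comp) (use assms in \<open>auto simp: borel_prod[symmetric]\<close>)

lemma W'_comp_meas:
  assumes "y \<in> borel_measurable borel" "\<And>t. y t \<in> \<Omega>"
  shows "(\<lambda>t. W' s t (y t)) \<in> borel_measurable borel"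
  unfolding W'_def
  by (rule primitive_measurable, rule V'_comp) (use assms in \<open>auto simp: borel_prod[symmetric]\<close>)

sublocale field: lipschitz_field \<Omega> "W s" "W' s" l for s
proof
  show "(\<lambda>t. W s t (y t)) \<in> borel_measurable borel" if "continuous_on UNIV y" for y
    by (rule W_comp_meas[OF borel_measurable_continuous_onI[OF that]])
  show "(\<lambda>t. W' s t (y t)) \<in> borel_measurable borel" if "continuous_on UNIV y" "range y \<subseteq> \<Omega>" for y
    by (rule W'_comp_meas[OF borel_measurable_continuous_onI[OF that(1)]]) (use that in auto)
  show "W s t x = 0" if "x \<notin> \<Omega>" for t x
    using that by (simp add: W_def V_off primitive_def set_lebesgue_integral_def)
qed (rule open_dom l_int l_nonneg W_bound W_lip W_der W'_cont; assumption?)+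

end

section \<open>Continuity of the flow and its derivatives in the parameter\<close>

locale flow_family = lipschitz_field_family +
  fixes \<psi> :: "real \<Rightarrow> real \<Rightarrow> 'a \<Rightarrow> 'a"
  assumes conn: "connected \<Omega>" and nonempty: "\<Omega> \<noteq> {}"
    and flow_in: "\<And>s t x. x \<in> \<Omega> \<Longrightarrow> \<psi> s t x \<in> \<Omega>"
    and flow_cont: "\<And>s x. x \<in> \<Omega> \<Longrightarrow> continuous_on UNIV (\<lambda>t. \<psi> s t x)"
    and flow_eq: "\<And>s t x. x \<in> \<Omega> \<Longrightarrow> \<psi> s t x = primitive x (\<lambda>\<tau>. W s \<tau> (\<psi> s \<tau> x)) t"
begin

sublocale flow: flow_of_field \<Omega> "W s" "W' s" l "\<psi> s" for s
proof
  show "field.solution s x (\<lambda>t. \<psi> s t x)" if "x \<in> \<Omega>" for x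
    unfolding field.solution_def using flow_cont[OF that] flow_eq[OF that] by blast
qed (use conn nonempty flow_in in auto)

abbreviation C where "C \<equiv> 2 * exp (2 * integral\<^sup>L lborel l)"
abbreviation \<alpha> where "\<alpha> \<equiv> primitive 0 \<mu>"

text \<open>Fubini: summed over all times, the perturbation from \<open>W s\<close> to
  \<open>W u\<close> has size at most the increment of \<open>\<alpha>\<close>. This makes
  \<open>\<alpha>\<close> the natural scale for increments in the parameter.\<close>

lemma m_strip:
  assumes "s \<le> u"
  shows "integrable lborel (\<lambda>t. LBINT r:{s<..u}. m t r)"
    and "(LBINT t. LBINT r:{s<..u}. m t r) = \<alpha> u - \<alpha> s"
proof -
  have i: "integrable (lborel \<Otimes>\<^sub>M lborel) (\<lambda>(t, r). indicator {s<..u} r *\<^sub>R m t r)"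
  proof (rule Bochner_Integration.integrable_bound[OF m_int])
    show "(\<lambda>(t, r). indicator {s<..u} r *\<^sub>R m t r) \<in> borel_measurable (lborel \<Otimes>\<^sub>M lborel)"
      using borel_measurable_integrable[OF m_int] unfolding split_def by measurable
  qed (auto simp: indicator_def)
  show "integrable lborel (\<lambda>t. LBINT r:{s<..u}. m t r)"
    using lborel_pair.integrable_fst'[OF i] by (simp add: set_lebesgue_integral_def)
  have "(LBINT t. LBINT r:{s<..u}. m t r) = (LBINT r. LBINT t. indicator {s<..u} r *\<^sub>R m t r)"
    using lborel_pair.Fubini_integral[OF i] by (simp add: set_lebesgue_integral_def)
  also have "\<dots> = (LBINT r:{s<..u}. \<mu> r)" by (simp add: set_lebesgue_integral_def \<mu>_def)
  also have "\<dots> = \<alpha> u - \<alpha> s" by (rule primitive_diff[OF \<mu>_int assms, symmetric])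
  finally show "(LBINT t. LBINT r:{s<..u}. m t r) = \<alpha> u - \<alpha> s" .
qed

lemma W_increment:
  assumes "s \<le> u"
  shows "W u t x - W s t x = (LBINT r:{s<..u}. V t r x)"
    and "norm (W u t x - W s t x) \<le> (LBINT r:{s<..u}. m t r)"
proof -
  show eq: "W u t x - W s t x = (LBINT r:{s<..u}. V t r x)"
    unfolding W_def by (rule primitive_diff[OF V_int1 assms])
  show "norm (W u t x - W s t x) \<le> (LBINT r:{s<..u}. m t r)"
    unfolding eq by (intro set_lebesgue_integral_norm_bound set_integrable_lborel_subset m_int1 V_bound) simp
qed

lemma flow_meas: "x \<in> \<Omega> \<Longrightarrow> (\<lambda>t. \<psi> s t x) \<in> borel_measurable borel"
  by (rule borel_measurable_continuous_onI[OF flow_cont])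

text \<open>The intermediate term is \<open>W s\<close> along the trajectory of \<open>u\<close>.
  Thus \<open>q\<close> compares one field at two points and can be linearized, while the forcing
  \<open>b\<close> is an integral of \<open>V\<close> over the strip between \<open>s\<close> and
  \<open>u\<close>.\<close>

lemma flow_increment:
  assumes x: "x \<in> \<Omega>" and su: "s \<le> u"
  defines "b \<equiv> \<lambda>\<tau>. W u \<tau> (\<psi> u \<tau> x) - W s \<tau> (\<psi> u \<tau> x)"
    and "q \<equiv> \<lambda>\<tau>. W s \<tau> (\<psi> u \<tau> x) - W s \<tau> (\<psi> s \<tau> x)"
  shows "integrable lborel b" "integrable lborel q"
    and "\<psi> u t x - \<psi> s t x = primitive 0 (\<lambda>\<tau>. b \<tau> + q \<tau>) t"
    and "(LBINT \<tau>. norm (b \<tau>)) \<le> \<alpha> u - \<alpha> s"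
    and "norm (\<psi> u t x - \<psi> s t x) \<le> C * (\<alpha> u - \<alpha> s)"
proof -
  have i: "integrable lborel (\<lambda>\<tau>. W a \<tau> (\<psi> c \<tau> x))" for a c
    by (rule field.w_comp_integrable[OF flow_cont[OF x]])
  show ib: "integrable lborel b" and iq: "integrable lborel q"
    unfolding b_def q_def by (intro Bochner_Integration.integrable_diff i)+
  have s: "\<psi> c t x = primitive x (\<lambda>\<tau>. W c \<tau> (\<psi> c \<tau> x)) t" for c t
    by (rule field.solutionD(2)[OF flow.flow_sol[OF x]])
  show eq: "\<psi> u t x - \<psi> s t x = primitive 0 (\<lambda>\<tau>. b \<tau> + q \<tau>) t" for t
    unfolding s[of u t] s[of s t] primitive_def b_def q_def
    by (simp add: set_integral_diff(2)[OF set_integrable_lborel_subset[OF i] set_integrable_lborel_subset[OF i]])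
  show nb: "(LBINT \<tau>. norm (b \<tau>)) \<le> \<alpha> u - \<alpha> s"
    unfolding m_strip(2)[OF su, symmetric]
    by (rule integral_mono) (use ib m_strip(1)[OF su] W_increment(2)[OF su] in \<open>auto simp: b_def\<close>)
  have "norm (primitive 0 (\<lambda>\<tau>. b \<tau> + q \<tau>) t) \<le> C * (norm (0::'a) + (LBINT \<tau>. norm (b \<tau>)))"
  proof (rule ode_bound[OF l_int l_nonneg])
    show "norm (b \<tau> + q \<tau>) \<le> l \<tau> * norm (primitive 0 (\<lambda>\<tau>. b \<tau> + q \<tau>) \<tau>) + norm (b \<tau>)" for \<tau>
    proof -
      have "norm (q \<tau>) \<le> l \<tau> * norm (primitive 0 (\<lambda>\<tau>. b \<tau> + q \<tau>) \<tau>)"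
        unfolding eq[symmetric] by (simp add: q_def W_lip)
      then show ?thesis using norm_triangle_ineq[of "b \<tau>" "q \<tau>"] by linarith
    qed
  qed (use ib iq in auto)
  also have "\<dots> \<le> C * (\<alpha> u - \<alpha> s)" using nb by (intro mult_left_mono) auto
  finally show "norm (\<psi> u t x - \<psi> s t x) \<le> C * (\<alpha> u - \<alpha> s)" unfolding eq .
qed

lemma flow_dist_parameter:
  assumes x: "x \<in> \<Omega>"
  shows "norm (\<psi> u t x - \<psi> s t x) \<le> C * \<bar>\<alpha> u - \<alpha> s\<bar>"
proof (cases "s \<le> u")
  case True
  show ?thesis by (rule order_trans[OF flow_increment(5)[OF x True]]) simp
next
  case False
  then have "norm (\<psi> s t x - \<psi> u t x) \<le> C * (\<alpha> s - \<alpha> u)" by (intro flow_increment(5)[OF x]) simp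
  also have "\<dots> \<le> C * \<bar>\<alpha> s - \<alpha> u\<bar>" by (intro mult_left_mono) auto
  finally show ?thesis by (simp only: norm_minus_commute abs_minus_commute)
qed

lemma \<alpha>_cont: "continuous_on UNIV \<alpha>" by (rule continuous_primitive[OF \<mu>_int])

lemma \<alpha>_tendsto: "X \<longlonglongrightarrow> s \<Longrightarrow> (\<lambda>n. \<alpha> (X n)) \<longlonglongrightarrow> \<alpha> s"
  by (rule tendsto_primitive[OF \<mu>_int])

lemma flow_tendsto_parameter:
  assumes x: "x \<in> \<Omega>" and X: "X \<longlonglongrightarrow> s"
  shows "(\<lambda>n. \<psi> (X n) t x) \<longlonglongrightarrow> \<psi> s t x"
proof (rule LIM_zero_cancel, rule Lim_null_comparison)
  show "\<forall>\<^sub>F n in sequentially. norm (\<psi> (X n) t x - \<psi> s t x) \<le> C * \<bar>\<alpha> (X n) - \<alpha> s\<bar>"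
    by (intro always_eventually allI flow_dist_parameter x)
  show "(\<lambda>n. C * \<bar>\<alpha> (X n) - \<alpha> s\<bar>) \<longlonglongrightarrow> 0"
    by (rule tendsto_mult_right_zero, rule tendsto_rabs_zero, rule LIM_zero, rule \<alpha>_tendsto[OF X])
qed

text \<open>First the point moves in the fixed derivative field \<open>W' s t\<close>, which is
  continuous; then the field changes, by at most an increment of the primitive of
  \<open>m t\<close>, uniformly over \<open>\<Omega>\<close>. Both limits are pointwise in time,
  with dominating function \<open>2 * l\<close>.\<close>

lemma A_tendsto_parameter:
  assumes x: "x \<in> \<Omega>" and X: "X \<longlonglongrightarrow> s"
  shows "(\<lambda>n. LBINT t. norm (flow.A (X n) x t - flow.A s x t)) \<longlonglongrightarrow> 0"
proof -
  have "(\<lambda>n. LBINT t. norm (flow.A (X n) x t - flow.A s x t)) \<longlonglongrightarrow> integral\<^sup>L (lborel :: real measure) (\<lambda>_. 0)"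
  proof (rule integral_dominated_convergence[where w="\<lambda>\<tau>. 2 * l \<tau>"])
    show "AE t in lborel. (\<lambda>n. norm (flow.A (X n) x t - flow.A s x t)) \<longlonglongrightarrow> 0"
    proof (rule AE_I2)
      fix t
      have 1: "(\<lambda>n. W' s t (\<psi> (X n) t x)) \<longlonglongrightarrow> W' s t (\<psi> s t x)"
        by (rule continuous_on_tendsto_compose[OF W'_cont flow_tendsto_parameter[OF x X] flow_in[OF x]])
          (simp add: flow_in[OF x])
      have 2: "(\<lambda>n. W' (X n) t (\<psi> (X n) t x) - W' s t (\<psi> (X n) t x)) \<longlonglongrightarrow> 0"
      proof (rule Lim_null_comparison)
        have le: "norm (W' u t y - W' s t y) \<le> \<bar>primitive 0 (m t) u - primitive 0 (m t) s\<bar>" if y: "y \<in> \<Omega>" for u y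
        proof (cases "s \<le> u")
          case True
          show ?thesis unfolding W'_def
            by (rule order_trans[OF primitive_norm_diff_le[OF V'_int1[OF y] m_int1 V'_bound[OF y] True] abs_ge_self])
        next
          case False
          then have us: "u \<le> s" by simp
          show ?thesis unfolding W'_def norm_minus_commute[of "primitive 0 _ u"] abs_minus_commute[of "primitive 0 (m t) u"]
            by (rule order_trans[OF primitive_norm_diff_le[OF V'_int1[OF y] m_int1 V'_bound[OF y] us] abs_ge_self])
        qed
        show "\<forall>\<^sub>F n in sequentially. norm (W' (X n) t (\<psi> (X n) t x) - W' s t (\<psi> (X n) t x))
            \<le> \<bar>primitive 0 (m t) (X n) - primitive 0 (m t) s\<bar>"
          by (intro always_eventually allI le flow_in x)
        show "(\<lambda>n. \<bar>primitive 0 (m t) (X n) - primitive 0 (m t) s\<bar>) \<longlonglongrightarrow> 0"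
          by (rule tendsto_rabs_zero, rule LIM_zero, rule tendsto_primitive[OF m_int1 X])
      qed
      have "(\<lambda>n. flow.A (X n) x t) \<longlonglongrightarrow> flow.A s x t"
        unfolding flow.A_def using tendsto_add[OF 1 2] by simp
      then show "(\<lambda>n. norm (flow.A (X n) x t - flow.A s x t)) \<longlonglongrightarrow> 0" by (intro tendsto_norm_zero LIM_zero)
    qed
    show "AE t in lborel. norm (norm (flow.A (X n) x t - flow.A s x t)) \<le> 2 * l t" for n
    proof (rule AE_I2)
      fix t
      show "norm (norm (flow.A (X n) x t - flow.A s x t)) \<le> 2 * l t"
        using norm_triangle_ineq4[of "flow.A (X n) x t" "flow.A s x t"] flow.A_bound[OF x, of "X n" t] flow.A_bound[OF x, of s t]
        by simp
    qed
  qed (use l_int flow.A_meas[OF x] in auto)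
  then show ?thesis by simp
qed

text \<open>A common modulus of continuity of \<open>J\<close> and \<open>K\<close> in the
  parameter, uniform in time; the constant is that of
  \<open>fundamental_solution_dependence\<close>.\<close>

definition \<kappa> where "\<kappa> x s u = C\<^sup>2 * (LBINT t. norm (flow.A u x t - flow.A s x t))"

lemma J_dist: "x \<in> \<Omega> \<Longrightarrow> norm (flow.J u x t - flow.J s x t) \<le> \<kappa> x s u"
  unfolding \<kappa>_def
  by (rule fundamental_solution_dependence(1)[OF l_int l_nonneg flow.A_meas flow.A_bound flow.A_meas flow.A_bound flow.J flow.J])

lemma K_dist: "x \<in> \<Omega> \<Longrightarrow> norm (flow.K u x t - flow.K s x t) \<le> \<kappa> x s u"
  unfolding \<kappa>_def
  by (rule fundamental_solution_dependence(2)[OF l_int l_nonneg flow.A_meas flow.A_bound flow.A_meas flow.A_bound flow.K flow.K])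

lemma \<kappa>_tendsto: "x \<in> \<Omega> \<Longrightarrow> X \<longlonglongrightarrow> s \<Longrightarrow> (\<lambda>n. \<kappa> x s (X n)) \<longlonglongrightarrow> 0"
  unfolding \<kappa>_def by (rule tendsto_mult_right_zero[OF A_tendsto_parameter])

lemma J_cont: "x \<in> \<Omega> \<Longrightarrow> continuous_on UNIV (\<lambda>s. flow.J s x t)"
  unfolding continuous_on_sequentially o_def
proof (intro allI ballI impI)
  fix X :: "nat \<Rightarrow> real" and s assume x: "x \<in> \<Omega>" and "(\<forall>n. X n \<in> UNIV) \<and> X \<longlonglongrightarrow> s"
  then have X: "X \<longlonglongrightarrow> s" by simp
  show "(\<lambda>n. flow.J (X n) x t) \<longlonglongrightarrow> flow.J s x t"
    by (rule LIM_zero_cancel, rule Lim_null_comparison[OF _ \<kappa>_tendsto[OF x X]])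
      (intro always_eventually allI J_dist x)
qed

lemma K_cont_time: "x \<in> \<Omega> \<Longrightarrow> continuous_on UNIV (flow.K s x)"
  using continuous_primitive[OF linear_solutionD(1)[OF flow.K]]
  by (metis (no_types, lifting) ext linear_solutionD(2)[OF flow.K])

text \<open>Because \<open>\<kappa>\<close> does not involve the time, continuity in the parameter
  is uniform in time and combines with continuity in time. Joint continuity is what makes the
  integrand of \<open>P\<close> jointly measurable.\<close>

lemma K_cont: "x \<in> \<Omega> \<Longrightarrow> continuous_on UNIV (\<lambda>p. flow.K (fst p) x (snd p))"
  unfolding continuous_on_sequentially o_def
proof (intro allI ballI impI)
  fix X and p :: "real \<times> real" assume x: "x \<in> \<Omega>" and "(\<forall>n. X n \<in> UNIV) \<and> X \<longlonglongrightarrow> p"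
  then have X: "X \<longlonglongrightarrow> p" by simp
  have 1: "(\<lambda>n. flow.K (fst (X n)) x (snd (X n)) - flow.K (fst p) x (snd (X n))) \<longlonglongrightarrow> 0"
    by (rule Lim_null_comparison[OF _ \<kappa>_tendsto[OF x tendsto_fst[OF X]]])
      (intro always_eventually allI K_dist x)
  have 2: "(\<lambda>n. flow.K (fst p) x (snd (X n))) \<longlonglongrightarrow> flow.K (fst p) x (snd p)"
    by (rule continuous_on_tendsto_compose[OF K_cont_time[OF x] tendsto_snd[OF X]]) auto
  show "(\<lambda>n. flow.K (fst (X n)) x (snd (X n))) \<longlonglongrightarrow> flow.K (fst p) x (snd p)"
    using tendsto_add[OF 1 2] by simp
qed

lemma flow_cont2: "x \<in> \<Omega> \<Longrightarrow> continuous_on UNIV (\<lambda>p. \<psi> (fst p) (snd p) x)"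
  unfolding continuous_on_sequentially o_def
proof (intro allI ballI impI)
  fix X and p :: "real \<times> real" assume x: "x \<in> \<Omega>" and "(\<forall>n. X n \<in> UNIV) \<and> X \<longlonglongrightarrow> p"
  then have X: "X \<longlonglongrightarrow> p" by simp
  have 1: "(\<lambda>n. \<psi> (fst (X n)) (snd (X n)) x - \<psi> (fst p) (snd (X n)) x) \<longlonglongrightarrow> 0"
  proof (rule Lim_null_comparison)
    show "\<forall>\<^sub>F n in sequentially. norm (\<psi> (fst (X n)) (snd (X n)) x - \<psi> (fst p) (snd (X n)) x) \<le> C * \<bar>\<alpha> (fst (X n)) - \<alpha> (fst p)\<bar>"
      by (intro always_eventually allI flow_dist_parameter x)
    show "(\<lambda>n. C * \<bar>\<alpha> (fst (X n)) - \<alpha> (fst p)\<bar>) \<longlonglongrightarrow> 0"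
      by (rule tendsto_mult_right_zero, rule tendsto_rabs_zero, rule LIM_zero, rule \<alpha>_tendsto[OF tendsto_fst[OF X]])
  qed
  have 2: "(\<lambda>n. \<psi> (fst p) (snd (X n)) x) \<longlonglongrightarrow> \<psi> (fst p) (snd p) x"
    by (rule continuous_on_tendsto_compose[OF flow_cont[OF x] tendsto_snd[OF X]]) auto
  show "(\<lambda>n. \<psi> (fst (X n)) (snd (X n)) x) \<longlonglongrightarrow> \<psi> (fst p) (snd p) x"
    using tendsto_add[OF 1 2] by simp
qed

text \<open>\<open>P\<close> is the integral of the fields pulled back to the initial point
  \<open>x\<close>, that is, the inner integral of the theorem at \<open>x\<close>. Pushed forward
  by \<open>J\<close> it becomes \<open>G\<close>, the asserted vector field at the point
  \<open>\<psi> s t x\<close>.\<close>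

definition P where "P s x t = primitive 0 (\<lambda>\<tau>. flow.K s x \<tau> (V \<tau> s (\<psi> s \<tau> x))) t"
definition G where "G s x t = flow.J s x t (P s x t)"

lemma KV_meas:
  assumes "x \<in> \<Omega>"
  shows "(\<lambda>p. flow.K (fst p) x (snd p) (V (snd p) (fst p) (\<psi> (fst p) (snd p) x))) \<in> borel_measurable borel"
  by (rule borel_measurable_bilinear[OF bounded_bilinear_blinfun_apply
        borel_measurable_continuous_onI[OF K_cont[OF assms]] V_comp[OF _ _ borel_measurable_continuous_onI[OF flow_cont2[OF assms]]]])
    (auto simp: borel_prod[symmetric])

lemma KV_bound: "x \<in> \<Omega> \<Longrightarrow> norm (flow.K s x \<tau> (V \<tau> r y)) \<le> C * m \<tau> r"
  by (rule order_trans[OF norm_blinfun]) (intro mult_mono flow.K_bound V_bound; simp)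

lemma KV_int:
  assumes x: "x \<in> \<Omega>" and y: "y \<in> borel_measurable borel"
  shows "integrable lborel (\<lambda>\<tau>. flow.K s x \<tau> (V \<tau> r (y \<tau>)))"
proof (rule integrable_dominated[OF _ _ KV_bound[OF x]])
  show "(\<lambda>\<tau>. flow.K s x \<tau> (V \<tau> r (y \<tau>))) \<in> borel_measurable borel"
    by (rule borel_measurable_bilinear[OF bounded_bilinear_blinfun_apply borel_measurable_continuous_onI[OF K_cont_time[OF x]] V_comp[OF _ _ y]])
      auto
qed (use m_int2 in auto)

lemma P_bound: "x \<in> \<Omega> \<Longrightarrow> norm (P s x t) \<le> C * \<mu> s"
  using primitive_norm_le[OF _ KV_bound, where c=0] m_int2 by (simp add: P_def \<mu>_def)

lemma G_bound: "x \<in> \<Omega> \<Longrightarrow> norm (G s x t) \<le> C * (C * \<mu> s)"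
  unfolding G_def by (rule order_trans[OF norm_blinfun]) (intro mult_mono flow.J_bound P_bound; simp)

lemma G_int:
  assumes x: "x \<in> \<Omega>"
  shows "integrable lborel (\<lambda>s. G s x t)"
proof (rule integrable_dominated[OF _ _ G_bound[OF x]])
  show "(\<lambda>s. G s x t) \<in> borel_measurable borel"
    unfolding G_def P_def
    by (rule borel_measurable_bilinear[OF bounded_bilinear_blinfun_apply borel_measurable_continuous_onI[OF J_cont[OF x]]
          primitive_measurable[OF KV_meas[OF x]]])
qed (use \<mu>_int in auto)

end

section \<open>The flow as a function of the parameter\<close>

context flow_family
begin

text \<open>\<open>linearization\<close> yields an integral over time of increments of the field.
  Exchanging time and parameter turns it into an integral over the strip, which can be compared with
  the increment of the primitive of \<open>G\<close>.\<close>

lemma Fubini_strip: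
  fixes t :: real
  assumes x: "x \<in> \<Omega>" and su: "s \<le> u" and y: "y \<in> borel_measurable borel"
  defines "Q \<equiv> \<lambda>r. primitive 0 (\<lambda>\<tau>. flow.K s x \<tau> (V \<tau> r (y \<tau>))) t"
  shows "set_integrable lborel {s<..u} Q"
    and "primitive 0 (\<lambda>\<tau>. flow.K s x \<tau> (W u \<tau> (y \<tau>) - W s \<tau> (y \<tau>))) t = (LBINT r:{s<..u}. Q r)"
proof -
  define g where "g \<tau> r = indicator {..t} \<tau> *\<^sub>R indicator {s<..u} r *\<^sub>R flow.K s x \<tau> (V \<tau> r (y \<tau>))" for \<tau> r
  have i: "integrable (lborel \<Otimes>\<^sub>M lborel) (\<lambda>(\<tau>, r). g \<tau> r)"
  proof (rule Bochner_Integration.integrable_bound)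
    show "integrable (lborel \<Otimes>\<^sub>M lborel) (\<lambda>p. C * (case p of (\<tau>, r) \<Rightarrow> m \<tau> r))" using m_int by simp
    have "(\<lambda>p. flow.K s x (fst p) (V (fst p) (snd p) (y (fst p)))) \<in> borel_measurable (lborel \<Otimes>\<^sub>M lborel)"
    proof (rule borel_measurable_bilinear[OF bounded_bilinear_blinfun_apply])
      show "(\<lambda>p. flow.K s x (fst p)) \<in> borel_measurable (lborel \<Otimes>\<^sub>M lborel)"
        using borel_measurable_continuous_onI[OF K_cont_time[OF x]] by measurable
      show "(\<lambda>p. V (fst p) (snd p) (y (fst p))) \<in> borel_measurable (lborel \<Otimes>\<^sub>M lborel)"
        by (rule V_comp) (use y in measurable)
    qed
    then show "(\<lambda>(\<tau>, r). g \<tau> r) \<in> borel_measurable (lborel \<Otimes>\<^sub>M lborel)"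
      unfolding g_def split_def by measurable
    show "AE p in lborel \<Otimes>\<^sub>M lborel. norm (case p of (\<tau>, r) \<Rightarrow> g \<tau> r) \<le> norm (C * (case p of (\<tau>, r) \<Rightarrow> m \<tau> r))"
    proof (rule AE_I2)
      fix p :: "real \<times> real"
      obtain \<tau> r where p: "p = (\<tau>, r)" by fastforce
      have "norm (g \<tau> r) \<le> norm (flow.K s x \<tau> (V \<tau> r (y \<tau>)))" by (simp add: g_def indicator_def)
      also have "\<dots> \<le> C * m \<tau> r" by (rule KV_bound[OF x])
      finally show "norm (case p of (\<tau>, r) \<Rightarrow> g \<tau> r) \<le> norm (C * (case p of (\<tau>, r) \<Rightarrow> m \<tau> r))"
        by (simp add: p)
    qed
  qed
  have Q: "(LBINT \<tau>. g \<tau> r) = indicator {s<..u} r *\<^sub>R Q r" for r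
  proof -
    have "g \<tau> r = indicator {s<..u} r *\<^sub>R (indicator {..t} \<tau> *\<^sub>R flow.K s x \<tau> (V \<tau> r (y \<tau>)))" for \<tau>
      by (simp add: g_def mult.commute)
    then show ?thesis by (simp only: integral_scaleR_right Q_def primitive_def set_lebesgue_integral_def add_0)
  qed
  show "set_integrable lborel {s<..u} Q"
    using lborel_pair.integrable_snd[OF i] by (simp add: set_integrable_def Q)
  have b: "flow.K s x \<tau> (W u \<tau> (y \<tau>) - W s \<tau> (y \<tau>)) = (LBINT r:{s<..u}. flow.K s x \<tau> (V \<tau> r (y \<tau>)))" for \<tau>
    unfolding W_increment(1)[OF su] set_lebesgue_integral_def blinfun.scaleR_right[symmetric]
    by (rule integral_bounded_linear[OF blinfun.bounded_linear_right, symmetric])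
      (use set_integrable_lborel_subset[OF V_int1, of "{s<..u}"] in \<open>simp add: set_integrable_def\<close>)
  have "primitive 0 (\<lambda>\<tau>. flow.K s x \<tau> (W u \<tau> (y \<tau>) - W s \<tau> (y \<tau>))) t = (LBINT \<tau>. LBINT r. g \<tau> r)"
    unfolding b by (simp only: primitive_def set_lebesgue_integral_def g_def integral_scaleR_right add_0)
  also have "\<dots> = (LBINT r. LBINT \<tau>. g \<tau> r)" by (rule lborel_pair.Fubini_integral[OF i, symmetric])
  also have "\<dots> = (LBINT r:{s<..u}. Q r)" by (simp add: Q set_lebesgue_integral_def)
  finally show "primitive 0 (\<lambda>\<tau>. flow.K s x \<tau> (W u \<tau> (y \<tau>) - W s \<tau> (y \<tau>))) t = (LBINT r:{s<..u}. Q r)" .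
qed

lemma \<kappa>_nonneg: "0 \<le> \<kappa> x s u"
  unfolding \<kappa>_def by (intro mult_nonneg_nonneg Bochner_Integration.integral_nonneg) auto

lemma \<alpha>_mono: "s \<le> u \<Longrightarrow> \<alpha> s \<le> \<alpha> u"
  using primitive_norm_diff_le[OF \<mu>_int \<mu>_int, of s u 0 0] \<mu>_nonneg
  by (smt (verit) norm_ge_zero real_norm_def)

text \<open>In \<open>Q\<close> the operator \<open>K\<close> belongs to \<open>s\<close> and the
  trajectory to \<open>u\<close>, in \<open>G r x t\<close> everything belongs to \<open>r\<close>.
  Exchanging \<open>K\<close> and exchanging \<open>J\<close> cost \<open>C * \<kappa> x s r\<close>
  each; moving the trajectory costs one \<open>C\<close> for the distance of the flows, one for
  \<open>K\<close> and one for \<open>J\<close>.\<close>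

lemma P_frozen_dist:
  fixes t :: real
  assumes x: "x \<in> \<Omega>" and r: "s \<le> r" "r \<le> u"
  defines "Q \<equiv> primitive 0 (\<lambda>\<tau>. flow.K s x \<tau> (V \<tau> r (\<psi> u \<tau> x))) t"
  shows "norm (flow.J s x t Q - G r x t) \<le> (2 * C * \<kappa> x s r + C * C * C * (\<alpha> u - \<alpha> s)) * \<mu> r"
proof -
  have alg1: "k * m + c * (m * (c * a)) = (k + c * c * a) * m"
    and alg2: "c * ((k + c * c * a) * m) + k * (c * m) = (2 * c * k + c * c * c * a) * m" for k m c a :: real
    by algebra+
  let ?c = "\<kappa> x s r + C * C * (\<alpha> u - \<alpha> s)"
  have i1: "integrable lborel (\<lambda>\<tau>. flow.K s x \<tau> (V \<tau> r (\<psi> u \<tau> x)))"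
    and i2: "integrable lborel (\<lambda>\<tau>. flow.K r x \<tau> (V \<tau> r (\<psi> r \<tau> x)))"
    by (rule KV_int[OF x flow_meas[OF x]])+
  have "norm (primitive 0 (\<lambda>\<tau>. flow.K s x \<tau> (V \<tau> r (\<psi> u \<tau> x)) - flow.K r x \<tau> (V \<tau> r (\<psi> r \<tau> x))) t - 0)
     \<le> (LBINT \<tau>. ?c * m \<tau> r)"
  proof (rule primitive_norm_le)
    show "integrable lborel (\<lambda>\<tau>. ?c * m \<tau> r)" using m_int2 by simp
    fix \<tau>
    let ?D = "flow.K s x \<tau> (V \<tau> r (\<psi> u \<tau> x)) - flow.K r x \<tau> (V \<tau> r (\<psi> r \<tau> x))"
    have D: "?D = (flow.K s x \<tau> - flow.K r x \<tau>) (V \<tau> r (\<psi> u \<tau> x)) + flow.K r x \<tau> (V \<tau> r (\<psi> u \<tau> x) - V \<tau> r (\<psi> r \<tau> x))"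
      by (simp add: blinfun.bilinear_simps)
    have "norm ?D \<le> \<kappa> x s r * m \<tau> r + C * (m \<tau> r * (C * (\<alpha> u - \<alpha> s)))"
      unfolding D
    proof (intro order_trans[OF norm_triangle_ineq] add_mono order_trans[OF norm_blinfun])
      show "norm (flow.K s x \<tau> - flow.K r x \<tau>) * norm (V \<tau> r (\<psi> u \<tau> x)) \<le> \<kappa> x s r * m \<tau> r"
        using K_dist[OF x, of r \<tau> s] V_bound \<kappa>_nonneg by (intro mult_mono) (auto simp: norm_minus_commute)
      have "norm (V \<tau> r (\<psi> u \<tau> x) - V \<tau> r (\<psi> r \<tau> x)) \<le> m \<tau> r * norm (\<psi> u \<tau> x - \<psi> r \<tau> x)" by (rule V_lip)
      also have "\<dots> \<le> m \<tau> r * (C * (\<alpha> u - \<alpha> s))"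
      proof (rule mult_left_mono[OF _ m_nonneg])
        have "norm (\<psi> u \<tau> x - \<psi> r \<tau> x) \<le> C * (\<alpha> u - \<alpha> r)" by (rule flow_increment(5)[OF x r(2)])
        also have "\<dots> \<le> C * (\<alpha> u - \<alpha> s)" using \<alpha>_mono[OF r(1)] by (intro mult_left_mono) auto
        finally show "norm (\<psi> u \<tau> x - \<psi> r \<tau> x) \<le> C * (\<alpha> u - \<alpha> s)" .
      qed
      finally show "norm (flow.K r x \<tau>) * norm (V \<tau> r (\<psi> u \<tau> x) - V \<tau> r (\<psi> r \<tau> x)) \<le> C * (m \<tau> r * (C * (\<alpha> u - \<alpha> s)))"
        by (intro mult_mono flow.K_bound[OF x]) auto
    qed
    also have "\<dots> = ?c * m \<tau> r" by (rule alg1)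
    finally show "norm ?D \<le> ?c * m \<tau> r" .
  qed
  also have "primitive 0 (\<lambda>\<tau>. flow.K s x \<tau> (V \<tau> r (\<psi> u \<tau> x)) - flow.K r x \<tau> (V \<tau> r (\<psi> r \<tau> x))) t - 0 = Q - P r x t"
    unfolding Q_def P_def primitive_def
    by (subst set_integral_diff(2)) (auto intro: set_integrable_lborel_subset i1 i2)
  also have "(LBINT \<tau>. ?c * m \<tau> r) = ?c * \<mu> r" by (simp add: \<mu>_def)
  finally have QP: "norm (Q - P r x t) \<le> ?c * \<mu> r" .
  have D: "flow.J s x t Q - G r x t = flow.J s x t (Q - P r x t) + (flow.J s x t - flow.J r x t) (P r x t)"
    unfolding G_def by (simp add: blinfun.bilinear_simps)
  have "norm (flow.J s x t Q - G r x t) \<le> C * (?c * \<mu> r) + \<kappa> x s r * (C * \<mu> r)"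
    unfolding D
  proof (intro order_trans[OF norm_triangle_ineq] add_mono order_trans[OF norm_blinfun] mult_mono QP P_bound[OF x] flow.J_bound[OF x])
    show "norm (flow.J s x t - flow.J r x t) \<le> \<kappa> x s r"
      using J_dist[OF x, of r t s] by (simp add: norm_minus_commute)
  qed (use \<kappa>_nonneg in auto)
  also have "\<dots> = (2 * C * \<kappa> x s r + C * C * C * (\<alpha> u - \<alpha> s)) * \<mu> r" by (rule alg2)
  finally show ?thesis .
qed

text \<open>Two replacements: \<open>linearization\<close> at \<open>s\<close> exchanges the
  increment of the flow for \<open>J\<close> applied to the integral of \<open>K b\<close>, and
  \<open>P_frozen_dist\<close> exchanges this for the integral of \<open>G\<close>. Both errors are
  small relative to the increment of \<open>\<alpha>\<close>.\<close>

lemma flow_parameter_step: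
  assumes x: "x \<in> \<Omega>" and e: "0 < e"
  shows "\<forall>\<^sub>F u in at_right s. norm (\<psi> u t x - \<psi> s t x
      - (primitive 0 (\<lambda>\<sigma>. G \<sigma> x t) u - primitive 0 (\<lambda>\<sigma>. G \<sigma> x t) s)) \<le> e * (\<alpha> u - \<alpha> s)"
\<comment> \<open>\<open>linearization\<close> is about sequences, so right neighbourhoods are
  tested along them; \<open>s + 1\<close> is merely some point to the right of
  \<open>s\<close>.\<close>
proof (rule sequentially_imp_eventually_at_right[of s "s + 1"])
  fix X :: "nat \<Rightarrow> real" assume sX: "\<And>n. s < X n" and X: "X \<longlonglongrightarrow> s"
  have le: "s \<le> X n" for n using sX[of n] by simp
  define b where "b n \<tau> = W (X n) \<tau> (\<psi> (X n) \<tau> x) - W s \<tau> (\<psi> (X n) \<tau> x)" for n \<tau>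
  define q where "q n \<tau> = W s \<tau> (\<psi> (X n) \<tau> x) - W s \<tau> (\<psi> s \<tau> x)" for n \<tau>
  define a where "a n = \<alpha> (X n) - \<alpha> s" for n
  note inc = flow_increment[OF x le]
  have a0: "0 \<le> a n" for n unfolding a_def using \<alpha>_mono[OF le] by simp
  have a: "a \<longlonglongrightarrow> 0" unfolding a_def by (rule LIM_zero[OF \<alpha>_tendsto[OF X]])
  have "\<exists>e'. e' \<longlonglongrightarrow> 0 \<and> (\<forall>n t. norm (flow.K s x t (\<psi> (X n) t x - \<psi> s t x)
      - primitive 0 (\<lambda>\<tau>. flow.K s x \<tau> (b n \<tau>)) t) \<le> e' n * a n)"
  proof (rule linearization[OF l_int l_nonneg flow.A_meas[OF x] flow.A_bound[OF x] flow.K[OF x], where q=q])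
    show "integrable lborel (b n)" "integrable lborel (q n)" for n
      unfolding b_def q_def by (rule inc(1), rule inc(2))
    show "\<psi> (X n) t x - \<psi> s t x = primitive 0 (\<lambda>\<tau>. b n \<tau> + q n \<tau>) t" for n t
      unfolding b_def q_def by (rule inc(3))
    show "norm (q n \<tau>) \<le> l \<tau> * norm (\<psi> (X n) \<tau> x - \<psi> s \<tau> x)" for n \<tau>
      unfolding q_def by (rule W_lip)
    show "norm (0::'a) + (LBINT \<tau>. norm (b n \<tau>)) \<le> a n" for n
      unfolding b_def a_def using inc(4) by simp
    show "(\<lambda>n. norm (q n \<tau> - flow.A s x \<tau> (\<psi> (X n) \<tau> x - \<psi> s \<tau> x)) / norm (\<psi> (X n) \<tau> x - \<psi> s \<tau> x)) \<longlonglongrightarrow> 0" for \<tau>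
      using flow.difference_quotient_tendsto[OF flow_in[OF x] LIM_zero[OF flow_tendsto_parameter[OF x X, of \<tau>]], of s \<tau> s \<tau>]
      unfolding q_def flow.A_def by simp
  qed
  then obtain e' where e': "e' \<longlonglongrightarrow> 0"
    and E: "\<And>n t. norm (flow.K s x t (\<psi> (X n) t x - \<psi> s t x) - primitive 0 (\<lambda>\<tau>. flow.K s x \<tau> (b n \<tau>)) t) \<le> e' n * a n"
    by blast
  \<comment> \<open>Each of three errors gets \<open>e / 3\<close>: the remainder of the
    linearization, the motion of the trajectory, and the variation of \<open>J\<close> and
    \<open>K\<close>. The last must be small for all parameters \<open>r\<close> of the strip at
    once.\<close>
  have ev1: "\<forall>\<^sub>F n in sequentially. C * e' n < e / 3"
    by (rule order_tendstoD(2)[OF tendsto_mult_right_zero[OF e']]) (use e in simp)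
  have ev2: "\<forall>\<^sub>F n in sequentially. C * C * C * a n < e / 3"
    by (rule order_tendstoD(2)[OF tendsto_mult_right_zero[OF a]]) (use e in simp)
  have ev3: "\<forall>\<^sub>F n in sequentially. \<forall>r\<in>{s<..X n}. 2 * C * \<kappa> x s r < e / 3"
  proof -
    have "((\<lambda>r. 2 * C * \<kappa> x s r) \<longlongrightarrow> 0) (at s)"
    proof (rule tendsto_mult_right_zero)
      show "(\<kappa> x s \<longlongrightarrow> 0) (at s)"
        unfolding tendsto_at_iff_sequentially o_def using \<kappa>_tendsto[OF x] by blast
    qed
    then have "\<forall>\<^sub>F r in at s. 2 * C * \<kappa> x s r < e / 3" by (rule order_tendstoD(2)) (use e in simp)
    then obtain d where d: "0 < d" "\<And>r. r \<noteq> s \<Longrightarrow> dist r s < d \<Longrightarrow> 2 * C * \<kappa> x s r < e / 3"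
      unfolding eventually_at by auto
    have "\<forall>\<^sub>F n in sequentially. X n < s + d" by (rule order_tendstoD(2)[OF X]) (use d(1) in simp)
    then show ?thesis
    proof eventually_elim
      case (elim n)
      show ?case
      proof
        fix r assume "r \<in> {s<..X n}"
        then show "2 * C * \<kappa> x s r < e / 3" using elim by (intro d(2)) (auto simp: dist_real_def)
      qed
    qed
  qed
  show "\<forall>\<^sub>F n in sequentially. norm (\<psi> (X n) t x - \<psi> s t x
      - (primitive 0 (\<lambda>\<sigma>. G \<sigma> x t) (X n) - primitive 0 (\<lambda>\<sigma>. G \<sigma> x t) s)) \<le> e * (\<alpha> (X n) - \<alpha> s)"
    using ev1 ev2 ev3
  proof eventually_elim
    case (elim n)
    let ?u = "X n"
    let ?Q = "\<lambda>r. primitive 0 (\<lambda>\<tau>. flow.K s x \<tau> (V \<tau> r (\<psi> ?u \<tau> x))) t"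
    let ?R = "primitive 0 (\<lambda>\<tau>. flow.K s x \<tau> (b n \<tau>)) t"
    note F = Fubini_strip[OF x le[of n] flow_meas[OF x, of "X n"], of t]
    have iJQ: "set_integrable lborel {s<..?u} (\<lambda>r. flow.J s x t (?Q r))"
      using integrable_bounded_linear[OF blinfun.bounded_linear_right F(1)[unfolded set_integrable_def], of "flow.J s x t"]
      by (simp add: set_integrable_def blinfun.scaleR_right)
    have "flow.J s x t ?R = (LBINT r:{s<..?u}. flow.J s x t (?Q r))"
      unfolding b_def F(2) set_lebesgue_integral_def blinfun.scaleR_right[symmetric]
      by (rule integral_bounded_linear[OF blinfun.bounded_linear_right F(1)[unfolded set_integrable_def], symmetric])
    then have D: "flow.J s x t ?R - (primitive 0 (\<lambda>\<sigma>. G \<sigma> x t) ?u - primitive 0 (\<lambda>\<sigma>. G \<sigma> x t) s)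
       = (LBINT r:{s<..?u}. flow.J s x t (?Q r) - G r x t)"
      unfolding primitive_diff[OF G_int[OF x] le]
      by (subst set_integral_diff(2)[OF iJQ set_integrable_lborel_subset[OF G_int[OF x]]]) auto
    have "norm (flow.J s x t ?R - (primitive 0 (\<lambda>\<sigma>. G \<sigma> x t) ?u - primitive 0 (\<lambda>\<sigma>. G \<sigma> x t) s))
        \<le> (LBINT r:{s<..?u}. 2 * e / 3 * \<mu> r)"
      unfolding D
    proof (rule set_lebesgue_integral_norm_bound)
      show "set_integrable lborel {s<..?u} (\<lambda>r. 2 * e / 3 * \<mu> r)"
        using \<mu>_int by (intro set_integrable_lborel_subset) auto
      fix r assume r: "r \<in> {s<..?u}"
      then have "norm (flow.J s x t (?Q r) - G r x t) \<le> (2 * C * \<kappa> x s r + C * C * C * (\<alpha> ?u - \<alpha> s)) * \<mu> r"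
        by (intro P_frozen_dist x) auto
      also have "\<dots> \<le> 2 * e / 3 * \<mu> r"
      proof (rule mult_right_mono[OF _ \<mu>_nonneg])
        have "2 * C * \<kappa> x s r < e / 3" using elim(3) r by blast
        then show "2 * C * \<kappa> x s r + C * C * C * (\<alpha> ?u - \<alpha> s) \<le> 2 * e / 3"
          using elim(2) unfolding a_def by linarith
      qed
      finally show "norm (flow.J s x t (?Q r) - G r x t) \<le> 2 * e / 3 * \<mu> r" .
    qed
    also have "\<dots> = 2 * e / 3 * a n" unfolding a_def primitive_diff[OF \<mu>_int le] by (rule set_integral_mult_right)
    finally have 1: "norm (flow.J s x t ?R - (primitive 0 (\<lambda>\<sigma>. G \<sigma> x t) ?u - primitive 0 (\<lambda>\<sigma>. G \<sigma> x t) s)) \<le> 2 * e / 3 * a n" .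
    \<comment> \<open>\<open>J K = id\<close> turns the estimate for \<open>K\<close> applied to the
      increment into one for the increment itself, at the cost of a factor \<open>C\<close>.\<close>
    have D: "\<psi> ?u t x - \<psi> s t x - flow.J s x t ?R = flow.J s x t (flow.K s x t (\<psi> ?u t x - \<psi> s t x) - ?R)"
      using flow.JK[OF x, of s t] by (simp add: blinfun.diff_right flip: blinfun_apply_blinfun_compose)
    have "norm (\<psi> ?u t x - \<psi> s t x - flow.J s x t ?R) \<le> C * (e' n * a n)"
      unfolding D by (rule order_trans[OF norm_blinfun]) (intro mult_mono flow.J_bound[OF x] E; simp)
    also have "\<dots> \<le> e / 3 * a n"
      using mult_right_mono[OF less_imp_le[OF elim(1)] a0[of n]] by (simp only: mult.assoc)
    finally have 2: "norm (\<psi> ?u t x - \<psi> s t x - flow.J s x t ?R) \<le> e / 3 * a n" .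
    have tel: "p - j + (j - g) = p - g" for p g j :: 'a by simp
    have "norm (\<psi> ?u t x - \<psi> s t x - (primitive 0 (\<lambda>\<sigma>. G \<sigma> x t) ?u - primitive 0 (\<lambda>\<sigma>. G \<sigma> x t) s))
      \<le> e / 3 * a n + 2 * e / 3 * a n"
      using norm_triangle_mono[OF 2 1] unfolding tel .
    also have "\<dots> = e * (\<alpha> ?u - \<alpha> s)" by (simp add: a_def field_simps)
    finally show ?case .
  qed
qed simp

theorem flow_parameter_integral:
  assumes x: "x \<in> \<Omega>"
  shows "\<psi> b t x - \<psi> a t x = primitive 0 (\<lambda>\<sigma>. G \<sigma> x t) b - primitive 0 (\<lambda>\<sigma>. G \<sigma> x t) a"
proof -
  let ?F = "\<lambda>s. \<psi> s t x - primitive 0 (\<lambda>\<sigma>. G \<sigma> x t) s"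
  have eq: "y - p - (z - q) = y - z - (p - q)" for y p z q :: 'a by simp
  have "?F b = ?F a"
  proof (rule growth_zero[where F="?F" and A=\<alpha>])
    have "continuous_on UNIV (\<lambda>s. \<psi> s t x)"
      unfolding continuous_on_sequentially o_def using flow_tendsto_parameter[OF x] by blast
    then show "continuous_on UNIV ?F"
      by (intro continuous_on_diff continuous_primitive G_int x)
    show "\<forall>\<^sub>F u in at_right s. norm (?F u - ?F s) \<le> e * (\<alpha> u - \<alpha> s)" if "0 < e" for s e
      unfolding eq by (rule flow_parameter_step[OF x that])
  qed (rule \<alpha>_cont)
  then have "?F b - ?F a = 0" by simp
  then show ?thesis unfolding eq by simp
qed

end

section \<open>Borel representatives\<close>

lemma closed_superset_dense:
  fixes S :: "'a::topological_space set"
  assumes "\<And>X. open X \<Longrightarrow> X \<noteq> {} \<Longrightarrow> \<exists>d\<in>D. d \<in> X" "closed S" "D \<subseteq> S"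
  shows "S = UNIV"
proof (rule ccontr)
  assume "S \<noteq> UNIV"
  then have "open (- S)" "- S \<noteq> {}" using assms(2) by auto
  then show False using assms(1,3) by blast
qed

lemma lebesgue_ex_borel_measurable:
  fixes f :: "'b::euclidean_space \<Rightarrow> 'a::euclidean_space"
  assumes "f \<in> borel_measurable lebesgue"
  shows "\<exists>g\<in>borel_measurable borel. AE x in lborel. f x = g x"
proof -
  have "\<forall>b. \<exists>g. g \<in> borel_measurable lborel \<and> (AE x in lborel. f x \<bullet> b = g x)"
  proof
    fix b :: 'a
    have "(\<lambda>x. f x \<bullet> b) \<in> borel_measurable lebesgue"
      by (intro borel_measurable_inner assms borel_measurable_const)
    from completion_ex_borel_measurable_real[OF this]
    show "\<exists>g. g \<in> borel_measurable lborel \<and> (AE x in lborel. f x \<bullet> b = g x)" by blast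
  qed
  then obtain g where g: "\<And>b. g b \<in> borel_measurable lborel" "\<And>b. AE x in lborel. f x \<bullet> b = g b x"
    by metis
  have "AE x in lborel. \<forall>b\<in>Basis. f x \<bullet> b = g b x" using g(2) by (simp add: AE_finite_allI)
  then have "AE x in lborel. f x = (\<Sum>b\<in>Basis. g b x *\<^sub>R b)"
  proof eventually_elim
    case (elim x)
    have "f x = (\<Sum>b\<in>Basis. (f x \<bullet> b) *\<^sub>R b)" by (simp add: euclidean_representation)
    also have "\<dots> = (\<Sum>b\<in>Basis. g b x *\<^sub>R b)" using elim by (intro sum.cong) auto
    finally show ?case .
  qed
  moreover have "(\<lambda>x. \<Sum>b\<in>Basis. g b x *\<^sub>R b) \<in> borel_measurable borel"
    by (intro borel_measurable_sum borel_measurable_scaleR borel_measurable_const) (use g(1) in simp)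
  ultimately show ?thesis by (rule bexI)
qed

text \<open>
  Since the fields are continuous in \<open>x\<close>, their values and Lipschitz constants are determined by a countable
  dense set of points, so a single null set works for all \<open>x\<close>. The bound \<open>B\<close> need not be measurable.
\<close>

lemma borel_modification:
  fixes v :: "real \<Rightarrow> real \<Rightarrow> 'a::euclidean_space \<Rightarrow> 'a" and B :: "real \<Rightarrow> real \<Rightarrow> real"
  assumes meas: "\<And>x. (\<lambda>p. v (fst p) (snd p) x) \<in> borel_measurable lebesgue"
    and bound: "\<And>t s x. norm (v t s x) \<le> B t s"
    and lip: "\<And>t s x y. norm (v t s x - v t s y) \<le> B t s * norm (x - y)"
    and fin1: "\<And>t. (\<integral>\<^sup>+ s. ennreal (B t s) \<partial>lborel) < \<infinity>"
    and fin2: "(\<integral>\<^sup>+ t. \<integral>\<^sup>+ s. ennreal (B t s) \<partial>lborel \<partial>lborel) < \<infinity>"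
  obtains E :: "(real \<times> real) set" and m :: "real \<Rightarrow> real \<Rightarrow> real"
  where "E \<in> sets borel" "AE p in lborel. p \<in> E"
    and "\<And>x. (\<lambda>p. if p \<in> E then v (fst p) (snd p) x else 0) \<in> borel_measurable borel"
    and "(\<lambda>p. m (fst p) (snd p)) \<in> borel_measurable borel" "\<And>t s. 0 \<le> m t s"
    and "integrable (lborel \<Otimes>\<^sub>M lborel) (\<lambda>(t, s). m t s)"
    and "\<And>t. integrable lborel (m t)" "\<And>s. integrable lborel (\<lambda>t. m t s)"
    and "\<And>t s x. (t, s) \<in> E \<Longrightarrow> norm (v t s x) \<le> m t s"
    and "\<And>t s x y. (t, s) \<in> E \<Longrightarrow> norm (v t s x - v t s y) \<le> m t s * norm (x - y)"
proof -
  obtain D :: "'a set" where D: "countable D" "\<And>X. open X \<Longrightarrow> X \<noteq> {} \<Longrightarrow> \<exists>d\<in>D. d \<in> X"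
    using countable_dense_exists by metis
  have Dne: "D \<noteq> {}" using D(2)[of UNIV] by auto
  have "\<forall>x. \<exists>g. g \<in> borel_measurable borel \<and> (AE p in lborel. v (fst p) (snd p) x = g p)"
    using lebesgue_ex_borel_measurable[OF meas] by blast
  then obtain g where g: "\<And>x. g x \<in> borel_measurable borel"
    and vg: "\<And>x. AE p in lborel. v (fst p) (snd p) x = g x p" by metis
  have "AE p in lborel. \<forall>x\<in>D. v (fst p) (snd p) x = g x p"
    using vg D(1) by (simp add: AE_ball_countable)
  then obtain N where N: "N \<in> null_sets lborel" "{p. \<not> (\<forall>x\<in>D. v (fst p) (snd p) x = g x p)} \<subseteq> N"
    unfolding eventually_ae_filter by auto
  have Nb[measurable]: "N \<in> sets borel" using N(1) by (auto simp: null_sets_def)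
  \<comment> \<open>Off \<open>N\<close> the values at points of \<open>D\<close> agree with Borel
    functions. Continuity in \<open>x\<close> carries Borel measurability from \<open>D\<close> to
    all points.\<close>
  define V where "V p x = (if p \<in> N then 0 else v (fst p) (snd p) x)" for p x
  have B_nonneg: "0 \<le> B t s" for t s by (rule order_trans[OF norm_ge_zero bound[of t s 0]])
  have V_lip: "norm (V p x - V p y) \<le> B (fst p) (snd p) * norm (x - y)" for p x y
    by (simp add: V_def lip B_nonneg)
  have V_bound: "norm (V p x) \<le> B (fst p) (snd p)" for p x
    by (simp add: V_def bound B_nonneg)
  have V_cont: "continuous_on UNIV (V p)" for p by (rule continuous_on_lipschitz[OF V_lip])
  have V_D: "(\<lambda>p. V p x) \<in> borel_measurable borel" if "x \<in> D" for x
  proof -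
    have "(\<lambda>p. V p x) = (\<lambda>p. if p \<in> N then 0 else g x p)" using N(2) that by (intro ext) (auto simp: V_def)
    then show ?thesis using g by simp
  qed
  have V_meas: "(\<lambda>p. V p x) \<in> borel_measurable borel" for x
  proof -
    have "\<exists>d\<in>D. dist d x < inverse (real (Suc n))" for n
      using D(2)[OF open_ball, of x "inverse (real (Suc n))"] by (auto simp: dist_commute)
    then obtain d where d: "\<And>n. d n \<in> D" "\<And>n. dist (d n) x < inverse (real (Suc n))" by metis
    have "(\<lambda>n. dist (d n) x) \<longlonglongrightarrow> 0"
      by (rule tendsto_sandwich[OF _ _ tendsto_const LIMSEQ_inverse_real_of_nat])
        (intro always_eventually allI zero_le_dist less_imp_le[OF d(2)])+
    then have dx: "d \<longlonglongrightarrow> x" by (rule tendsto_dist_iff[THEN iffD2])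
    show ?thesis
    proof (rule borel_measurable_LIMSEQ_metric)
      show "(\<lambda>p. V p (d n)) \<in> borel_measurable borel" for n by (rule V_D[OF d(1)])
      show "(\<lambda>n. V p (d n)) \<longlonglongrightarrow> V p x" for p
        by (rule continuous_on_tendsto_compose[OF V_cont dx]) auto
    qed
  qed
  \<comment> \<open>The smallest common bound for size and Lipschitz constant, as a supremum over
    countable sets and hence Borel measurable. Pairs with equal entries contribute 0 by division by
    0.\<close>
  define L where "L p = max (SUP x\<in>D. ennreal (norm (V p x)))
     (SUP q\<in>D \<times> D. ennreal (norm (V p (fst q) - V p (snd q)) / norm (fst q - snd q)))" for p
  have L_meas: "L \<in> borel_measurable borel"
  proof -
    have "(\<lambda>p. ennreal (norm (V p x))) \<in> borel_measurable borel" for x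
      using V_meas[of x] by measurable
    moreover have "(\<lambda>p. ennreal (norm (V p x - V p y) / c)) \<in> borel_measurable borel" for x y c
      using V_meas[of x] V_meas[of y] by measurable
    ultimately show ?thesis
      unfolding L_def by (intro borel_measurable_max borel_measurable_SUP countable_SIGMA D(1))
  qed
  have L_le: "L p \<le> ennreal (B (fst p) (snd p))" for p
    unfolding L_def
  proof (intro max.boundedI SUP_least ennreal_leI)
    show "norm (V p x) \<le> B (fst p) (snd p)" for x by (rule V_bound)
    show "norm (V p (fst q) - V p (snd q)) / norm (fst q - snd q) \<le> B (fst p) (snd p)" for q
      using V_lip[of p "fst q" "snd q"] B_nonneg by (cases "fst q = snd q") (auto simp: field_simps)
  qed
  define m1 where "m1 p = enn2real (L p)" for p
  have L_m1: "L p = ennreal (m1 p)" for p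
    unfolding m1_def by (rule ennreal_enn2real[symmetric]) (rule order.strict_trans1[OF L_le ennreal_less_top])
  have m1_meas[measurable]: "m1 \<in> borel_measurable borel" unfolding m1_def using L_meas by simp
  have m1_nonneg: "0 \<le> m1 p" for p by (simp add: m1_def)
  have m1_le: "m1 p \<le> B (fst p) (snd p)" for p
    using L_le[of p] B_nonneg unfolding L_m1 by simp
  have m1_bound: "norm (V p x) \<le> m1 p" for p x
  proof -
    have "closed {x. norm (V p x) \<le> m1 p}"
      by (intro closed_Collect_le continuous_intros V_cont)
    moreover have "norm (V p x) \<le> m1 p" if "x \<in> D" for x
    proof -
      have "ennreal (norm (V p x)) \<le> L p" unfolding L_def by (intro max.coboundedI1 SUP_upper that)
      then show ?thesis unfolding L_m1 using m1_nonneg by simp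
    qed
    ultimately have "{x. norm (V p x) \<le> m1 p} = UNIV" by (intro closed_superset_dense[OF D(2)]) auto
    then show ?thesis by blast
  qed
  have m1_lip: "norm (V p x - V p y) \<le> m1 p * norm (x - y)" for p x y
  proof -
    have DD: "norm (V p x - V p y) \<le> m1 p * norm (x - y)" if "x \<in> D" "y \<in> D" for x y
    proof (cases "x = y")
      case False
      have "ennreal (norm (V p x - V p y) / norm (x - y)) \<le> L p"
        unfolding L_def using that by (intro max.coboundedI2 SUP_upper2[of "(x, y)"]) auto
      then show ?thesis unfolding L_m1 using m1_nonneg False by (simp add: field_simps)
    qed simp
    have "{x. norm (V p x - V p y) \<le> m1 p * norm (x - y)} = UNIV" if "y \<in> D" for y
      by (rule closed_superset_dense[OF D(2)])
        (use DD that in \<open>auto intro!: closed_Collect_le continuous_intros V_cont\<close>)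
    then have Dy: "norm (V p x - V p y) \<le> m1 p * norm (x - y)" if "y \<in> D" for x y
      using that by blast
    have "{y. norm (V p x - V p y) \<le> m1 p * norm (x - y)} = UNIV" for x
      by (rule closed_superset_dense[OF D(2)])
        (use Dy in \<open>auto intro!: closed_Collect_le continuous_intros V_cont\<close>)
    then show ?thesis by blast
  qed
  have m1_prod[measurable]: "(\<lambda>p. ennreal (m1 p)) \<in> borel_measurable (lborel \<Otimes>\<^sub>M lborel)"
    using m1_meas by (simp add: lborel_prod)
  have fin2': "(\<integral>\<^sup>+ t. \<integral>\<^sup>+ s. ennreal (m1 (t, s)) \<partial>lborel \<partial>lborel) < \<infinity>"
    by (rule order.strict_trans1[OF _ fin2]) (intro nn_integral_mono ennreal_leI, use m1_le in force)
  have fin1': "(\<integral>\<^sup>+ s. ennreal (m1 (t, s)) \<partial>lborel) < \<infinity>" for t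
    by (rule order.strict_trans1[OF _ fin1[of t]]) (intro nn_integral_mono ennreal_leI, use m1_le in force)
  \<comment> \<open>Tonelli makes the integral over \<open>t\<close> finite only for almost every
    \<open>s\<close>. The exceptional parameters are removed, so that these sections of
    \<open>m\<close> become integrable for every \<open>s\<close>.\<close>
  define S where "S = {s. (\<integral>\<^sup>+ t. ennreal (m1 (t, s)) \<partial>lborel) = \<infinity>}"
  have swap: "(\<integral>\<^sup>+ s. \<integral>\<^sup>+ t. ennreal (m1 (t, s)) \<partial>lborel \<partial>lborel) < \<infinity>"
    using lborel_pair.Fubini[OF m1_prod] fin2' by simp
  have S_meas[measurable]: "(\<lambda>s. \<integral>\<^sup>+ t. ennreal (m1 (t, s)) \<partial>lborel) \<in> borel_measurable lborel"
    by (rule lborel.borel_measurable_nn_integral) (use m1_prod in measurable)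
  have Sb[measurable]: "S \<in> sets borel"
    using S_meas unfolding S_def by measurable
  have "AE s in lborel. (\<integral>\<^sup>+ t. ennreal (m1 (t, s)) \<partial>lborel) \<noteq> \<infinity>"
    by (rule nn_integral_noteq_infinite) (use swap in \<open>auto simp: less_top[symmetric]\<close>)
  then have S_null: "S \<in> null_sets lborel"
    using Sb by (subst AE_iff_null_sets) (auto simp: S_def)
  define E where "E = - N \<inter> {p. snd p \<notin> S}"
  define m where "m t s = (if s \<in> S then 0 else m1 (t, s))" for t s
  have E_snd: "{p :: real \<times> real. snd p \<notin> S} \<in> sets borel"
  proof -
    have "{p :: real \<times> real. snd p \<notin> S} = snd -` (- S) \<inter> space borel" by auto
    also have "\<dots> \<in> sets (borel :: (real \<times> real) measure)"
      by (rule measurable_sets[where A=borel]) (auto simp: borel_prod[symmetric])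
    finally show ?thesis .
  qed
  show thesis
  proof (rule that[of E m])
    show "E \<in> sets borel" unfolding E_def using E_snd by auto
    have "emeasure (lborel \<Otimes>\<^sub>M lborel) ((UNIV :: real set) \<times> S) = emeasure lborel (UNIV :: real set) * emeasure lborel S"
      by (rule lborel.emeasure_pair_measure_Times) auto
    also have "\<dots> = 0" using S_null by (simp add: null_sets_def)
    finally have "UNIV \<times> S \<in> null_sets (lborel :: (real \<times> real) measure)"
      by (auto simp: null_sets_def lborel_prod borel_prod[symmetric])
    from AE_not_in[OF this] AE_not_in[OF N(1)]
    show "AE p in lborel. p \<in> E" by eventually_elim (auto simp: E_def)
    show "(\<lambda>p. if p \<in> E then v (fst p) (snd p) x else 0) \<in> borel_measurable borel" for x
    proof -
      have "(\<lambda>p. if p \<in> E then v (fst p) (snd p) x else 0) = (\<lambda>p. if p \<in> {p. snd p \<notin> S} then V p x else 0)"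
        by (auto simp: E_def V_def)
      then show ?thesis
        by (simp only:) (rule measurable_If_set[OF V_meas], use E_snd in auto)
    qed
    show m_meas: "(\<lambda>p. m (fst p) (snd p)) \<in> borel_measurable borel"
    proof -
      have "(\<lambda>p. m (fst p) (snd p)) = (\<lambda>p. if p \<in> {p. snd p \<notin> S} then m1 p else 0)" by (auto simp: m_def)
      then show ?thesis
        by (simp only:) (rule measurable_If_set[OF m1_meas], use E_snd in auto)
    qed
    show m_nonneg: "0 \<le> m t s" for t s by (simp add: m_def m1_nonneg)
    have m_le: "ennreal (m t s) \<le> ennreal (m1 (t, s))" for t s by (simp add: m_def)
    have mp: "(\<lambda>(t, s). m t s) \<in> borel_measurable (lborel \<Otimes>\<^sub>M lborel)"
      using m_meas by (simp add: lborel_prod split_def)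
    show "integrable (lborel \<Otimes>\<^sub>M lborel) (\<lambda>(t, s). m t s)"
    proof (rule integrableI_bounded[OF mp])
      have "(\<integral>\<^sup>+ p. ennreal (norm (case p of (t, s) \<Rightarrow> m t s)) \<partial>(lborel \<Otimes>\<^sub>M lborel))
          \<le> (\<integral>\<^sup>+ p. ennreal (m1 p) \<partial>(lborel \<Otimes>\<^sub>M lborel))"
        using m_le m_nonneg by (intro nn_integral_mono) auto
      also have "\<dots> = (\<integral>\<^sup>+ t. \<integral>\<^sup>+ s. ennreal (m1 (t, s)) \<partial>lborel \<partial>lborel)"
        by (rule lborel.nn_integral_fst[OF m1_prod, symmetric])
      finally show "(\<integral>\<^sup>+ p. ennreal (norm (case p of (t, s) \<Rightarrow> m t s)) \<partial>(lborel \<Otimes>\<^sub>M lborel)) < \<infinity>"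
        using fin2' by (rule order.strict_trans1)
    qed
    show "integrable lborel (m t)" for t
    proof (rule integrableI_bounded)
      show "m t \<in> borel_measurable lborel"
        using measurable_compose[OF measurable_Pair1'[of t lborel lborel] mp] by simp
      have "(\<integral>\<^sup>+ s. ennreal (norm (m t s)) \<partial>lborel) \<le> (\<integral>\<^sup>+ s. ennreal (m1 (t, s)) \<partial>lborel)"
        using m_le m_nonneg by (intro nn_integral_mono) auto
      then show "(\<integral>\<^sup>+ s. ennreal (norm (m t s)) \<partial>lborel) < \<infinity>"
        using fin1' by (rule order.strict_trans1)
    qed
    show "integrable lborel (\<lambda>t. m t s)" for s
    proof (cases "s \<in> S")
      case False
      show ?thesis
      proof (rule integrableI_bounded)
        show "(\<lambda>t. m t s) \<in> borel_measurable lborel"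
          using measurable_compose[OF measurable_Pair2'[of s lborel lborel] mp] by simp
        have "(\<integral>\<^sup>+ t. ennreal (norm (m t s)) \<partial>lborel) \<le> (\<integral>\<^sup>+ t. ennreal (m1 (t, s)) \<partial>lborel)"
          using m_le m_nonneg by (intro nn_integral_mono) auto
        also have "\<dots> < \<infinity>" using False by (auto simp: S_def less_top[symmetric])
        finally show "(\<integral>\<^sup>+ t. ennreal (norm (m t s)) \<partial>lborel) < \<infinity>" .
      qed
    qed (simp add: m_def)
    show "norm (v t s x) \<le> m t s" if "(t, s) \<in> E" for t s x
      using m1_bound[of "(t, s)" x] that by (auto simp: E_def V_def m_def)
    show "norm (v t s x - v t s y) \<le> m t s * norm (x - y)" if "(t, s) \<in> E" for t s x y
      using m1_lip[of "(t, s)" x y] that by (auto simp: E_def V_def m_def)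
  qed
qed

text \<open>The mean value inequality works only on segments inside \<open>\<Omega>\<close>, which
  need not be convex. If a segment contains a point \<open>z\<close> outside, walking from each
  endpoint towards \<open>z\<close> meets the boundary, where \<open>f\<close> tends to 0; so
  \<open>norm (f x)\<close> and \<open>norm (f y)\<close> are at most \<open>B\<close> times the
  distances to \<open>z\<close>, and these add up to the length.\<close>

lemma vanishing_boundary_lipschitz:
  fixes f :: "'a::euclidean_space \<Rightarrow> 'a"
  assumes op: "open \<Omega>" and off: "\<And>x. x \<notin> \<Omega> \<Longrightarrow> f x = 0"
    and bd: "\<And>p. p \<in> frontier \<Omega> \<Longrightarrow> (f \<longlongrightarrow> 0) (at p within \<Omega>)"
    and der: "\<And>x. x \<in> \<Omega> \<Longrightarrow> (f has_derivative f' x) (at x)"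
    and bound: "\<And>x. x \<in> \<Omega> \<Longrightarrow> onorm (f' x) \<le> B" and B0: "0 \<le> B"
  shows "norm (f x - f y) \<le> B * norm (x - y)"
proof -
  have seg: "norm (f a - f b) \<le> B * norm (a - b)" if "closed_segment a b \<subseteq> \<Omega>" for a b
  proof (rule differentiable_bound[of "closed_segment a b" f f'])
    show "(f has_derivative f' z) (at z within closed_segment a b)" if "z \<in> closed_segment a b" for z
      using der \<open>closed_segment a b \<subseteq> \<Omega>\<close> that has_derivative_at_withinI by blast
  qed (use that bound in auto)
  have exit: "norm (f a) \<le> B * norm (a - b)" if a: "a \<in> \<Omega>" and b: "b \<notin> \<Omega>" for a b
  proof -
    let ?S = "closed_segment a b - \<Omega>"
    have "closed ?S" using op by (intro closed_Diff closed_segment) auto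
    moreover have "?S \<noteq> {}" using b by auto
    \<comment> \<open>The first exit from \<open>\<Omega>\<close> on the way from \<open>a\<close>
      to \<open>b\<close>: everything before \<open>p\<close> is inside, so the mean value
      inequality holds up to it.\<close>
    ultimately obtain p where p: "p \<in> ?S" "\<And>z. z \<in> ?S \<Longrightarrow> dist a p \<le> dist a z"
      using distance_attains_inf by metis
    define \<gamma> where "\<gamma> s = a + s *\<^sub>R (p - a)" for s
    have ev: "\<forall>\<^sub>F s in at_left (1::real). s \<in> {0<..<1}" by (rule eventually_at_left_real) simp
    have pa: "p \<noteq> a" using p(1) a by auto
    have in_seg: "\<gamma> s \<in> \<Omega>" if "0 \<le> s" "s < 1" for s
    proof (rule ccontr)
      assume "\<gamma> s \<notin> \<Omega>"
      moreover have "\<gamma> s \<in> closed_segment a p"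
        unfolding closed_segment_def \<gamma>_def using that by (auto simp: algebra_simps intro!: exI[of _ s])
      then have "\<gamma> s \<in> closed_segment a b"
        using p(1) subset_closed_segment[of a p a b] by auto
      ultimately have "dist a p \<le> dist a (\<gamma> s)" using p(2) by blast
      also have "\<dots> = s * dist a p" using that by (simp add: \<gamma>_def dist_norm norm_minus_commute)
      finally show False using that pa by simp
    qed
    have le: "norm (f a - f (\<gamma> s)) \<le> B * norm (a - b)" if "0 \<le> s" "s < 1" for s
    proof -
      have "closed_segment a (\<gamma> s) \<subseteq> \<Omega>"
      proof
        fix z assume "z \<in> closed_segment a (\<gamma> s)"
        then obtain u where u: "0 \<le> u" "u \<le> 1" "z = (1 - u) *\<^sub>R a + u *\<^sub>R \<gamma> s"
          by (auto simp: closed_segment_def)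
        then have "z = \<gamma> (u * s)" by (simp add: \<gamma>_def algebra_simps)
        moreover have "u * s < 1" using u that by (metis mult_left_le_one_le order.strict_trans1)
        ultimately show "z \<in> \<Omega>" using in_seg u that by simp
      qed
      then have "norm (f a - f (\<gamma> s)) \<le> B * norm (a - \<gamma> s)" by (rule seg)
      also have "norm (a - \<gamma> s) = s * norm (a - p)" using that by (simp add: \<gamma>_def norm_minus_commute)
      also have "\<dots> \<le> 1 * norm (a - p)" using that by (intro mult_right_mono) auto
      also have "norm (a - p) \<le> norm (a - b)"
        using p(2)[of b] b by (simp add: dist_norm)
      finally show ?thesis using B0 by (simp add: mult_left_mono)
    qed
    have fr: "p \<in> frontier \<Omega>"
    proof -
      have "((\<lambda>s. \<gamma> s) \<longlongrightarrow> \<gamma> 1) (at_left 1)" unfolding \<gamma>_def by (intro tendsto_intros)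
      moreover have "\<forall>\<^sub>F s in at_left 1. \<gamma> s \<in> closure \<Omega>"
        using ev by eventually_elim (use in_seg closure_subset in force)
      ultimately have "\<gamma> 1 \<in> closure \<Omega>"
        using Lim_in_closed_set[OF closed_closure] trivial_limit_at_left_real by blast
      then show ?thesis using p(1) op by (simp add: \<gamma>_def frontier_def interior_open)
    qed
    have "((\<lambda>s. f (\<gamma> s)) \<longlongrightarrow> 0) (at_left 1)"
    proof (rule tendsto_compose_filtermap[unfolded o_def, THEN iffD2, OF tendsto_mono[OF _ bd[OF fr]]])
      show "filtermap \<gamma> (at_left 1) \<le> at p within \<Omega>"
        unfolding filterlim_def[symmetric] filterlim_at
      proof
        have "((\<lambda>s. \<gamma> s) \<longlongrightarrow> \<gamma> 1) (at_left 1)" unfolding \<gamma>_def by (intro tendsto_intros)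
        moreover have "\<gamma> 1 = p" by (simp add: \<gamma>_def)
        ultimately show "(\<gamma> \<longlongrightarrow> p) (at_left 1)" by simp
        show "\<forall>\<^sub>F s in at_left 1. \<gamma> s \<in> \<Omega> \<and> \<gamma> s \<noteq> p"
          using ev by eventually_elim (use in_seg p(1) in force)
      qed
    qed
    then have "((\<lambda>s. norm (f a - f (\<gamma> s))) \<longlongrightarrow> norm (f a - 0)) (at_left 1)"
      by (intro tendsto_intros)
    then have "norm (f a - 0) \<le> B * norm (a - b)"
    proof (rule tendsto_upperbound)
      show "\<forall>\<^sub>F s in at_left 1. norm (f a - f (\<gamma> s)) \<le> B * norm (a - b)"
        using ev by eventually_elim (use le in auto)
    qed simp
    then show ?thesis by simp
  qed
  show ?thesis
  proof (cases "closed_segment x y \<subseteq> \<Omega>")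
    case True then show ?thesis by (rule seg)
  next
    case False
    then obtain z where z: "z \<in> closed_segment x y" "z \<notin> \<Omega>" by blast
    have e: "norm (f a) \<le> B * norm (a - z)" for a
      using exit[OF _ z(2), of a] off[of a] B0 by (cases "a \<in> \<Omega>") auto
    have "norm (f x - f y) \<le> norm (f x) + norm (f y)" by (rule norm_triangle_ineq4)
    also have "\<dots> \<le> B * norm (x - z) + B * norm (y - z)" by (intro add_mono e)
    also have "\<dots> = B * norm (x - y)"
      using z(1) unfolding between_mem_segment[symmetric] between
      by (simp add: dist_norm norm_minus_commute[of y z] flip: distrib_left)
    finally show ?thesis .
  qed
qed

section \<open>Fields of a bundle\<close>

lemma C1_field_bounds:
  assumes op: "open \<Omega>" and f: "f \<in> C1_fields \<Omega>" and le: "norm_1_inf \<Omega> f \<le> ennreal B" and B: "0 \<le> B"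
  shows "norm (f x) \<le> B" and "norm (f x - f y) \<le> B * norm (x - y)"
proof -
  obtain f' where f': "\<And>x. x \<in> \<Omega> \<Longrightarrow> (f has_derivative blinfun_apply (f' x)) (at x)"
    using f by (auto simp: C1_fields_def C1_on_def)
  have off: "\<And>x. x \<notin> \<Omega> \<Longrightarrow> f x = 0" and bd: "\<And>p. p \<in> frontier \<Omega> \<Longrightarrow> (f \<longlongrightarrow> 0) (at p within \<Omega>)"
    using f by (auto simp: C1_fields_def)
  have "ennreal (norm (f x)) \<le> norm_1_inf \<Omega> f" if "x \<in> \<Omega>" for x
    unfolding norm_1_inf_def by (rule order_trans[OF SUP_upper[OF that] add_increasing2]) auto
  then have "norm (f x) \<le> B" if "x \<in> \<Omega>" for x
    using order_trans[OF _ le] that B by (metis ennreal_le_iff)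
  then show "norm (f x) \<le> B" using off B by (cases "x \<in> \<Omega>") auto
  have "ennreal (onorm (frechet_derivative f (at x))) \<le> norm_1_inf \<Omega> f" if "x \<in> \<Omega>" for x
    unfolding norm_1_inf_def by (rule order_trans[OF SUP_upper[OF that] add_increasing]) auto
  then have "onorm (frechet_derivative f (at x)) \<le> B" if "x \<in> \<Omega>" for x
    using order_trans[OF _ le] that B by (metis ennreal_le_iff)
  then have "onorm (blinfun_apply (f' x)) \<le> B" if "x \<in> \<Omega>" for x
    using that frechet_derivative_at[OF f'[OF that]] by simp
  then show "norm (f x - f y) \<le> B * norm (x - y)"
    by (intro vanishing_boundary_lipschitz[OF op off bd f' _ B])
qed

text \<open>The bridge from the Lebesgue integrals of the statement to \<open>primitive\<close>:
  \<open>g\<close> is a Borel representative cut off to \<open>{0<..1}\<close>, and the endpoint 0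
  is null. Completeness of Lebesgue measure makes \<open>f\<close> measurable.\<close>

lemma lebesgue_set_integral_eq_lborel:
  fixes f g :: "real \<Rightarrow> 'a::euclidean_space"
  assumes g: "integrable lborel g" and zero: "\<And>\<tau>. \<tau> \<notin> {0<..1} \<Longrightarrow> g \<tau> = 0"
    and ae: "AE \<tau> in lborel. \<tau> \<in> {0<..1} \<longrightarrow> f \<tau> = g \<tau>"
  shows "t \<in> {0..1} \<Longrightarrow> (LINT \<tau>:{0..t}|lebesgue. f \<tau>) = (LBINT \<tau>:{..t}. g \<tau>)"
    and "f absolutely_integrable_on {0..1}"
proof -
  have eq: "AE \<tau> in lebesgue. indicator {..t} \<tau> *\<^sub>R g \<tau> = indicator {0..t} \<tau> *\<^sub>R f \<tau>"
    if "t \<in> {0..1}" for t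
    using ae AE_lborel_singleton[of 0] unfolding AE_completion_iff
    by eventually_elim (use that zero in \<open>auto simp: indicator_def\<close>)
  have gi: "integrable lborel (\<lambda>\<tau>. indicator {..t} \<tau> *\<^sub>R g \<tau>)" for t
    using set_integrable_lborel_subset[OF g, of "{..t}"] by (simp add: set_integrable_def)
  have gm: "(\<lambda>\<tau>. indicator {..t} \<tau> *\<^sub>R g \<tau>) \<in> borel_measurable lborel" for t using gi by auto
  have gl: "integrable lebesgue (\<lambda>\<tau>. indicator {..t} \<tau> *\<^sub>R g \<tau>)" for t
    using gi integrable_completion[OF gm] by blast
  have fm: "(\<lambda>\<tau>. indicator {0..t} \<tau> *\<^sub>R f \<tau>) \<in> borel_measurable lebesgue" if "t \<in> {0..1}" for t
    by (rule borel_measurable_AE[OF _ eq[OF that]]) (use gl in auto)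
  show "(LINT \<tau>:{0..t}|lebesgue. f \<tau>) = (LBINT \<tau>:{..t}. g \<tau>)" if t: "t \<in> {0..1}"
  proof -
    have "(LINT \<tau>:{0..t}|lebesgue. f \<tau>) = (LINT \<tau>|lebesgue. indicator {..t} \<tau> *\<^sub>R g \<tau>)"
      unfolding set_lebesgue_integral_def
      by (rule integral_cong_AE[symmetric, OF _ fm[OF t] eq[OF t]]) (use gl in auto)
    also have "\<dots> = (LBINT \<tau>:{..t}. g \<tau>)"
      unfolding set_lebesgue_integral_def by (rule integral_completion[OF gm])
    finally show ?thesis .
  qed
  show "f absolutely_integrable_on {0..1}"
    unfolding set_integrable_def by (rule integrable_cong_AE_imp[OF gl fm eq]) auto
qed

text \<open>Extends a flow given on the unit interval to the whole line by its values at the ends;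
  primitives of functions that vanish off \<open>{0<..1}\<close> extend in the same way.\<close>

definition unit_clamp :: "real \<Rightarrow> real" where "unit_clamp t = max 0 (min 1 t)"

lemma unit_clamp: "unit_clamp t \<in> {0..1}" "t \<in> {0..1} \<Longrightarrow> unit_clamp t = t"
  "continuous_on S unit_clamp"
  by (auto simp: unit_clamp_def[abs_def] intro!: continuous_intros)

lemma primitive_unit_clamp:
  assumes "\<And>\<tau>. \<tau> \<notin> {0<..1} \<Longrightarrow> g \<tau> = 0"
  shows "primitive c g (unit_clamp t) = primitive c g t"
proof -
  have "indicator {..unit_clamp t} \<tau> *\<^sub>R g \<tau> = indicator {..t} \<tau> *\<^sub>R g \<tau>" for \<tau>
    using assms[of \<tau>] by (cases "\<tau> \<in> {0<..1}") (auto simp: unit_clamp_def indicator_def)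
  then show ?thesis by (simp only: primitive_def set_lebesgue_integral_def)
qed

lemma Ad_at_flow:
  assumes bij: "bij_betw \<phi> \<Omega> \<Omega>" and x: "x \<in> \<Omega>" and der: "(\<phi> has_derivative D) (at x)"
  shows "Ad \<Omega> \<phi> u (\<phi> x) = D (u x)"
  using inv_into_f_f[OF bij_betw_imp_inj_on[OF bij] x] frechet_derivative_at[OF der]
  by (simp add: Ad_def Let_def)

text \<open>On \<open>\<Omega>\<close> the inverse of the inverse is \<open>\<phi>\<close> again, so
  the field is evaluated at \<open>\<phi> x\<close>, on the trajectory of \<open>x\<close>.\<close>

lemma Ad_inverse_flow:
  assumes bij: "bij_betw \<phi> \<Omega> \<Omega>" and x: "x \<in> \<Omega>"
    and der: "(inv_into \<Omega> \<phi> has_derivative D) (at (\<phi> x))"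
  shows "Ad \<Omega> (inv_into \<Omega> \<phi>) u x = D (u (\<phi> x))"
  using inv_into_inv_into_eq[OF bij x] frechet_derivative_at[OF der]
  by (simp add: Ad_def Let_def)

context flow_family
begin

lemma C1_diffeo: "bij_betw (\<psi> s t) \<Omega> \<Omega>"
  "continuous_on \<Omega> (\<lambda>x. flow.J s x t)"
  "continuous_on \<Omega> (\<lambda>y. flow.K s (inv_into \<Omega> (\<psi> s t) y) t)"
  "y \<in> \<Omega> \<Longrightarrow> (inv_into \<Omega> (\<psi> s t) has_derivative blinfun_apply (flow.K s (inv_into \<Omega> (\<psi> s t) y) t)) (at y)"
proof -
  show bij: "bij_betw (\<psi> s t) \<Omega> \<Omega>" by (rule flow.flow_bij)
  show der: "(inv_into \<Omega> (\<psi> s t) has_derivative blinfun_apply (flow.K s (inv_into \<Omega> (\<psi> s t) y) t)) (at y)"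
    if "y \<in> \<Omega>" for y
    using flow.inverse_flow_derivative[of "inv_into \<Omega> (\<psi> s t) y" s t] that bij
    by (metis bij_betw_inv_into_right bij_betw_def inv_into_into)
  show "continuous_on \<Omega> (\<lambda>y. flow.K s (inv_into \<Omega> (\<psi> s t) y) t)"
  proof (rule continuous_on_compose2[OF flow.K_continuous])
    show "continuous_on \<Omega> (inv_into \<Omega> (\<psi> s t))"
      by (rule has_derivative_continuous_on) (use der has_derivative_at_withinI in blast)
    show "inv_into \<Omega> (\<psi> s t) ` \<Omega> \<subseteq> \<Omega>"
      using bij by (metis bij_betw_def image_subsetI inv_into_into)
  qed
qed (rule flow.J_continuous)

end

lemma clamped_primitive_continuous:
  fixes f :: "real \<Rightarrow> 'a::euclidean_space"
  assumes f: "f absolutely_integrable_on {0..1}"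
    and y: "\<And>t. t \<in> {0..1} \<Longrightarrow> y t = x + (LINT \<tau>:{0..t}|lebesgue. f \<tau>)"
  shows "continuous_on UNIV (\<lambda>t. y (unit_clamp t))"
proof (rule continuous_on_compose2[of "{0..1}" y])
  have "y t = x + integral {0..t} f" if "t \<in> {0..1}" for t
    using y[OF that] set_lebesgue_integral_eq_integral(2)[OF set_integrable_subset[OF f, of "{0..t}"]] that by auto
  moreover have "continuous_on {0..1} (\<lambda>t. x + integral {0..t} f)"
    using f by (intro continuous_intros indefinite_integral_continuous_1 set_lebesgue_integral_eq_integral(1))
  ultimately show "continuous_on {0..1} y" using continuous_on_cong by (metis (no_types, lifting))
qed (use unit_clamp in auto)

section \<open>An integrable bound for the fields in \<open>L2_V\<close>\<close>

lemma nn_integral_unit_interval: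
  fixes h :: "real \<Rightarrow> real"
  assumes "integrable (lebesgue_on {0..1}) h" "\<And>s. 0 \<le> h s"
  shows "(\<integral>\<^sup>+ s. ennreal (h s) * indicator {0..1} s \<partial>lborel) = ennreal (LINT s|lebesgue_on {0..1}. h s)"
proof -
  have "(\<integral>\<^sup>+ s. ennreal (h s) * indicator {0..1} s \<partial>lborel) = (\<integral>\<^sup>+ s. ennreal (h s) * indicator {0..1} s \<partial>lebesgue)"
    by (rule nn_integral_completion[symmetric])
  also have "\<dots> = (\<integral>\<^sup>+ s. ennreal (h s) \<partial>lebesgue_on {0..1})"
    by (rule nn_integral_restrict_space[symmetric]) simp
  also have "\<dots> = ennreal (LINT s|lebesgue_on {0..1}. h s)"
    by (rule nn_integral_eq_integral[OF assms(1)]) (use assms(2) in simp)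
  finally show ?thesis .
qed

text \<open>\<open>B t s\<close> is the embedding constant \<open>M s\<close> times the norm of
  \<open>v t s\<close> in \<open>H s\<close>. Nonnegative integrals allow the finiteness to be
  stated although joint measurability of these norms in \<open>t\<close> and \<open>s\<close> is not
  among the data.\<close>

lemma L2_V_bound:
  assumes adm: "admissible_bundle \<Omega> H ip" and v: "v \<in> L2_V \<Omega> H ip"
  obtains B where
    "\<And>t s. t \<in> {0..1} \<Longrightarrow> s \<in> {0..1} \<Longrightarrow> v t s \<in> C1_fields \<Omega>"
    "\<And>t s. t \<in> {0..1} \<Longrightarrow> s \<in> {0..1} \<Longrightarrow> norm_1_inf \<Omega> (v t s) \<le> ennreal (B t s)"
    "\<And>t s. t \<in> {0..1} \<Longrightarrow> s \<in> {0..1} \<Longrightarrow> 0 \<le> B t s"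
    "\<And>t. t \<in> {0..1} \<Longrightarrow> (\<integral>\<^sup>+ s. ennreal (B t s) * indicator {0..1} s \<partial>lborel) < \<infinity>"
    "(\<integral>\<^sup>+ t. (\<integral>\<^sup>+ s. ennreal (B t s) * indicator {0..1} s \<partial>lborel) * indicator {0..1} t \<partial>lborel) < \<infinity>"
proof -
  obtain M where M: "\<And>s. s \<in> {0..1} \<Longrightarrow> 0 < M s" "\<And>s. s \<in> {0..1} \<Longrightarrow> admissible_rkhs \<Omega> (H s) (ip s) (M s)"
    and M2: "set_integrable lborel {0..1} (\<lambda>s. (M s)\<^sup>2)"
    using adm unfolding admissible_bundle_def by blast
  have vV: "v t \<in> V_space \<Omega> H ip" if "t \<in> {0..1}" for t using v that by (auto simp: L2_V_def)
  have vH: "v t s \<in> H s" if "t \<in> {0..1}" "s \<in> {0..1}" for t s using vV[OF that(1)] that(2) by (auto simp: V_space_def)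
  define n where "n t s = ip_norm (ip s) (v t s)" for t s
  define c where "c = (LINT s|lebesgue_on {0..1}. (M s)\<^sup>2)"
  have n0: "0 \<le> n t s" if "t \<in> {0..1}" "s \<in> {0..1}" for t s
    using M(2)[OF that(2)] vH[OF that]
    by (auto simp: n_def ip_norm_def admissible_rkhs_def hilbert_space_of_fields_def)
  have iM: "integrable (lebesgue_on {0..1}) (\<lambda>s. (M s)\<^sup>2)"
  proof -
    have "integrable lborel (\<lambda>s. indicator {0..1} s *\<^sub>R (M s)\<^sup>2)" using M2 by (simp add: set_integrable_def)
    then have "integrable lebesgue (\<lambda>s. indicator {0..1} s *\<^sub>R (M s)\<^sup>2)"
      using integrable_completion[of "\<lambda>s. indicator {0..1} s *\<^sub>R (M s)\<^sup>2" lborel] borel_measurable_integrable by blast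
    then show ?thesis by (subst integrable_restrict_space) auto
  qed
  have i_n: "integrable (lebesgue_on {0..1}) (\<lambda>s. (n t s)\<^sup>2)" if "t \<in> {0..1}" for t
    using vV[OF that] by (auto simp: V_space_def n_def)
  have Vn: "(V_norm ip (v t))\<^sup>2 = (LINT s|lebesgue_on {0..1}. (n t s)\<^sup>2)" for t
    unfolding V_norm_def n_def by (rule real_sqrt_pow2) (intro Bochner_Integration.integral_nonneg zero_le_power2)
  have iV: "integrable (lebesgue_on {0..1}) (\<lambda>t. (V_norm ip (v t))\<^sup>2)" using v by (auto simp: L2_V_def)
  \<comment> \<open>This elementary form of Cauchy-Schwarz separates the factors: one square is
    integrable by admissibility of the bundle, the other by membership in \<open>V_space\<close> and
    \<open>L2_V\<close>.\<close>
  have le: "ennreal (M s * n t s) \<le> ennreal (((M s)\<^sup>2 + (n t s)\<^sup>2) / 2)" for t s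
    using sum_squares_bound[of "M s" "n t s"] by (intro ennreal_leI) simp
  have fin: "(\<integral>\<^sup>+ s. ennreal (M s * n t s) * indicator {0..1} s \<partial>lborel) \<le> ennreal ((c + (V_norm ip (v t))\<^sup>2) / 2)"
    if t: "t \<in> {0..1}" for t
  proof -
    have "(\<integral>\<^sup>+ s. ennreal (M s * n t s) * indicator {0..1} s \<partial>lborel)
        \<le> (\<integral>\<^sup>+ s. ennreal (((M s)\<^sup>2 + (n t s)\<^sup>2) / 2) * indicator {0..1} s \<partial>lborel)"
      by (intro nn_integral_mono mult_right_mono le) auto
    also have "\<dots> = ennreal (LINT s|lebesgue_on {0..1}. ((M s)\<^sup>2 + (n t s)\<^sup>2) / 2)"
      by (rule nn_integral_unit_interval) (use iM i_n[OF t] in auto)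
    also have "(LINT s|lebesgue_on {0..1}. ((M s)\<^sup>2 + (n t s)\<^sup>2) / 2) = (c + (V_norm ip (v t))\<^sup>2) / 2"
      using iM i_n[OF t] by (simp add: c_def Vn)
    finally show ?thesis .
  qed
  show thesis
  proof (rule that[of "\<lambda>t s. M s * n t s"])
    fix t s :: real assume ts: "t \<in> {0..1}" "s \<in> {0..1}"
    show "v t s \<in> C1_fields \<Omega>" "norm_1_inf \<Omega> (v t s) \<le> ennreal (M s * n t s)"
      using M(2)[OF ts(2)] vH[OF ts] by (auto simp: admissible_rkhs_def n_def)
    show "0 \<le> M s * n t s" using M(1)[OF ts(2)] n0[OF ts] by simp
  next
    show "(\<integral>\<^sup>+ s. ennreal (M s * n t s) * indicator {0..1} s \<partial>lborel) < \<infinity>" if "t \<in> {0..1}" for t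
      using order.strict_trans1[OF fin[OF that] ennreal_less_top] by simp
    have "(\<integral>\<^sup>+ t. (\<integral>\<^sup>+ s. ennreal (M s * n t s) * indicator {0..1} s \<partial>lborel) * indicator {0..1} t \<partial>lborel)
      \<le> (\<integral>\<^sup>+ t. ennreal ((c + (V_norm ip (v t))\<^sup>2) / 2) * indicator {0..1} t \<partial>lborel)"
      by (rule nn_integral_mono) (use fin in \<open>auto simp: indicator_def\<close>)
    also have "\<dots> = ennreal (LINT t|lebesgue_on {0..1}. (c + (V_norm ip (v t))\<^sup>2) / 2)"
    proof (rule nn_integral_unit_interval)
      have "integrable (lebesgue_on {0..1}) (\<lambda>_::real. c)"
        by (subst integrable_restrict_space) (auto intro!: integrable_scaleR_left)
      then show "integrable (lebesgue_on {0..1}) (\<lambda>t. (c + (V_norm ip (v t))\<^sup>2) / 2)" using iV by auto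
      show "0 \<le> (c + (V_norm ip (v t))\<^sup>2) / 2" for t
        unfolding c_def by (intro divide_nonneg_pos add_nonneg_nonneg Bochner_Integration.integral_nonneg) auto
    qed
    finally show "(\<integral>\<^sup>+ t. (\<integral>\<^sup>+ s. ennreal (M s * n t s) * indicator {0..1} s \<partial>lborel) * indicator {0..1} t \<partial>lborel) < \<infinity>"
      using order.strict_trans1[OF _ ennreal_less_top] by simp
  qed
qed

text \<open>The first two parts of the conclusion ensure that the formula in the third is
  meaningful: without them, inverses, derivatives and the inner integral could be default values.
  Integrability in time is asserted for almost every \<open>s\<close>, since square integrability in
  both variables controls only almost every such section.\<close>

theorem theorem3p2:
  fixes \<Omega> :: "(real^'n) set"
    and H :: "real \<Rightarrow> (real^'n \<Rightarrow> real^'n) set"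
    and ip :: "real \<Rightarrow> (real^'n \<Rightarrow> real^'n) \<Rightarrow> (real^'n \<Rightarrow> real^'n) \<Rightarrow> real"
    and v :: "real \<Rightarrow> real \<Rightarrow> real^'n \<Rightarrow> real^'n"
    and \<psi> :: "real \<Rightarrow> real \<Rightarrow> real^'n \<Rightarrow> real^'n"
  assumes domain: "open \<Omega>" "connected \<Omega>" "\<Omega> \<noteq> {}"
    and adm: "admissible_bundle \<Omega> H ip"
    and ordered: "\<And>s t. 0 \<le> s \<Longrightarrow> s \<le> t \<Longrightarrow> t \<le> 1 \<Longrightarrow> H s \<subseteq> H t"
    and v_L2: "v \<in> L2_V \<Omega> H ip"
    and flow_t: "\<And>s. s \<in> {0..1} \<Longrightarrow>
                   is_flow \<Omega> (\<lambda>t x. LINT r:{0..s}|lebesgue. v t r x) (\<lambda>t. \<psi> s t)"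
  shows "(\<forall>s\<in>{0..1}. \<forall>t\<in>{0..1}. is_C1_diffeo \<Omega> (\<psi> s t))
    \<and> (AE s in lebesgue_on {0..1}. \<forall>x\<in>\<Omega>.
         (\<lambda>r. Ad \<Omega> (inv_into \<Omega> (\<psi> s r)) (v r s) x) absolutely_integrable_on {0..1})
    \<and> (\<forall>t\<in>{0..1}.
         is_flow \<Omega>
           (\<lambda>s. Ad \<Omega> (\<psi> s t)
                  (\<lambda>x. LINT r:{0..t}|lebesgue. Ad \<Omega> (inv_into \<Omega> (\<psi> s r)) (v r s) x))
           (\<lambda>s. \<psi> s t))"
proof -
  obtain B where vC: "\<And>t s. t \<in> {0..1} \<Longrightarrow> s \<in> {0..1} \<Longrightarrow> v t s \<in> C1_fields \<Omega>"
    and vB: "\<And>t s. t \<in> {0..1} \<Longrightarrow> s \<in> {0..1} \<Longrightarrow> norm_1_inf \<Omega> (v t s) \<le> ennreal (B t s)"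
    and B0: "\<And>t s. t \<in> {0..1} \<Longrightarrow> s \<in> {0..1} \<Longrightarrow> 0 \<le> B t s"
    and fin1: "\<And>t. t \<in> {0..1} \<Longrightarrow> (\<integral>\<^sup>+ s. ennreal (B t s) * indicator {0..1} s \<partial>lborel) < \<infinity>"
    and fin2: "(\<integral>\<^sup>+ t. (\<integral>\<^sup>+ s. ennreal (B t s) * indicator {0..1} s \<partial>lborel) * indicator {0..1} t \<partial>lborel) < \<infinity>"
    using L2_V_bound[OF adm v_L2] by blast
  \<comment> \<open>With 0 excluded, integrals over \<open>{..s}\<close> and \<open>{0..s}\<close> agree and vanish pointwise for \<open>s \<le> 0\<close>.\<close>
  let ?I = "{0<..1::real}"
  define v0 where "v0 t s x = (if t \<in> ?I \<and> s \<in> ?I then v t s x else 0)" for t s x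
  define B' where "B' t s = (if t \<in> ?I \<and> s \<in> ?I then B t s else 0)" for t s
  have I: "t \<in> ?I \<Longrightarrow> t \<in> {0..1}" for t by auto
  obtain E :: "(real \<times> real) set" and m where E: "E \<in> sets borel" "AE p in lborel. p \<in> E"
    and V_meas: "\<And>x. (\<lambda>p. if p \<in> E then v0 (fst p) (snd p) x else 0) \<in> borel_measurable borel"
    and m: "(\<lambda>p. m (fst p) (snd p)) \<in> borel_measurable borel" "\<And>t s. 0 \<le> m t s"
      "integrable (lborel \<Otimes>\<^sub>M lborel) (\<lambda>(t, s). m t s)"
      "\<And>t. integrable lborel (m t)" "\<And>s. integrable lborel (\<lambda>t. m t s)"
    and V_bound: "\<And>t s x. (t, s) \<in> E \<Longrightarrow> norm (v0 t s x) \<le> m t s"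
    and V_lip: "\<And>t s x y. (t, s) \<in> E \<Longrightarrow> norm (v0 t s x - v0 t s y) \<le> m t s * norm (x - y)"
  proof (rule borel_modification[of v0 B'])
    show "(\<lambda>p. v0 (fst p) (snd p) x) \<in> borel_measurable lebesgue" for x
    proof (cases "x \<in> \<Omega>")
      case True
      have "(\<lambda>p. v (fst p) (snd p) x) \<in> borel_measurable (lebesgue_on ({0..1} \<times> {0..1}))"
        using v_L2 True by (auto simp: L2_V_def split_def)
      then have "(\<lambda>p. v (fst p) (snd p) x) \<in> borel_measurable (lebesgue_on (?I \<times> ?I))"
        by (rule measurable_restrict_mono) auto
      moreover have "?I \<times> ?I \<in> sets (borel :: (real \<times> real) measure)"
        unfolding borel_prod[symmetric] by simp
      ultimately have "(\<lambda>p. indicator (?I \<times> ?I) p *\<^sub>R v (fst p) (snd p) x) \<in> borel_measurable lebesgue"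
        by (subst (asm) borel_measurable_restrict_space_iff) auto
      moreover have "(\<lambda>p. indicator (?I \<times> ?I) p *\<^sub>R v (fst p) (snd p) x) = (\<lambda>p. v0 (fst p) (snd p) x)"
        by (auto simp: v0_def indicator_def)
      ultimately show ?thesis by simp
    next
      case False
      then have "v0 t s x = 0" for t s using vC[OF I I, of t s] by (auto simp: v0_def C1_fields_def)
      then show ?thesis by simp
    qed
    show "norm (v0 t s x) \<le> B' t s" for t s x
      using C1_field_bounds(1)[OF domain(1) vC vB B0, OF I I I I I I] by (auto simp: v0_def B'_def)
    show "norm (v0 t s x - v0 t s y) \<le> B' t s * norm (x - y)" for t s x y
      using C1_field_bounds(2)[OF domain(1) vC vB B0, OF I I I I I I] by (auto simp: v0_def B'_def)
    have le: "(\<integral>\<^sup>+ s. ennreal (B' t s) \<partial>lborel) \<le> (\<integral>\<^sup>+ s. ennreal (B t s) * indicator {0..1} s \<partial>lborel) * indicator {0..1} t" for t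
    proof (cases "t \<in> {0..1}")
      case True
      then show ?thesis by (auto simp: B'_def indicator_def intro!: nn_integral_mono)
    qed (auto simp: B'_def)
    show "(\<integral>\<^sup>+ s. ennreal (B' t s) \<partial>lborel) < \<infinity>" for t
      by (rule order.strict_trans1[OF le]) (use fin1[of t] in \<open>auto simp: indicator_def\<close>)
    show "(\<integral>\<^sup>+ t. \<integral>\<^sup>+ s. ennreal (B' t s) \<partial>lborel \<partial>lborel) < \<infinity>"
      by (rule order.strict_trans1[OF nn_integral_mono[OF le] fin2])
  qed blast
  define V where "V t s x = (if (t, s) \<in> E then v0 t s x else 0)" for t s x
  have "\<forall>t s. \<exists>f'. t \<in> ?I \<longrightarrow> s \<in> ?I \<longrightarrow>
      (\<forall>x\<in>\<Omega>. (v t s has_derivative blinfun_apply (f' x)) (at x)) \<and> continuous_on \<Omega> f'"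
    using vC[OF I I] by (auto simp: C1_fields_def C1_on_def)
  then obtain D where D: "\<And>t s x. t \<in> ?I \<Longrightarrow> s \<in> ?I \<Longrightarrow> x \<in> \<Omega> \<Longrightarrow> (v t s has_derivative blinfun_apply (D t s x)) (at x)"
    "\<And>t s. t \<in> ?I \<Longrightarrow> s \<in> ?I \<Longrightarrow> continuous_on \<Omega> (D t s)" by metis
  define V' where "V' t s x = (if (t, s) \<in> E \<and> t \<in> ?I \<and> s \<in> ?I then D t s x else 0)" for t s x
  have V0: "V t s x = 0" if "t \<notin> ?I \<or> s \<notin> ?I" for t s x using that by (auto simp: V_def v0_def)
  have V_eq: "V t s = (if (t, s) \<in> E \<and> t \<in> ?I \<and> s \<in> ?I then v t s else (\<lambda>x. 0))" for t s
    by (auto simp: V_def v0_def)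
  interpret V: lipschitz_field_family \<Omega> V V' m
  proof
    show "(\<lambda>p. V (fst p) (snd p) x) \<in> borel_measurable borel" for x
      using V_meas[of x] by (simp add: V_def)
    show "norm (V t s x) \<le> m t s" for t s x using V_bound m(2) by (simp add: V_def)
    show "norm (V t s x - V t s y) \<le> m t s * norm (x - y)" for t s x y using V_lip m(2) by (simp add: V_def)
    show "V t s x = 0" if "x \<notin> \<Omega>" for t s x
      using that vC[OF I I, of t s] by (auto simp: V_eq C1_fields_def)
    show "(V t s has_derivative blinfun_apply (V' t s x)) (at x)" if "x \<in> \<Omega>" for t s x
      using D(1)[OF _ _ that, of t s] by (simp add: V_eq V'_def zero_blinfun.rep_eq)
    show "continuous_on \<Omega> (V' t s)" for t s
    proof -
      have "V' t s = (if (t, s) \<in> E \<and> t \<in> ?I \<and> s \<in> ?I then D t s else (\<lambda>x. 0))"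
        by (auto simp: V'_def)
      then show ?thesis using D(2)[of t s] by (simp only: split: if_split) auto
    qed
  qed (use domain m in auto)
  \<comment> \<open>Both orders are needed: \<open>AE1\<close> identifies integrals over the
    parameter in the given flow equation, \<open>AE2\<close> integrals over time in the asserted
    vector field.\<close>
  have AE1: "AE t in lborel. AE s in lborel. (t, s) \<in> E"
    by (rule lborel_pair.AE_pair[of "\<lambda>p. p \<in> E", unfolded lborel_prod, OF E(2)])
  have AE2: "AE s in lborel. AE t in lborel. (t, s) \<in> E"
  proof -
    have "E \<in> sets (lborel \<Otimes>\<^sub>M lborel)" using E(1) by (simp only: lborel_prod sets_lborel)
    moreover have "{p \<in> space (lborel \<Otimes>\<^sub>M lborel). (fst p, snd p) \<in> E} = E"
      by (auto simp: space_pair_measure)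
    ultimately show ?thesis
      using AE1 lborel_pair.AE_commute[of "\<lambda>t s. (t, s) \<in> E"] by (simp only:)
  qed
  \<comment> \<open>Beyond the unit interval \<open>W\<close> vanishes in \<open>t\<close> and is
    constant in \<open>s\<close> where clamping occurs, so the clamped flow solves the integral
    equation on the whole line with value \<open>x\<close> at minus infinity.\<close>
  define Y where "Y s t x = \<psi> (unit_clamp s) (unit_clamp t) x" for s t x
  have Y: "Y s t = \<psi> s t" if "s \<in> {0..1}" "t \<in> {0..1}" for s t
    using unit_clamp(2) that by (auto simp: Y_def)
  have W_clamp: "V.W (unit_clamp s) t x = V.W s t x" for s t x
    unfolding V.W_def by (rule primitive_unit_clamp) (simp add: V0)
  have W0: "V.W s t x = 0" if "t \<notin> ?I" for s t x
    using that by (simp add: V.W_def V0 primitive_def set_lebesgue_integral_def)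
  have flow_props: "\<psi> s 0 x = x"
      "(\<lambda>\<tau>. LINT r:{0..s}|lebesgue. v \<tau> r (\<psi> s \<tau> x)) absolutely_integrable_on {0..1}"
      "t \<in> {0..1} \<Longrightarrow> \<psi> s t x \<in> \<Omega>"
      "t \<in> {0..1} \<Longrightarrow> \<psi> s t x = x + (LINT \<tau>:{0..t}|lebesgue. LINT r:{0..s}|lebesgue. v \<tau> r (\<psi> s \<tau> x))"
    if "s \<in> {0..1}" "x \<in> \<Omega>" for s t x
    using flow_t[OF that(1), unfolded is_flow_def, THEN bspec, OF that(2)] by blast+
  have Y_cont: "continuous_on UNIV (\<lambda>t. Y s t x)" if "x \<in> \<Omega>" for s x
    unfolding Y_def
    by (rule clamped_primitive_continuous[OF flow_props(2)[OF unit_clamp(1) that] flow_props(4)[OF unit_clamp(1) that]])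
  interpret V: flow_family \<Omega> V V' m Y
  proof
    show "Y s t x \<in> \<Omega>" if "x \<in> \<Omega>" for s t x
      unfolding Y_def by (rule flow_props(3)[OF unit_clamp(1) that unit_clamp(1)])
    show "Y s t x = primitive x (\<lambda>\<tau>. V.W s \<tau> (Y s \<tau> x)) t" if x: "x \<in> \<Omega>" for s t x
    proof -
      let ?s = "unit_clamp s" and ?t = "unit_clamp t" and ?g = "\<lambda>\<tau>. V.W s \<tau> (Y s \<tau> x)"
      \<comment> \<open>The original and the Borel field have the same parameter integral for almost
        every time only, which is enough for the integrated equation.\<close>
      have "AE \<tau> in lborel. \<tau> \<in> ?I \<longrightarrow> (LINT r:{0..?s}|lebesgue. v \<tau> r (\<psi> ?s \<tau> x)) = ?g \<tau>"
        using AE1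
      proof eventually_elim
        case (elim \<tau>)
        show ?case
        proof
          assume \<tau>: "\<tau> \<in> ?I"
          have "(LINT r:{0..?s}|lebesgue. v \<tau> r (\<psi> ?s \<tau> x)) = (LBINT r:{..?s}. V \<tau> r (\<psi> ?s \<tau> x))"
          proof (rule lebesgue_set_integral_eq_lborel(1)[OF V.V_int1 _ _ unit_clamp(1)])
            show "AE r in lborel. r \<in> ?I \<longrightarrow> v \<tau> r (\<psi> ?s \<tau> x) = V \<tau> r (\<psi> ?s \<tau> x)"
              using elim by eventually_elim (use \<tau> in \<open>simp add: V_eq\<close>)
          qed (simp add: V0)
          also have "\<dots> = V.W ?s \<tau> (\<psi> ?s \<tau> x)" by (simp add: V.W_def primitive_def)
          also have "\<dots> = ?g \<tau>" using unit_clamp(2)[OF I[OF \<tau>]] by (simp add: Y_def W_clamp)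
          finally show "(LINT r:{0..?s}|lebesgue. v \<tau> r (\<psi> ?s \<tau> x)) = ?g \<tau>" .
        qed
      qed
      from lebesgue_set_integral_eq_lborel(1)[OF V.field.w_comp_integrable[OF Y_cont[OF x]] _ this unit_clamp(1)[of t]]
      have "(LINT \<tau>:{0..?t}|lebesgue. LINT r:{0..?s}|lebesgue. v \<tau> r (\<psi> ?s \<tau> x)) = (LBINT \<tau>:{..?t}. ?g \<tau>)"
        using W0 by blast
      then have "Y s t x = primitive x ?g ?t"
        using flow_props(4)[OF unit_clamp(1) x unit_clamp(1), of s t] by (simp add: Y_def primitive_def)
      also have "\<dots> = primitive x ?g t" by (rule primitive_unit_clamp) (rule W0)
      finally show ?thesis .
    qed
  qed (use domain Y_cont in auto)
  have bij: "bij_betw (\<psi> s t) \<Omega> \<Omega>" if "s \<in> {0..1}" "t \<in> {0..1}" for s t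
    using V.C1_diffeo(1)[of s t] Y[OF that] by simp
  have diffeo: "is_C1_diffeo \<Omega> (\<psi> s t)" if "s \<in> {0..1}" "t \<in> {0..1}" for s t
    unfolding is_C1_diffeo_def C1_on_def Y[OF that, symmetric]
  proof (intro conjI exI ballI)
    show "bij_betw (Y s t) \<Omega> \<Omega>" by (rule V.C1_diffeo(1))
    show "(Y s t has_derivative blinfun_apply (V.flow.J s x t)) (at x)" if "x \<in> \<Omega>" for x
      by (rule V.flow.flow_derivative[OF that])
    show "(inv_into \<Omega> (Y s t) has_derivative blinfun_apply (V.flow.K s (inv_into \<Omega> (Y s t) y) t)) (at y)"
      if "y \<in> \<Omega>" for y by (rule V.C1_diffeo(4)[OF that])
  qed (rule V.C1_diffeo)+
  have Ad_K: "Ad \<Omega> (inv_into \<Omega> (\<psi> s r)) u x = V.flow.K s x r (u (Y s r x))"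
    if "s \<in> {0..1}" "r \<in> {0..1}" "x \<in> \<Omega>" for s r x u
    using Ad_inverse_flow[OF bij[OF that(1,2)] that(3), of "blinfun_apply (V.flow.K s x r)"]
      V.flow.inverse_flow_derivative[OF that(3), of s r] by (simp add: Y[OF that(1,2)])
  have Ad_J: "Ad \<Omega> (\<psi> s t) u (\<psi> s t x) = V.flow.J s x t (u x)"
    if "s \<in> {0..1}" "t \<in> {0..1}" "x \<in> \<Omega>" for s t x u
    using Ad_at_flow[OF bij[OF that(1,2)] that(3), of "blinfun_apply (V.flow.J s x t)"]
      V.flow.flow_derivative[OF that(3), of s t] by (simp add: Y[OF that(1,2)])
  let ?k = "\<lambda>s x r. V.flow.K s x r (V r s (Y s r x))"
  have k0: "?k s x r = 0" if "r \<notin> ?I" for s x r using that by (simp add: V0 blinfun.zero_right)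
  have k_int: "integrable lborel (?k s x)" if "x \<in> \<Omega>" for s x by (rule V.KV_int[OF that V.flow_meas[OF that]])
  \<comment> \<open>The null set of parameters does not depend on \<open>x\<close>, since
    \<open>E\<close> serves all points at once.\<close>
  have AE3: "AE s in lborel. s \<in> ?I \<longrightarrow> (\<forall>x\<in>\<Omega>. AE r in lborel. r \<in> ?I \<longrightarrow>
      Ad \<Omega> (inv_into \<Omega> (\<psi> s r)) (v r s) x = ?k s x r)"
    using AE2
  proof eventually_elim
    case (elim s)
    show ?case
    proof (intro impI ballI)
      fix x assume s: "s \<in> ?I" and x: "x \<in> \<Omega>"
      show "AE r in lborel. r \<in> ?I \<longrightarrow> Ad \<Omega> (inv_into \<Omega> (\<psi> s r)) (v r s) x = ?k s x r"
        using elim by eventually_elim (use s x Ad_K[OF I I x] in \<open>auto simp: V_eq\<close>)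
    qed
  qed
  have part2: "AE s in lebesgue_on {0..1}. \<forall>x\<in>\<Omega>.
      (\<lambda>r. Ad \<Omega> (inv_into \<Omega> (\<psi> s r)) (v r s) x) absolutely_integrable_on {0..1}"
  proof -
    have "AE s in lborel. s \<in> {0..1} \<longrightarrow> (\<forall>x\<in>\<Omega>.
      (\<lambda>r. Ad \<Omega> (inv_into \<Omega> (\<psi> s r)) (v r s) x) absolutely_integrable_on {0..1})"
      \<comment> \<open>\<open>AE3\<close> speaks of \<open>{0<..1}\<close>; the remaining parameter
        0 is a null set.\<close>
      using AE3 AE_lborel_singleton[of 0]
    proof eventually_elim
      case (elim s)
      show ?case
      proof (intro impI ballI)
        fix x assume s: "s \<in> {0..1}" and x: "x \<in> \<Omega>"
        have "s \<in> ?I" using s elim(2) by auto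
        then show "(\<lambda>r. Ad \<Omega> (inv_into \<Omega> (\<psi> s r)) (v r s) x) absolutely_integrable_on {0..1}"
          using elim(1) x by (intro lebesgue_set_integral_eq_lborel(2)[OF k_int[OF x] k0]) auto
      qed
    qed
    then show ?thesis by (subst AE_restrict_space_iff) (auto simp: AE_completion_iff)
  qed
  have part3: "is_flow \<Omega>
       (\<lambda>s. Ad \<Omega> (\<psi> s t) (\<lambda>x. LINT r:{0..t}|lebesgue. Ad \<Omega> (inv_into \<Omega> (\<psi> s r)) (v r s) x))
       (\<lambda>s. \<psi> s t)" if t: "t \<in> {0..1}" for t
    unfolding is_flow_def
  proof (intro ballI conjI)
    fix x assume x: "x \<in> \<Omega>"
    let ?w = "\<lambda>s. Ad \<Omega> (\<psi> s t) (\<lambda>x. LINT r:{0..t}|lebesgue. Ad \<Omega> (inv_into \<Omega> (\<psi> s r)) (v r s) x) (\<psi> s t x)"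
    have wG: "AE s in lborel. s \<in> ?I \<longrightarrow> ?w s = V.G s x t"
      using AE3
    proof eventually_elim
      case (elim s)
      show ?case
      proof
        assume s: "s \<in> ?I"
        have "(LINT r:{0..t}|lebesgue. Ad \<Omega> (inv_into \<Omega> (\<psi> s r)) (v r s) x) = (LBINT r:{..t}. ?k s x r)"
          using elim s x by (intro lebesgue_set_integral_eq_lborel(1)[OF k_int[OF x] k0 _ t]) auto
        then show "?w s = V.G s x t"
          unfolding Ad_J[OF I[OF s] t x] by (simp add: V.G_def V.P_def primitive_def)
      qed
    qed
    have G0: "V.G s x t = 0" if "s \<notin> ?I" for s
      using that by (simp add: V.G_def V.P_def V0 primitive_def set_lebesgue_integral_def blinfun.zero_right)
    show "?w absolutely_integrable_on {0..1}"
      by (rule lebesgue_set_integral_eq_lborel(2)[OF V.G_int[OF x] G0 wG])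
    \<comment> \<open>The initial condition of the flow in \<open>s\<close>: at \<open>s = 0\<close>
      the integrated field is 0, so its flow in \<open>t\<close> is the identity.\<close>
    have Y0: "Y 0 t x = x"
    proof -
      have "V.W 0 \<tau> z = 0" for \<tau> z
      proof -
        have "indicator {..0} r *\<^sub>R V \<tau> r z = 0" for r using V0[of \<tau> r z] by (auto simp: indicator_def)
        then show ?thesis
          by (simp only: V.W_def primitive_def set_lebesgue_integral_def) simp
      qed
      then show ?thesis using V.flow_eq[OF x, of 0 t] by (simp add: primitive_def set_lebesgue_integral_def)
    qed
    then show "\<psi> 0 t x = x" using Y[of 0 t] t by simp
    fix s :: real assume s: "s \<in> {0..1}"
    show "\<psi> s t x \<in> \<Omega>" by (rule flow_props(3)[OF s x t])
    have G00: "primitive 0 (\<lambda>\<sigma>. V.G \<sigma> x t) 0 = 0"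
    proof -
      have "indicator {..0} r *\<^sub>R V.G r x t = 0" for r using G0[of r] by (auto simp: indicator_def)
      then show ?thesis by (simp only: primitive_def set_lebesgue_integral_def) simp
    qed
    have "\<psi> s t x = x + primitive 0 (\<lambda>\<sigma>. V.G \<sigma> x t) s"
      using V.flow_parameter_integral[OF x, of s t 0] Y0 Y[OF s t] G00 by (simp add: algebra_simps)
    also have "primitive 0 (\<lambda>\<sigma>. V.G \<sigma> x t) s = (LINT \<sigma>:{0..s}|lebesgue. ?w \<sigma>)"
      unfolding primitive_def add_0
      by (rule lebesgue_set_integral_eq_lborel(1)[OF V.G_int[OF x] G0 wG s, symmetric])
    finally show "\<psi> s t x = x + (LINT \<sigma>:{0..s}|lebesgue. ?w \<sigma>)" .
  qed
  show ?thesis using diffeo part2 part3 by blast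
qed

end
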